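(* Let $1\le m\le n$ be integers, let $(X,d)$ be a metric space, let $A\subset\mathbb{R}^n$ be a measurable set of positive measure, and let $f:A\to X$ be Lipschitz with $\operatorname{rank}\,\mathrm{md}_a(f,p)\ge m$ for a.e. $p\in A$. Then there is a countable family $\{K_i\}$ of pairwise disjoint compact subsets of $A$ such that $\mathcal{H}^n(A\setminus\bigcup_iK_i)=0$, and for each $i$ we have $\mathcal{H}^n(K_i)>0$ and there exist a $C^1$-diffeomorphism $G_i:\mathbb{R}^n\to\mathbb{R}^n=\mathbb{R}^m\times\mathbb{R}^{n-m}$ (onto $\mathbb{R}^n$) and a $\sqrt m$-Lipschitz map $\pi_i:X\to\mathbb{R}^m$ such that, with $F_i=f\circ G_i^{-1}$, the following hold: (A) $\mathcal{H}^m(f(A))>0$; (B) $(\pi_i\circ F_i)(x,y)=x$ for all $(x,y)\in G_i(K_i)$; (C) $F_i^{-1}(F_i(x,y))\cap G_i(K_i)\subset\{x\}\times\mathbb{R}^{n-m}$ for all $(x,y)\in G_i(K_i)$; (D) for all $y\in\mathbb{R}^{n-m}$ the maps $F_i|_{(\mathbb{R}^m\times\{y\})\cap G_i(K_i)}$ are bi-Lipschitz onto their images, with a bi-Lipschitz constant independent of $y$ (it may depend on $i$).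
   Context: A seminorm on $\mathbb{R}^n$ is a function $\sigma:\mathbb{R}^n\to[0,\infty)$ with $\sigma(\lambda v)=|\lambda|\sigma(v)$ and $\sigma(v+w)\le\sigma(v)+\sigma(w)$. Its rank is $\operatorname{rank}\sigma=n-\dim\{v:\sigma(v)=0\}$. A measurable map $f:A\to(X,d)$ on a measurable set $A\subset\mathbb{R}^n$ is approximately metrically differentiable at $x\in A$ if there are a measurable set $A_x\subset A$ having $x$ as a Lebesgue density point and a seminorm $\sigma_x$ on $\mathbb{R}^n$ such that $\lim_{A_x\ni y\to x}\frac{d(f(y),f(x))-\sigma_x(y-x)}{|y-x|}=0$; $\sigma_x$ is then unique and is denoted $\mathrm{md}_a(f,x)$. (For Lipschitz $f$ it exists at almost every $x\in A$, by Kirchheim's theorem.) $\mathcal{H}^s$ is the $s$-dimensional Hausdorff measure, normalized so that $\mathcal{H}^n$ equals Lebesgue measure on $\mathbb{R}^n$. $\mathbb{R}^m$ carries the Euclidean norm. *)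

theory Defs
  imports "HOL-Analysis.Analysis"
begin

definition is_seminorm :: "('a::real_vector \<Rightarrow> real) \<Rightarrow> bool" where
  "is_seminorm \<sigma> \<longleftrightarrow>
     (\<forall>v. 0 \<le> \<sigma> v) \<and>
     (\<forall>c v. \<sigma> (c *\<^sub>R v) = \<bar>c\<bar> * \<sigma> v) \<and>
     (\<forall>v w. \<sigma> (v + w) \<le> \<sigma> v + \<sigma> w)"

definition seminorm_rank :: "('a::euclidean_space \<Rightarrow> real) \<Rightarrow> nat" where
  "seminorm_rank \<sigma> = DIM('a) - dim {v. \<sigma> v = 0}"

definition lebesgue_density_point :: "'a::euclidean_space \<Rightarrow> 'a set \<Rightarrow> bool" where
  "lebesgue_density_point x S \<longleftrightarrow>
     ((\<lambda>r. measure lebesgue (S \<inter> ball x r) / measure lebesgue (ball x r)) \<longlongrightarrow> 1) (at_right 0)"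

text \<open>A map on \<open>A\<close> is given by a total function of which only the values on \<open>A\<close> are used.\<close>

definition has_approx_metric_differential ::
    "('a::euclidean_space \<Rightarrow> 'x::metric_space) \<Rightarrow> 'a set \<Rightarrow> 'a \<Rightarrow> ('a \<Rightarrow> real) \<Rightarrow> bool" where
  "has_approx_metric_differential f A x \<sigma> \<longleftrightarrow>
     x \<in> A \<and> is_seminorm \<sigma> \<and>
     (\<exists>B. B \<in> sets lebesgue \<and> B \<subseteq> A \<and> lebesgue_density_point x B \<and>
        ((\<lambda>y. (dist (f y) (f x) - \<sigma> (y - x)) / norm (y - x)) \<longlongrightarrow> 0) (at x within B))"

text \<open>The approximate metric differential is unique where it exists; elsewhere the value of
  the following description is unspecified.\<close>

definition md_a ::
    "('a::euclidean_space \<Rightarrow> 'x::metric_space) \<Rightarrow> 'a set \<Rightarrow> 'a \<Rightarrow> ('a \<Rightarrow> real)" where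
  "md_a f A x = (THE \<sigma>. has_approx_metric_differential f A x \<sigma>)"

text \<open>Hausdorff (outer) measure of dimension \<open>s \<ge> 0\<close>, defined on all subsets. The factor
  \<open>unit_ball_vol s / 2 powr s\<close> normalizes it to Lebesgue measure in integer dimensions.
  The case distinctions give the empty set weight \<open>0\<close> and, for \<open>s = 0\<close>, make up for
  \<open>0 powr 0 = 0\<close>. Boundedness is required because \<open>diameter\<close> is
  meaningless on unbounded sets.\<close>

definition hausdorff_weight :: "real \<Rightarrow> 'a::metric_space set \<Rightarrow> ennreal" where
  "hausdorff_weight s U =
     (if U = {} then 0
      else if s = 0 then 1
      else ennreal (unit_ball_vol s * (diameter U / 2) powr s))"

definition hausdorff_content :: "real \<Rightarrow> real \<Rightarrow> 'a::metric_space set \<Rightarrow> ennreal" where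
  "hausdorff_content s \<delta> S =
     (INF U \<in> {U :: nat \<Rightarrow> 'a set. S \<subseteq> (\<Union>i. U i) \<and> (\<forall>i. bounded (U i) \<and> diameter (U i) \<le> \<delta>)}.
        \<Sum>i. hausdorff_weight s (U i))"

definition hausdorff_measure :: "real \<Rightarrow> 'a::metric_space set \<Rightarrow> ennreal" where
  "hausdorff_measure s S = (SUP \<delta> \<in> {0<..}. hausdorff_content s \<delta> S)"

definition C1_map :: "('a::real_normed_vector \<Rightarrow> 'b::real_normed_vector) \<Rightarrow> bool" where
  "C1_map g \<longleftrightarrow>
     (\<exists>g' :: 'a \<Rightarrow> ('a \<Rightarrow>\<^sub>L 'b).
        (\<forall>x. (g has_derivative blinfun_apply (g' x)) (at x)) \<and> continuous_on UNIV g')"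

definition C1_diffeomorphism :: "('a::real_normed_vector \<Rightarrow> 'b::real_normed_vector) \<Rightarrow> bool" where
  "C1_diffeomorphism G \<longleftrightarrow> bij G \<and> C1_map G \<and> C1_map (inv G)"

definition bilipschitz_on ::
    "real \<Rightarrow> 'a::metric_space set \<Rightarrow> ('a \<Rightarrow> 'b::metric_space) \<Rightarrow> bool" where
  "bilipschitz_on L S g \<longleftrightarrow>
     1 \<le> L \<and>
     (\<forall>u\<in>S. \<forall>v\<in>S. dist u v / L \<le> dist (g u) (g v) \<and> dist (g u) (g v) \<le> L * dist u v)"

text \<open>An injection \<open>\<iota>\<close> of index types, which exists iff \<open>m = CARD('m) \<le> n = CARD('n)\<close>, selects
  the \<open>m\<close> coordinates that form the first factor of \<open>\<real>^n = \<real>^m \<times> \<real>^(n-m)\<close>. The second factor is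
  represented by the coordinate subspace \<open>{0} \<times> \<real>^(n-m)\<close> of \<open>\<real>^n\<close>, since a separate type
  \<open>real ^ 'k\<close> could not have dimension \<open>0\<close>, which occurs when \<open>m = n\<close>.\<close>

definition fst_part :: "('m::finite \<Rightarrow> 'n::finite) \<Rightarrow> real ^ 'n \<Rightarrow> real ^ 'm" where
  "fst_part \<iota> z = (\<chi> i. z $ \<iota> i)"

definition snd_part :: "('m::finite \<Rightarrow> 'n::finite) \<Rightarrow> real ^ 'n \<Rightarrow> real ^ 'n" where
  "snd_part \<iota> z = (\<chi> j. if j \<in> range \<iota> then 0 else z $ j)"

end

theory Submission
  imports Defs
begin

text \<open>Let \<open>a k\<close> be dense in \<open>A\<close> and let \<open>u k\<close> be a Lipschitz extension of
  \<open>p \<mapsto> dist (f p) (f (a k))\<close>. Almost everywhere all the \<open>u k\<close> are differentiable and the metric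
  differential of \<open>f\<close> is the supremum of the absolute values of their differentials (Kirchheim). So
  where its rank is at least \<open>m\<close>, some \<open>m\<close> of the gradients are linearly independent. On a piece of
  positive measure the corresponding \<open>m\<close> functions differ from fixed linear forms by maps of
  small Lipschitz constant, which by Lusin approximation agree with \<open>C\<^sup>1\<close> functions of small gradient
  on a compact set \<open>K\<close> of positive measure. Completing the linear forms to an isomorphism and adding
  the \<open>C\<^sup>1\<close> corrections gives the diffeomorphism \<open>G\<close>; the map \<open>\<pi>\<close> consists of the distances to
  the \<open>m\<close> points \<open>f (a k)\<close>. The sets \<open>K\<close> exhaust \<open>A\<close>.\<close>

section \<open>Lebesgue density and porosity\<close>

text \<open>Two obstacles shape the proof. The gradients come without any measurability statement,
  so the pieces on which they are almost constant are arbitrary sets. What is tracked is only that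
  they are not negligible, a property that some member of every countable cover inherits.
  Measurability returns at a single point, by replacing a piece \<open>T\<close> with
  \<open>closure T \<inter> B\<close>; this is harmless because a small Lipschitz constant survives
  the closure. Moreover \<open>G\<close> has to be a diffeomorphism of the whole space, so a local
  inverse theorem is not enough. The correction of the linear isomorphism must have a Lipschitz
  constant below the lower bound of that isomorphism; the contraction principle then inverts the sum
  globally. This is why the Lusin approximation has to bound the gradient everywhere, not only on
  the set where the functions agree. Once \<open>\<pi> (f x)\<close> equals the first part of
  \<open>G x\<close> on \<open>K\<close>, properties (B), (C) and (D) are formal consequences. The
  factor \<open>sqrt m\<close> compares the maximum norm with the Euclidean norm. Since
  \<open>md_a\<close> is a definite description, uniqueness of the metric differential is needed
  besides existence.\<close>

lemma mcshane_extension: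
  fixes u :: "'a::metric_space \<Rightarrow> real"
  assumes u: "L-lipschitz_on S u"
  obtains w where "L-lipschitz_on UNIV w" "\<And>x. x \<in> S \<Longrightarrow> w x = u x"
proof (cases "S = {}")
  case True
  then show ?thesis
    using that[of "\<lambda>_. 0"] lipschitz_on_constant lipschitz_on_nonneg[OF u]
    by (metis empty_iff lipschitz_on_mono order_refl)
next
  case False
  have L: "0 \<le> L" using lipschitz_on_nonneg[OF u] .
  \<comment> \<open>The largest \<open>L\<close>-Lipschitz extension: an infimum of
    \<open>L\<close>-Lipschitz functions of \<open>x\<close>, bounded below by
    \<open>bd\<close>.\<close>
  define w where "w x = (INF s\<in>S. u s + L * dist x s)" for x
  obtain s0 where s0: "s0 \<in> S" using False by blast
  have bd: "u s0 - L * dist x s0 \<le> u s + L * dist x s" if "s \<in> S" for x s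
  proof -
    have "u s0 - u s \<le> L * dist s0 s"
      using lipschitz_onD[OF u s0 that] by (auto simp: dist_real_def)
    also have "\<dots> \<le> L * (dist x s0 + dist x s)"
      by (intro mult_left_mono L) (metis dist_commute dist_triangle)
    finally show ?thesis by (simp add: algebra_simps)
  qed
  have bb: "bdd_below ((\<lambda>s. u s + L * dist x s) ` S)" for x
    using bd by (auto intro!: bdd_belowI2)
  have step: "w x \<le> w y + L * dist x y" for x y
  proof -
    have "w x - L * dist x y \<le> u s + L * dist y s" if "s \<in> S" for s
    proof -
      have "w x \<le> u s + L * dist x s"
        unfolding w_def by (rule cINF_lower[OF bb that])
      also have "\<dots> \<le> u s + L * (dist x y + dist y s)"
        by (intro add_left_mono mult_left_mono L dist_triangle)
      finally show ?thesis by (simp add: algebra_simps)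
    qed
    then have "w x - L * dist x y \<le> w y"
      unfolding w_def[of y] by (intro cINF_greatest False)
    then show ?thesis by simp
  qed
  show ?thesis
  proof
    show "L-lipschitz_on UNIV w"
      using step[of x y for x y] step[of y x for x y]
      by (intro lipschitz_onI L) (auto simp: dist_real_def abs_le_iff dist_commute algebra_simps, metis add.commute dist_commute)
    fix x assume x: "x \<in> S"
    have "w x \<le> u x + L * dist x x"
      unfolding w_def by (rule cINF_lower[OF bb x])
    moreover have "u x \<le> w x"
      unfolding w_def
    proof (rule cINF_greatest[OF False])
      fix s assume "s \<in> S"
      then show "u x \<le> u s + L * dist x s"
        using lipschitz_onD[OF u x \<open>s \<in> S\<close>] by (auto simp: dist_real_def)
    qed
    ultimately show "w x = u x" by simp
  qed
qed

text \<open>Vitali's covering lemma inside an open set of tiny measure: disjoint balls have small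
  total volume, and their five-fold enlargements cover \<open>N\<close>. It serves both absolute
  continuity and Hausdorff null sets.\<close>

lemma negligible_cball_cover:
  fixes N :: "'a::euclidean_space set"
  assumes N: "negligible N" and "0 < \<epsilon>" "0 < \<delta>"
  obtains a :: "nat \<Rightarrow> 'a" and r :: "nat \<Rightarrow> real"
  where "\<And>i. 0 \<le> r i" "\<And>i. r i \<le> \<delta>" "N \<subseteq> (\<Union>i. cball (a i) (r i))"
    "(\<Sum>i. ennreal (r i ^ DIM('a))) \<le> ennreal \<epsilon>"
proof (cases "N = {}")
  case True
  show ?thesis
  proof (rule that[of "\<lambda>_. 0" "\<lambda>_. 0"])
    show "N \<subseteq> (\<Union>i. cball ((\<lambda>_. 0) i) ((\<lambda>_. 0) i))" using True by blast
    show "(\<Sum>i. ennreal ((\<lambda>_. 0) i ^ DIM('a))) \<le> ennreal \<epsilon>" by (simp add: zero_power)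
  qed (use \<open>0 < \<delta>\<close> in simp_all)
next
  case False
  \<comment> \<open>Chosen so that a ball of radius \<open>R\<close> has volume
    \<open>v * (5 * R) ^ DIM('a)\<close>, which absorbs the enlargement factor.\<close>
  define v where "v = unit_ball_vol (real DIM('a)) / 5 ^ DIM('a)"
  have v: "v > 0" by (simp add: v_def)
  have Ns: "N \<in> null_sets lebesgue"
    using N by (simp add: negligible_iff_null_sets)
  obtain U where U: "open U" "N \<subseteq> U" "U - N \<in> lmeasurable" "emeasure lebesgue (U - N) < ennreal (v * \<epsilon>)"
    using sets_lebesgue_outer_open[of N "v * \<epsilon>"] Ns v \<open>0 < \<epsilon>\<close> by (auto intro: null_setsD2)
  have "emeasure lebesgue U = emeasure lebesgue (U - N)"
    using U Ns by (subst emeasure_Diff_null_set) auto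
  with U have Um: "emeasure lebesgue U \<le> ennreal (v * \<epsilon>)" by simp
  have "\<exists>r. 0 < r \<and> r \<le> \<delta>/5 \<and> cball x r \<subseteq> U" if "x \<in> N" for x
  proof -
    have "x \<in> U" using U(2) that by (rule subsetD)
    then obtain e where "e > 0" "cball x e \<subseteq> U" using U(1) open_contains_cball by metis
    then show ?thesis
      using \<open>0 < \<delta>\<close> by (intro exI[of _ "min e (\<delta>/5)"]) auto
  qed
  then obtain R where R: "\<And>x. x \<in> N \<Longrightarrow> 0 < R x \<and> R x \<le> \<delta>/5 \<and> cball x (R x) \<subseteq> U" by metis
  obtain C where C: "countable C" "C \<subseteq> N"
    and dis: "pairwise (\<lambda>i j. disjnt (cball i (R i)) (cball j (R j))) C"
    and cov: "N \<subseteq> (\<Union>i\<in>C. cball i (5 * R i))"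
    using Vitali_covering_lemma_cballs[of N "\<lambda>x. x" R N "\<delta>/5"] R
    by (smt (verit, ccfv_SIG) UN_iff centre_in_cball less_imp_le subsetI)
  have Cne: "C \<noteq> {}" using False cov by auto
  have "(\<integral>\<^sup>+i. emeasure lebesgue (cball i (R i)) \<partial>count_space C) = emeasure lebesgue (\<Union>i\<in>C. cball i (R i))"
    using dis by (intro emeasure_UN_countable[symmetric] C) (auto simp: disjoint_family_on_def pairwise_def disjnt_def)
  also have "\<dots> \<le> emeasure lebesgue U"
    using C R U by (intro emeasure_mono) auto
  also note Um
  finally have 1: "(\<integral>\<^sup>+i. emeasure lebesgue (cball i (R i)) \<partial>count_space C) \<le> ennreal (v * \<epsilon>)" .
  have 2: "emeasure lebesgue (cball i (R i)) = ennreal v * ennreal ((5 * R i) ^ DIM('a))" if "i \<in> C" for i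
  proof -
    have "0 \<le> R i" using R[of i] C that by force
    then have "emeasure lebesgue (cball i (R i)) = ennreal (unit_ball_vol (real DIM('a)) * R i ^ DIM('a))"
      by (simp add: emeasure_cball)
    also have "unit_ball_vol (real DIM('a)) * R i ^ DIM('a) = v * (5 * R i) ^ DIM('a)"
      by (simp add: v_def power_mult_distrib)
    finally show ?thesis using v \<open>0 \<le> R i\<close> by (simp add: ennreal_mult)
  qed
  have 3: "(\<integral>\<^sup>+i. ennreal ((5 * R i) ^ DIM('a)) \<partial>count_space C) \<le> ennreal \<epsilon>"
  proof -
    have "ennreal v * (\<integral>\<^sup>+i. ennreal ((5 * R i) ^ DIM('a)) \<partial>count_space C)
      = (\<integral>\<^sup>+i. emeasure lebesgue (cball i (R i)) \<partial>count_space C)"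
      by (subst nn_integral_cmult[symmetric], simp, rule nn_integral_cong) (simp only: 2 space_count_space)
    also have "\<dots> \<le> ennreal v * ennreal \<epsilon>"
      using 1 v \<open>0 < \<epsilon>\<close> by (simp add: ennreal_mult)
    finally show ?thesis
      using v by (metis ennreal_mult_le_mult_iff ennreal_neq_top ennreal_0 ennreal_eq_zero_iff less_le not_less)
  qed
  \<comment> \<open>If \<open>C\<close> is finite, \<open>from_nat_into\<close> repeats its
    elements. Radius \<open>0\<close> at the surplus indices keeps the sum from counting a ball
    twice.\<close>
  define \<rho> where "\<rho> i = (if i \<in> to_nat_on C ` C then 5 * R (from_nat_into C i) else 0)" for i
  show ?thesis
  proof
    fix i
    show "0 \<le> \<rho> i" "\<rho> i \<le> \<delta>"
      using from_nat_into[OF Cne, of i] C R[of "from_nat_into C i"] \<open>0 < \<delta>\<close> by (force simp: \<rho>_def)+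
  next
    show "N \<subseteq> (\<Union>i. cball (from_nat_into C i) (\<rho> i))"
    proof
      fix x assume "x \<in> N"
      then obtain c where c: "c \<in> C" "x \<in> cball c (5 * R c)" using cov by blast
      then have "x \<in> cball (from_nat_into C (to_nat_on C c)) (\<rho> (to_nat_on C c))"
        using C by (simp add: \<rho>_def)
      then show "x \<in> (\<Union>i. cball (from_nat_into C i) (\<rho> i))" by blast
    qed
    have "(\<Sum>i. ennreal (\<rho> i ^ DIM('a))) = (\<integral>\<^sup>+i. ennreal (\<rho> i ^ DIM('a)) \<partial>count_space UNIV)"
      by (simp add: nn_integral_count_space_nat)
    also have "\<dots> = (\<integral>\<^sup>+i. ennreal (\<rho> i ^ DIM('a)) \<partial>count_space (to_nat_on C ` C))"
      by (rule nn_integral_count_space_eq) (auto simp: \<rho>_def)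
    also have "\<dots> = (\<integral>\<^sup>+i. ennreal ((5 * R i) ^ DIM('a)) \<partial>count_space C)"
      using C by (subst nn_integral_bij_count_space[symmetric, of "to_nat_on C" C])
        (auto intro!: nn_integral_cong inj_on_imp_bij_betw inj_on_to_nat_on simp: \<rho>_def)
    finally show "(\<Sum>i. ennreal (\<rho> i ^ DIM('a))) \<le> ennreal \<epsilon>" using 3 by simp
  qed
qed


text \<open>Where density fails, the complement of \<open>A\<close> fills a fixed fraction
  \<epsilon> of arbitrarily small balls. Disjoint such balls inside an open \<open>T\<close>
  containing \<open>A\<close> cover almost all of these points, and \<epsilon> times their total
  volume is at most the measure of \<open>T - A\<close>, which is as small as desired.\<close>

lemma lebesgue_density_theorem:
  fixes A :: "'a::euclidean_space set"
  assumes A: "A \<in> sets lebesgue"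
  shows "negligible {x\<in>A. \<not> lebesgue_density_point x A}"
proof -
  let ?S = "\<lambda>\<epsilon>. {x\<in>A. \<forall>d>0. \<exists>r. 0 < r \<and> r < d \<and>
              \<epsilon> * measure lebesgue (cball x r) \<le> measure lebesgue (cball x r - A)}"
  have neg: "negligible (?S \<epsilon>)" if "\<epsilon> > 0" for \<epsilon>
    unfolding negligible_outer_le
  proof (intro allI impI)
    fix e :: real assume "e > 0"
    obtain T where T: "open T" "A \<subseteq> T" "T - A \<in> lmeasurable" "emeasure lebesgue (T - A) < ennreal (e * \<epsilon>)"
      using sets_lebesgue_outer_open[OF A, of "e * \<epsilon>"] \<open>e > 0\<close> \<open>\<epsilon> > 0\<close> by auto
    define K where "K = {(x,r). 0 < r \<and> cball x r \<subseteq> T \<and> \<epsilon> * measure lebesgue (cball x r) \<le> measure lebesgue (cball x r - A)}"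
    have ex: "\<exists>i. i \<in> K \<and> x \<in> cball (fst i) (snd i) \<and> snd i < d" if "x \<in> ?S \<epsilon>" "0 < d" for x d
    proof -
      obtain d' where d': "d' > 0" "cball x d' \<subseteq> T"
        using \<open>open T\<close> \<open>A \<subseteq> T\<close> \<open>x \<in> ?S \<epsilon>\<close> open_contains_cball by blast
      obtain r where "0 < r" "r < min d d'" "\<epsilon> * measure lebesgue (cball x r) \<le> measure lebesgue (cball x r - A)"
        using \<open>x \<in> ?S \<epsilon>\<close> \<open>0 < d\<close> d' by (smt (verit, best) mem_Collect_eq min_less_iff_conj)
      then show ?thesis
        using d' by (intro exI[of _ "(x,r)"]) (auto simp: K_def)
    qed
    have K0: "0 < snd i" if "i \<in> K" for i using that by (auto simp: K_def)
    obtain C where C: "countable C" "C \<subseteq> K"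
      and dis: "pairwise (\<lambda>i j. disjnt (cball (fst i) (snd i)) (cball (fst j) (snd j))) C"
      and neg: "negligible (?S \<epsilon> - (\<Union>i\<in>C. cball (fst i) (snd i)))"
      using Vitali_covering_theorem_cballs[of K snd "?S \<epsilon>" fst, OF _ ex] K0 by blast
    let ?W = "\<Union>i\<in>C. cball (fst i) (snd i)"
    have W: "?W \<in> sets lebesgue" using C by (intro sets.countable_UN') auto
    have le: "ennreal \<epsilon> * emeasure lebesgue (cball (fst i) (snd i)) \<le> emeasure lebesgue (cball (fst i) (snd i) - A)" if "i \<in> C" for i
    proof -
      have "\<epsilon> * measure lebesgue (cball (fst i) (snd i)) \<le> measure lebesgue (cball (fst i) (snd i) - A)"
        using C that by (auto simp: K_def)
      moreover have "cball (fst i) (snd i) \<in> lmeasurable" "cball (fst i) (snd i) - A \<in> lmeasurable"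
        using A by (auto intro: fmeasurable_Diff)
      ultimately show ?thesis
        using \<open>\<epsilon> > 0\<close> by (simp add: emeasure_eq_measure2 ennreal_mult[symmetric] ennreal_leI)
    qed
    have dis2: "disjoint_family_on (\<lambda>i. cball (fst i) (snd i)) C"
      using dis unfolding disjoint_family_on_def pairwise_def disjnt_def by blast
    have "ennreal \<epsilon> * emeasure lebesgue ?W = ennreal \<epsilon> * (\<integral>\<^sup>+i. emeasure lebesgue (cball (fst i) (snd i)) \<partial>count_space C)"
      using C dis2 by (subst emeasure_UN_countable) auto
    also have "\<dots> = (\<integral>\<^sup>+i. ennreal \<epsilon> * emeasure lebesgue (cball (fst i) (snd i)) \<partial>count_space C)"
      by (rule nn_integral_cmult[symmetric]) auto
    also have "\<dots> \<le> (\<integral>\<^sup>+i. emeasure lebesgue (cball (fst i) (snd i) - A) \<partial>count_space C)"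
      by (intro nn_integral_mono) (use le in auto)
    also have "\<dots> = emeasure lebesgue (\<Union>i\<in>C. cball (fst i) (snd i) - A)"
      proof (rule emeasure_UN_countable[symmetric])
      show "disjoint_family_on (\<lambda>i. cball (fst i) (snd i) - A) C"
        using dis2 unfolding disjoint_family_on_def by blast
    qed (use C A in auto)
    also have "\<dots> \<le> emeasure lebesgue (T - A)"
    proof (rule emeasure_mono)
      show "(\<Union>i\<in>C. cball (fst i) (snd i) - A) \<subseteq> T - A"
      proof clarify
        fix x a b assume "(a,b) \<in> C" "x \<in> cball (fst (a,b)) (snd (a,b))" "x \<notin> A"
        then have "(a,b) \<in> K" "x \<in> cball a b" using C(2) by auto
        then show "x \<in> T" unfolding K_def by blast
      qed
    qed (use T A in auto)
    also have "\<dots> \<le> ennreal \<epsilon> * ennreal e"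
      using T \<open>e > 0\<close> \<open>\<epsilon> > 0\<close> by (simp add: ennreal_mult[symmetric] mult.commute)
    finally have We: "emeasure lebesgue ?W \<le> ennreal e"
      using \<open>\<epsilon> > 0\<close> by (subst (asm) ennreal_mult_le_mult_iff) auto
    have Wf: "?W \<in> lmeasurable" "measure lebesgue ?W \<le> e"
      using W We \<open>e > 0\<close> le_less_trans[OF We ennreal_less_top]
      unfolding fmeasurable_def measure_def by (auto intro: enn2real_leI)
    show "\<exists>T. ?S \<epsilon> \<subseteq> T \<and> T \<in> lmeasurable \<and> measure lebesgue T \<le> e"
    proof (intro exI[of _ "(?S \<epsilon> - ?W) \<union> ?W"] conjI)
      show "(?S \<epsilon> - ?W) \<union> ?W \<in> lmeasurable"
        using neg Wf by (intro fmeasurable.Un) (auto simp: negligible_imp_measurable)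
      have "measure lebesgue ((?S \<epsilon> - ?W) \<union> ?W) \<le> measure lebesgue (?S \<epsilon> - ?W) + measure lebesgue ?W"
        using neg Wf by (intro measure_Un_le) (auto simp: negligible_imp_sets)
      also have "\<dots> \<le> e" using neg Wf by (simp add: negligible_imp_measure0)
      finally show "measure lebesgue ((?S \<epsilon> - ?W) \<union> ?W) \<le> e" .
    qed auto
  qed
  have "{x\<in>A. \<not> lebesgue_density_point x A} \<subseteq> (\<Union>n. ?S (1 / real (Suc n)))"
  proof (rule subsetI, rule ccontr)
    fix x assume x: "x \<in> {x\<in>A. \<not> lebesgue_density_point x A}" and "x \<notin> (\<Union>n. ?S (1 / real (Suc n)))"
    then have *: "\<exists>d>0. \<forall>r. 0 < r \<and> r < d \<longrightarrow> measure lebesgue (cball x r - A) < 1 / real (Suc n) * measure lebesgue (cball x r)" for n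
      by (auto simp: not_le) (meson not_le)
    have "lebesgue_density_point x A"
      unfolding lebesgue_density_point_def
    proof (rule tendstoI)
      fix e :: real assume "e > 0"
      then obtain n where n: "1 / real (Suc n) < e"
        using nat_approx_posE by blast
      obtain d where "d > 0" and d: "\<And>r. 0 < r \<Longrightarrow> r < d \<Longrightarrow> measure lebesgue (cball x r - A) < 1 / real (Suc n) * measure lebesgue (cball x r)"
        using *[of n] by blast
      show "\<forall>\<^sub>F r in at_right 0. dist (measure lebesgue (A \<inter> ball x r) / measure lebesgue (ball x r)) 1 < e"
        unfolding eventually_at_right_field
      proof (intro exI[of _ d] conjI allI impI)
        fix r :: real assume elim: "0 < r" "r < d"
        have pos: "0 < measure lebesgue (ball x r)" using elim by (simp add: content_ball_gt_0_iff)
        have eq: "measure lebesgue (cball x r) = measure lebesgue (ball x r)"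
          using elim by (simp add: content_cball content_ball)
        have "measure lebesgue (ball x r - A \<inter> ball x r) = measure lebesgue (ball x r) - measure lebesgue (A \<inter> ball x r)"
          using A by (intro measurable_measure_Diff) auto
        then have "measure lebesgue (ball x r) = measure lebesgue (A \<inter> ball x r) + measure lebesgue (ball x r - A)"
          by (simp add: Diff_Int)
        moreover have "measure lebesgue (ball x r - A) \<le> measure lebesgue (cball x r - A)"
          using A by (intro measure_mono_fmeasurable fmeasurable_Diff sets.Diff) (auto intro: order.strict_implies_order)
        ultimately have "\<bar>measure lebesgue (A \<inter> ball x r) - measure lebesgue (ball x r)\<bar> < e * measure lebesgue (ball x r)"
          using d[of r] elim eq n pos measure_nonneg[of lebesgue "ball x r - A"]
          by (smt (verit, best) mult_right_mono)
        then show "dist (measure lebesgue (A \<inter> ball x r) / measure lebesgue (ball x r)) 1 < e"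
          using pos by (simp add: dist_real_def field_simps abs_if split: if_splits)
      qed (fact \<open>d > 0\<close>)
    qed
    with x show False by simp
  qed
  moreover have "negligible (\<Union>n. ?S (1 / real (Suc n)))"
    by (intro negligible_Union_nat neg) simp
  ultimately show ?thesis by (rule negligible_subset[rotated])
qed


text \<open>A hole of radius \<open>e * norm h\<close> around \<open>x + h\<close> would remove from
  \<open>S\<close> a fixed fraction of the ball of radius \<open>2 * norm h\<close> around
  \<open>x\<close>, at arbitrarily small scales.\<close>

lemma density_imp_nonporous:
  fixes S :: "'a::euclidean_space set"
  assumes S: "S \<in> sets lebesgue" and d: "lebesgue_density_point x S" and "0 < e"
  shows "\<exists>d>0. \<forall>h. h \<noteq> 0 \<and> norm h < d \<longrightarrow> (\<exists>q\<in>S. dist q (x + h) \<le> e * norm h)"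
proof -
  \<comment> \<open>With \<open>e' \<le> 1\<close> the hole lies inside the ball of radius
    \<open>2 * norm h\<close>; the number \<eta> below is the ratio of the two volumes.\<close>
  define e' where "e' = min e 1"
  have e': "0 < e'" "e' \<le> e" "e' \<le> 1" using \<open>0 < e\<close> by (auto simp: e'_def)
  define \<eta> where "\<eta> = (e' / 2) ^ DIM('a)"
  have \<eta>: "\<eta> > 0" using e' by (simp add: \<eta>_def)
  have "\<forall>\<^sub>F r in at_right 0. dist (measure lebesgue (S \<inter> ball x r) / measure lebesgue (ball x r)) 1 < \<eta>"
    using d \<eta> unfolding lebesgue_density_point_def by (rule tendstoD)
  then obtain d where d: "d > 0" and dd: "\<And>r. 0 < r \<Longrightarrow> r < d \<Longrightarrow>
      dist (measure lebesgue (S \<inter> ball x r) / measure lebesgue (ball x r)) 1 < \<eta>"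
    unfolding eventually_at_right_field by blast
  have ex: "\<exists>q\<in>S. dist q (x + h) \<le> e * norm h" if h: "norm h < d / 2" "h \<noteq> 0" for h
  proof (rule ccontr)
    assume "\<not> ?thesis"
    then have disj: "S \<inter> ball (x + h) (e' * norm h) = {}"
      using e' by (auto simp: dist_commute not_le) (smt (verit) mult_right_mono norm_ge_zero)
    define r where "r = 2 * norm h"
    have r: "0 < r" "r < d" using h by (auto simp: r_def)
    have sub: "ball (x + h) (e' * norm h) \<subseteq> ball x r"
    proof
      fix y assume "y \<in> ball (x + h) (e' * norm h)"
      then have "dist (x + h) y < 1 * norm h"
        using e' mult_right_mono[of e' 1 "norm h"] by simp
      moreover have "dist x y \<le> dist x (x + h) + dist (x + h) y" by (rule dist_triangle)
      ultimately show "y \<in> ball x r" by (simp add: r_def dist_norm)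
    qed
    have "measure lebesgue (S \<inter> ball x r) \<le> measure lebesgue (ball x r - ball (x + h) (e' * norm h))"
      using S disj by (intro measure_mono_fmeasurable) (auto intro: fmeasurable_Diff)
    also have "\<dots> = measure lebesgue (ball x r) - measure lebesgue (ball (x + h) (e' * norm h))"
      using sub by (intro measurable_measure_Diff) auto
    also have "measure lebesgue (ball (x + h) (e' * norm h)) = \<eta> * measure lebesgue (ball x r)"
      using e' r by (simp add: content_ball \<eta>_def r_def power_mult_distrib power_divide)
    finally have "measure lebesgue (S \<inter> ball x r) \<le> (1 - \<eta>) * measure lebesgue (ball x r)"
      by (simp add: algebra_simps)
    moreover have "0 < measure lebesgue (ball x r)" using r by (simp add: content_ball_gt_0_iff)
    ultimately have "measure lebesgue (S \<inter> ball x r) / measure lebesgue (ball x r) \<le> 1 - \<eta>"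
      by (simp add: pos_divide_le_eq)
    then show False using dd[OF r] by (simp add: dist_real_def)
  qed
  show ?thesis
    by (intro exI[of _ "d / 2"] conjI allI impI ex) (use d in auto)
qed

text \<open>\<open>S\<close> may be nonmeasurable: density is used for \<open>closure S\<close>, and
  a nearby point of the closure is replaced by one of \<open>S\<close> at the price of halving
  \<open>e\<close>. For \<open>h = 0\<close> the point \<open>x\<close> itself serves.\<close>

lemma negligible_porous_points:
  fixes S :: "'a::euclidean_space set"
  shows "negligible {x\<in>S. \<not> (\<forall>e>0. \<exists>d>0. \<forall>h. norm h < d \<longrightarrow> (\<exists>q\<in>S. dist q (x + h) \<le> e * norm h))}"
proof (rule negligible_subset[OF lebesgue_density_theorem[of "closure S"]])
  have "\<exists>d>0. \<forall>h. norm h < d \<longrightarrow> (\<exists>q\<in>S. dist q (x + h) \<le> e * norm h)"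
    if x: "x \<in> S" "lebesgue_density_point x (closure S)" and "e > 0" for x and e :: real
  proof -
    obtain d where d: "d > 0" and q: "\<And>h. h \<noteq> 0 \<Longrightarrow> norm h < d \<Longrightarrow> \<exists>q\<in>closure S. dist q (x + h) \<le> e / 2 * norm h"
      using density_imp_nonporous[of "closure S" x "e/2"] x \<open>e > 0\<close> by auto
    have "\<exists>q\<in>S. dist q (x + h) \<le> e * norm h" if h: "norm h < d" for h
    proof (cases "h = 0")
      case False
      obtain q where "q \<in> closure S" "dist q (x + h) \<le> e / 2 * norm h" using q[OF False h] by blast
      moreover obtain q' where "q' \<in> S" "dist q' q < e / 2 * norm h"
        using \<open>q \<in> closure S\<close> False \<open>e > 0\<close> closure_approachable by (metis half_gt_zero mult_pos_pos zero_less_norm_iff)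
      moreover have "dist q' (x + h) \<le> dist q' q + dist q (x + h)" by (rule dist_triangle)
      ultimately show ?thesis by (intro bexI[of _ q']) auto
    qed (use x in auto)
    with d show ?thesis by blast
  qed
  then show "{x\<in>S. \<not> (\<forall>e>0. \<exists>d>0. \<forall>h. norm h < d \<longrightarrow> (\<exists>q\<in>S. dist q (x + h) \<le> e * norm h))}
    \<subseteq> {x\<in>closure S. \<not> lebesgue_density_point x (closure S)}"
    using closure_subset[of S] by blast
qed simp

section \<open>Rademacher and Kirchheim differentiation\<close>

text \<open>Adding \<open>L * x\<close> makes \<gamma> nondecreasing, so it defines a Stieltjes
  measure. This measure is absolutely continuous, and its Radon-Nikodym density minus
  \<open>L\<close> is the integrand.\<close>

lemma lipschitz_real_integral:
  fixes \<gamma> :: "real \<Rightarrow> real"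
  assumes \<gamma>: "L-lipschitz_on UNIV \<gamma>"
  obtains f where "f \<in> borel_measurable borel"
    "\<And>a b. a \<le> b \<Longrightarrow> (f has_integral \<gamma> b - \<gamma> a) {a..b}"
proof -
  have L: "L \<ge> 0" using \<gamma> by (rule lipschitz_on_nonneg)
  define G where "G x = \<gamma> x + L * x" for x
  have lip: "\<bar>\<gamma> x - \<gamma> y\<bar> \<le> L * \<bar>x - y\<bar>" for x y
    using lipschitz_onD[OF \<gamma>, of x y] by (simp add: dist_real_def)
  have mono: "G x \<le> G y" if "x \<le> y" for x y
    using lip[of x y] that by (simp add: G_def abs_le_iff algebra_simps)
  have contG: "continuous_on UNIV G"
    unfolding G_def by (intro continuous_intros lipschitz_on_continuous_on[OF \<gamma>])
  let ?F = "interval_measure G"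
  have Icc: "emeasure ?F {a..b} = ennreal (G b - G a)" if "a \<le> b" for a b
    using emeasure_interval_measure_Icc[OF that, of G] mono contG by (simp add: continuous_on_subset)
  have ac: "absolutely_continuous lborel ?F"
    unfolding absolutely_continuous_def
  proof
    fix N assume N: "N \<in> null_sets (lborel :: real measure)"
    then have neg: "negligible N" by (simp add: negligible_iff_null_sets null_sets_completionI)
    have Nb: "N \<in> sets borel" using N by auto
    \<comment> \<open>A ball of radius \<open>r\<close> is an interval of length
      \<open>2 * r\<close>, on which \<open>G\<close> grows by at most \<open>2 * L\<close> times
      the length; hence the factor \<open>4 * L\<close>.\<close>
    have small: "emeasure ?F N \<le> ennreal (4 * L * \<epsilon>)" if "\<epsilon> > 0" for \<epsilon>
    proof -
      obtain a r where r: "\<And>i::nat. 0 \<le> r i" and cov: "N \<subseteq> (\<Union>i. cball (a i) (r i))"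
        and sum: "(\<Sum>i. ennreal (r i ^ DIM(real))) \<le> ennreal \<epsilon>"
        using negligible_cball_cover[OF neg \<open>\<epsilon> > 0\<close> zero_less_one] by metis
      have "emeasure ?F N \<le> emeasure ?F (\<Union>i. cball (a i) (r i))"
        using cov Nb by (intro emeasure_mono) auto
      also have "\<dots> \<le> (\<Sum>i. emeasure ?F (cball (a i) (r i)))"
        by (intro emeasure_subadditive_countably) auto
      also have "\<dots> \<le> (\<Sum>i. ennreal (4 * L) * ennreal (r i))"
      proof (intro suminf_le summableI)
        fix i
        have "emeasure ?F (cball (a i) (r i)) = ennreal (G (a i + r i) - G (a i - r i))"
          using r[of i] by (simp add: cball_eq_atLeastAtMost Icc)
        also have "\<dots> \<le> ennreal (4 * L * r i)"
          using lip[of "a i + r i" "a i - r i"] r[of i] by (intro ennreal_leI) (simp add: G_def algebra_simps)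
        finally show "emeasure ?F (cball (a i) (r i)) \<le> ennreal (4 * L) * ennreal (r i)"
          using L r[of i] by (simp add: ennreal_mult)
      qed
      also have "\<dots> = ennreal (4 * L) * (\<Sum>i. ennreal (r i))"
        by (rule ennreal_suminf_cmult)
      also have "\<dots> \<le> ennreal (4 * L) * ennreal \<epsilon>"
        using sum by (intro mult_left_mono) auto
      finally show ?thesis using L \<open>\<epsilon> > 0\<close> by (simp add: ennreal_mult)
    qed
    have "emeasure ?F N \<le> 0"
    proof (rule ennreal_le_epsilon)
      fix e :: real assume "e > 0"
      have "4 * L * (e / (4 * L + 1)) \<le> e"
        using L \<open>e > 0\<close> by (simp add: divide_simps)
      then show "emeasure ?F N \<le> 0 + ennreal e"
        using small[of "e / (4 * L + 1)"] L \<open>e > 0\<close>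
        by (metis add_0 divide_pos_pos ennreal_leI add_nonneg_pos mult_nonneg_nonneg order_trans zero_le_numeral zero_less_one)
    qed
    then show "N \<in> null_sets ?F" using Nb by (auto simp: null_sets_def)
  qed
  define h where "h = RN_deriv lborel ?F"
  have hb: "h \<in> borel_measurable borel" unfolding h_def by (metis borel_measurable_RN_deriv measurable_lborel2)
  have dens: "density lborel h = ?F"
    unfolding h_def using ac by (intro sigma_finite_measure.density_RN_deriv sigma_finite_lborel) auto
  have hint: "(\<integral>\<^sup>+x. h x * indicator {a..b} x \<partial>lborel) = ennreal (G b - G a)" if "a \<le> b" for a b
    using Icc[OF that] hb by (subst (asm) dens[symmetric], subst (asm) emeasure_density) auto
  \<comment> \<open>\<open>enn2real\<close> sends the value infinity to \<open>0\<close>; this is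
    harmless because \<open>h\<close> is finite almost everywhere on each interval.\<close>
  define f where "f x = enn2real (h x) - L" for x
  show ?thesis
  proof
    show "f \<in> borel_measurable borel" unfolding f_def using hb by measurable
    fix a b :: real assume ab: "a \<le> b"
    have "AE x in lborel. h x * indicator {a..b} x \<noteq> \<infinity>"
      using hint[OF ab] hb by (intro nn_integral_PInf_AE) auto
    then have "(\<integral>\<^sup>+x. ennreal (enn2real (h x) * indicator {a..b} x) \<partial>lborel) = ennreal (G b - G a)"
      unfolding hint[OF ab, symmetric]
      by (intro nn_integral_cong_AE) (auto split: split_indicator simp: ennreal_enn2real_if)
    then have "((\<lambda>x. enn2real (h x) * indicator {a..b} x) has_integral G b - G a) UNIV"
      using hb mono[OF ab] by (intro nn_integral_has_integral) auto
    then have "((\<lambda>x. if x \<in> {a..b} then enn2real (h x) else 0) has_integral G b - G a) UNIV"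
      by (rule has_integral_eq[rotated]) auto
    then have 1: "((\<lambda>x. enn2real (h x)) has_integral G b - G a) {a..b}"
      by (simp only: has_integral_restrict_UNIV)
    have 2: "((\<lambda>x. L) has_integral L * (b - a)) {a..b}"
      using has_integral_const_real[of L a b] ab by (simp add: mult.commute)
    show "(f has_integral \<gamma> b - \<gamma> a) {a..b}"
      using has_integral_diff[OF 1 2] unfolding f_def by (simp add: G_def algebra_simps)
  qed
qed

text \<open>One-sided derivatives are enough later on, because the set of directions considered
  contains \<open>- v\<close> along with \<open>v\<close>.\<close>

lemma indefinite_integral_right_derivative:
  fixes f :: "real \<Rightarrow> real"
  assumes "\<And>a b. f integrable_on {a..b}"
  obtains N where "negligible N"
    "\<And>t e. \<lbrakk>t \<notin> N; 0 < e\<rbrakk> \<Longrightarrow> \<exists>d>0. \<forall>h. 0 < h \<and> h < d \<longrightarrow> \<bar>integral {t..t+h} f / h - f t\<bar> < e"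
proof -
  have "f integrable_on cbox a b" for a b using assms by simp
  then obtain N where N: "negligible N"
      "\<And>x e. \<lbrakk>x \<notin> N; 0 < e\<rbrakk> \<Longrightarrow> \<exists>d>0. \<forall>h. 0 < h \<and> h < d \<longrightarrow>
                         norm(integral (cbox x (x + h *\<^sub>R One)) f /\<^sub>R h ^ DIM(real) - f x) < e"
    using integrable_ccontinuous_explicit by blast
  show ?thesis
    by (rule that[of N]) (use N in \<open>simp_all add: divide_inverse mult.commute\<close>)
qed

text \<open>The last conclusion is uniform in \<open>k\<close>, which separate differentiability of
  the \<gamma> \<open>k\<close> would not give. Every increment is at most the integral of the
  single function \<open>M\<close>, the supremum of the absolute derivatives, and Lebesgue
  differentiation is applied to \<open>M\<close>.\<close>

lemma lipschitz_sequence_right_derivatives: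
  fixes \<gamma> :: "nat \<Rightarrow> real \<Rightarrow> real"
  assumes \<gamma>: "\<And>k. L-lipschitz_on UNIV (\<gamma> k)"
  obtains N m where "negligible N"
    "\<And>k t. t \<notin> N \<Longrightarrow> ((\<lambda>h. (\<gamma> k (t + h) - \<gamma> k t) / h) \<longlongrightarrow> m k t) (at_right 0)"
    "\<And>t e. \<lbrakk>t \<notin> N; 0 < e\<rbrakk> \<Longrightarrow>
      \<exists>d>0. \<forall>h k. 0 < h \<and> h < d \<longrightarrow> \<bar>\<gamma> k (t + h) - \<gamma> k t\<bar> \<le> ((SUP k. \<bar>m k t\<bar>) + e) * h"
proof -
  have L: "L \<ge> 0" using \<gamma>[of 0] by (rule lipschitz_on_nonneg)
  have "\<forall>k. \<exists>f. f \<in> borel_measurable borel \<and> (\<forall>a b. a \<le> b \<longrightarrow> (f has_integral \<gamma> k b - \<gamma> k a) {a..b})"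
    using lipschitz_real_integral[OF \<gamma>] by metis
  then obtain f where fb: "\<And>k. f k \<in> borel_measurable borel"
    and fi: "\<And>k a b. a \<le> b \<Longrightarrow> (f k has_integral \<gamma> k b - \<gamma> k a) {a..b}" by metis
  have fint: "f k integrable_on {a..b}" for k a b
    by (cases "a \<le> b") (auto intro: has_integral_integrable fi integrable_on_empty)
  have "\<forall>k. \<exists>N. negligible N \<and> (\<forall>t e. t \<notin> N \<and> 0 < e \<longrightarrow>
      (\<exists>d>0. \<forall>h. 0 < h \<and> h < d \<longrightarrow> \<bar>integral {t..t+h} (f k) / h - f k t\<bar> < e))"
    using indefinite_integral_right_derivative[OF fint] by metis
  then obtain N1 where N1: "\<And>k. negligible (N1 k)" and
    N1d: "\<And>k t e. \<lbrakk>t \<notin> N1 k; 0 < e\<rbrakk> \<Longrightarrow>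
      \<exists>d>0. \<forall>h. 0 < h \<and> h < d \<longrightarrow> \<bar>integral {t..t+h} (f k) / h - f k t\<bar> < e" by metis
  have lim: "((\<lambda>h. (\<gamma> k (t + h) - \<gamma> k t) / h) \<longlongrightarrow> f k t) (at_right 0)" if nt: "t \<notin> N1 k" for k t
  proof (rule tendstoI)
    fix e :: real assume "e > 0"
    then obtain d where "d > 0" and d: "\<And>h. 0 < h \<Longrightarrow> h < d \<Longrightarrow> \<bar>integral {t..t+h} (f k) / h - f k t\<bar> < e"
      using N1d[OF nt \<open>e > 0\<close>] by metis
    have "dist ((\<gamma> k (t + h) - \<gamma> k t) / h) (f k t) < e" if "0 < h" "h < d" for h
      using d[OF that] integral_unique[OF fi[of t "t + h" k]] that by (simp add: dist_real_def)
    then show "\<forall>\<^sub>F h in at_right 0. dist ((\<gamma> k (t + h) - \<gamma> k t) / h) (f k t) < e"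
      unfolding eventually_at_right_field using \<open>d > 0\<close> by blast
  qed
  have fL: "\<bar>f k t\<bar> \<le> L" if "t \<notin> N1 k" for k t
  proof (rule tendsto_le[OF _ tendsto_const tendsto_rabs[OF lim[OF that]]])
    show "\<forall>\<^sub>F h in at_right 0. \<bar>(\<gamma> k (t + h) - \<gamma> k t) / h\<bar> \<le> L"
      unfolding eventually_at_right_field
      using lipschitz_onD[OF \<gamma>[of k], of "t + h" t for h]
      by (intro exI[of _ 1]) (simp add: dist_real_def pos_divide_le_eq, metis abs_of_pos)
  qed simp
  \<comment> \<open>Truncation at \<open>L\<close> keeps the supremum finite also on the null sets
    \<open>N1 k\<close>, where \<open>f k\<close> is uncontrolled; elsewhere it changes
    nothing.\<close>
  define M where "M t = (SUP k. min \<bar>f k t\<bar> L)" for t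
  have bdd: "bdd_above (range (\<lambda>k. min \<bar>f k t\<bar> L))" for t
    by (intro bdd_aboveI2[of _ _ L]) simp
  have Mle: "min \<bar>f k t\<bar> L \<le> M t" for k t
    unfolding M_def by (intro cSUP_upper bdd) simp
  have MleL: "M t \<le> L" for t unfolding M_def by (intro cSUP_least) auto
  have M0: "0 \<le> M t" for t using Mle[of 0 t] L by linarith
  have Mb: "M \<in> borel_measurable borel"
    unfolding M_def using fb bdd by (intro borel_measurable_cSUP) auto
  have Mint: "M integrable_on {a..b}" for a b
  proof -
    have "integrable lborel (\<lambda>x. indicator {a..b} x *\<^sub>R M x)"
      using M0 MleL Mb by (intro integrableI_bounded_set_indicator[of _ _ _ L]) (auto simp: emeasure_lborel_Icc_eq)
    then have "set_integrable lborel {a..b} M" unfolding set_integrable_def .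
    then show ?thesis by (rule set_borel_integral_eq_integral)
  qed
  obtain N2 where N2: "negligible N2" and
    N2d: "\<And>t e. \<lbrakk>t \<notin> N2; 0 < e\<rbrakk> \<Longrightarrow>
      \<exists>d>0. \<forall>h. 0 < h \<and> h < d \<longrightarrow> \<bar>integral {t..t+h} M / h - M t\<bar> < e"
    using indefinite_integral_right_derivative[OF Mint] by metis
  have inc: "\<bar>\<gamma> k b - \<gamma> k a\<bar> \<le> integral {a..b} M" if "a \<le> b" for k a b
  proof -
    \<comment> \<open>Setting the derivative to \<open>0\<close> on \<open>N1 k\<close> preserves
      the integral and makes the bound by \<open>M\<close> hold at every point.\<close>
    have "norm (integral {a..b} (\<lambda>t. if t \<in> N1 k then 0 else f k t)) \<le> integral {a..b} M"
    proof (rule integral_norm_bound_integral[OF _ Mint])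
      show "(\<lambda>t. if t \<in> N1 k then 0 else f k t) integrable_on {a..b}"
        by (rule integrable_spike[OF fint N1[of k]]) auto
      show "norm (if t \<in> N1 k then 0 else f k t) \<le> M t" for t
        using fL[of t k] Mle[of k t] M0[of t] by auto
    qed
    also have "integral {a..b} (\<lambda>t. if t \<in> N1 k then 0 else f k t) = integral {a..b} (f k)"
      by (rule integral_spike[OF N1[of k]]) auto
    also have "\<dots> = \<gamma> k b - \<gamma> k a" using fi[OF that] by (rule integral_unique)
    finally show ?thesis by simp
  qed
  show ?thesis
  proof (rule that[of "(\<Union>k. N1 k) \<union> N2" f])
    show "negligible ((\<Union>k. N1 k) \<union> N2)"
      by (intro negligible_Un negligible_Union_nat N1 N2)
    fix t assume t: "t \<notin> (\<Union>k. N1 k) \<union> N2"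
    then show "((\<lambda>h. (\<gamma> k (t + h) - \<gamma> k t) / h) \<longlongrightarrow> f k t) (at_right 0)" for k
      using lim by simp
    fix e :: real assume "e > 0"
    obtain d where "d > 0" and d: "\<And>h. 0 < h \<Longrightarrow> h < d \<Longrightarrow> \<bar>integral {t..t+h} M / h - M t\<bar> < e"
      using N2d[of t e] t \<open>e > 0\<close> by blast
    have Meq: "M t = (SUP k. \<bar>f k t\<bar>)"
      unfolding M_def using t fL by (intro SUP_cong) auto
    show "\<exists>d>0. \<forall>h k. 0 < h \<and> h < d \<longrightarrow> \<bar>\<gamma> k (t + h) - \<gamma> k t\<bar> \<le> ((SUP k. \<bar>f k t\<bar>) + e) * h"
    proof (intro exI[of _ d] conjI allI impI)
      fix h k assume h: "0 < h \<and> h < d"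
      have "integral {t..t+h} M / h \<le> M t + e" using d[of h] h by linarith
      then have "integral {t..t+h} M \<le> (M t + e) * h" using h by (simp add: pos_divide_le_eq)
      then show "\<bar>\<gamma> k (t + h) - \<gamma> k t\<bar> \<le> ((SUP k. \<bar>f k t\<bar>) + e) * h"
        using inc[of t "t + h" k] h Meq by simp
    qed (fact \<open>d > 0\<close>)
  qed
qed

text \<open>By Tonelli and translation invariance, averaging the indicator of \<open>B\<close> over the segments
  \<open>x + t *\<^sub>R v\<close>, \<open>t \<in> {0..1}\<close>, and integrating over \<open>x\<close> gives back the measure of \<open>B\<close>.\<close>

lemma negligible_if_lines_negligible:
  fixes B :: "'a::euclidean_space set"
  assumes B: "B \<in> sets borel" and lines: "\<And>p. negligible {t::real. p + t *\<^sub>R v \<in> B}"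
  shows "negligible B"
proof -
  have [measurable]: "B \<in> sets borel" by (rule B)
  define g where "g = (\<lambda>(x, t::real). indicator B (x + t *\<^sub>R v) * indicator {0..1} t :: ennreal)"
  have g [measurable]: "g \<in> borel_measurable (lborel \<Otimes>\<^sub>M lborel)"
    unfolding g_def by measurable
  have "(\<integral>\<^sup>+t. g (x, t) \<partial>lborel) = 0" for x
  proof -
    have "{t. x + t *\<^sub>R v \<in> B} \<in> null_sets lborel"
    proof -
      have "{t. x + t *\<^sub>R v \<in> B} = (\<lambda>t. x + t *\<^sub>R v) -` B \<inter> space borel" by auto
      also have "\<dots> \<in> sets borel" by (rule measurable_sets[OF _ B]) measurable
      finally show ?thesis
        using lines[of x] by (simp add: negligible_iff_null_sets null_sets_def)
    qed
    then have "AE t in lborel. x + t *\<^sub>R v \<notin> B"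
      by (rule AE_I'[rotated 0, of _ lborel]) auto
    then have "(\<integral>\<^sup>+t. g (x, t) \<partial>lborel) = (\<integral>\<^sup>+t. 0 \<partial>(lborel :: real measure))"
      by (intro nn_integral_cong_AE) (auto simp: g_def)
    then show ?thesis by simp
  qed
  then have "0 = (\<integral>\<^sup>+x. (\<integral>\<^sup>+t. g (x, t) \<partial>lborel) \<partial>(lborel :: 'a measure))" by simp
  also have "\<dots> = (\<integral>\<^sup>+t. (\<integral>\<^sup>+x. g (x, t) \<partial>lborel) \<partial>lborel)"
    by (rule lborel_pair.Fubini'[symmetric]) (simp add: g)
  also have "\<dots> = (\<integral>\<^sup>+t. emeasure lborel B * indicator {0..1} t \<partial>(lborel :: real measure))"
  proof (rule nn_integral_cong)
    fix t :: real
    have "(\<integral>\<^sup>+x. indicator B (x + t *\<^sub>R v) \<partial>lborel) = (\<integral>\<^sup>+x. indicator B x \<partial>distr lborel borel ((+) (t *\<^sub>R v)))"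
      by (subst nn_integral_distr) (auto simp: add.commute)
    also have "\<dots> = emeasure lborel B" by (simp add: lborel_distr_plus)
    finally show "(\<integral>\<^sup>+x. g (x, t) \<partial>lborel) = emeasure lborel B * indicator {0..1} t"
      by (simp add: g_def nn_integral_multc)
  qed
  also have "\<dots> = emeasure lborel B" by (simp add: nn_integral_cmult_indicator)
  finally have "B \<in> null_sets lborel" using B by (simp add: null_sets_def)
  then show ?thesis by (simp add: negligible_iff_null_sets null_sets_completionI)
qed

text \<open>Every line parallel to \<open>v\<close> meets the bad set in a null set by the
  one-dimensional result. To integrate over the lines the bad set must be Borel, so the good points
  are described by countably many conditions.\<close>

lemma lipschitz_sequence_directional_derivatives:
  fixes u :: "nat \<Rightarrow> 'a::euclidean_space \<Rightarrow> real"
  assumes u: "\<And>k. L-lipschitz_on UNIV (u k)"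
  obtains N m where "negligible N"
    "\<And>k x. x \<notin> N \<Longrightarrow> ((\<lambda>h. (u k (x + h *\<^sub>R v) - u k x) / h) \<longlongrightarrow> m k x) (at_right 0)"
    "\<And>x e. \<lbrakk>x \<notin> N; 0 < e\<rbrakk> \<Longrightarrow>
      \<exists>d>0. \<forall>h k. 0 < h \<and> h < d \<longrightarrow> \<bar>u k (x + h *\<^sub>R v) - u k x\<bar> \<le> ((SUP k. \<bar>m k x\<bar>) + e) * h"
proof -
  have L: "L \<ge> 0" using u[of 0] by (rule lipschitz_on_nonneg)
  have cont: "continuous_on UNIV (u k)" for k using u by (rule lipschitz_on_continuous_on)
  have [measurable]: "u k \<in> borel_measurable borel" for k
    using cont by (rule borel_measurable_continuous_onI)
  define Q where "Q k x h = (u k (x + h *\<^sub>R v) - u k x) / h" for k x h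
  have Qb: "\<bar>Q k x h\<bar> \<le> L * norm v" if "h > 0" for k x h
    using lipschitz_onD[OF u[of k], of "x + h *\<^sub>R v" x] that
    by (simp add: Q_def dist_real_def dist_norm pos_divide_le_eq mult.commute mult.left_commute)
  have Qc: "continuous (at h) (Q k x)" if "h > 0" for k x h
  proof -
    have "continuous_on UNIV (\<lambda>h. u k (x + h *\<^sub>R v))"
      by (rule continuous_on_compose2[OF cont]) (auto intro!: continuous_intros)
    then have "isCont (\<lambda>h. u k (x + h *\<^sub>R v)) h"
      by (simp add: continuous_on_eq_continuous_at)
    then show ?thesis unfolding Q_def using that by simp
  qed
  \<comment> \<open>A limit along one fixed sequence is Borel in \<open>x\<close> whether or not it
    converges; where the one-sided derivative exists, \<open>seqlim\<close> identifies the
    two.\<close>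
  define m where "m k x = lim (\<lambda>n. Q k x (1 / real (Suc n)))" for k x
  have [measurable]: "(\<lambda>x. Q k x h) \<in> borel_measurable borel" for k h
    unfolding Q_def by measurable
  have [measurable]: "m k \<in> borel_measurable borel" for k
    unfolding m_def by measurable
  define M where "M x = (SUP k. min \<bar>m k x\<bar> (L * norm v))" for x
  have [measurable]: "M \<in> borel_measurable borel"
    unfolding M_def by (intro borel_measurable_cSUP) (auto intro!: bdd_aboveI2[of _ _ "L * norm v"])
  \<comment> \<open>Rational step sizes and reciprocals of integers make the conditions in
    \<open>G1\<close> and \<open>G2\<close> countable, hence Borel.\<close>
  define G1 where "G1 k = {x. \<forall>i::nat. \<exists>j::nat. \<forall>q::rat. 0 < q \<and> real_of_rat q < 1 / real (Suc j) \<longrightarrow>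
     \<bar>Q k x (real_of_rat q) - m k x\<bar> \<le> 1 / real (Suc i)}" for k
  define G2 where "G2 = {x. \<forall>i::nat. \<exists>j::nat. \<forall>q::rat. \<forall>k. 0 < q \<and> real_of_rat q < 1 / real (Suc j) \<longrightarrow>
     \<bar>Q k x (real_of_rat q)\<bar> \<le> M x + 1 / real (Suc i)}"
  define G where "G = (\<Inter>k. G1 k) \<inter> G2"
  have "G1 k \<in> sets borel" for k
  proof -
    have "Measurable.pred borel (\<lambda>x. \<forall>i::nat. \<exists>j::nat. \<forall>q::rat. 0 < q \<and> real_of_rat q < 1 / real (Suc j) \<longrightarrow>
     \<bar>Q k x (real_of_rat q) - m k x\<bar> \<le> 1 / real (Suc i))" by measurable
    then show ?thesis unfolding G1_def pred_def by simp
  qed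
  moreover have "G2 \<in> sets borel"
  proof -
    have "Measurable.pred borel (\<lambda>x. \<forall>i::nat. \<exists>j::nat. \<forall>q::rat. \<forall>k. 0 < q \<and> real_of_rat q < 1 / real (Suc j) \<longrightarrow>
     \<bar>Q k x (real_of_rat q)\<bar> \<le> M x + 1 / real (Suc i))" by measurable
    then show ?thesis unfolding G2_def pred_def by simp
  qed
  ultimately have G: "G \<in> sets borel" unfolding G_def by auto
  \<comment> \<open>Non-strict bounds pass from rational to real step sizes, since the difference
    quotient is continuous in the step for \<open>h > 0\<close>.\<close>
  have dense: "\<bar>F h\<bar> \<le> b" if F: "continuous (at h) F" "0 < h" "h < d"
    and b: "\<And>q::rat. 0 < q \<Longrightarrow> real_of_rat q < d \<Longrightarrow> \<bar>F (real_of_rat q)\<bar> \<le> b" for F :: "real \<Rightarrow> real" and h d b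
  proof (rule ccontr)
    assume "\<not> ?thesis"
    then have "\<bar>F h\<bar> - b > 0" by simp
    then obtain s where s: "s > 0" and sd: "\<And>y. dist y h < s \<Longrightarrow> dist (F y) (F h) < \<bar>F h\<bar> - b"
      using F(1) unfolding continuous_at_eps_delta by blast
    have "max 0 (h - s) < h" using s F(2) by simp
    then obtain q where "q \<in> \<rat>" and q: "max 0 (h - s) < q" "q < h"
      using Rats_dense_in_real by blast
    from \<open>q \<in> \<rat>\<close> obtain r' where "q = real_of_rat r'" by (rule Rats_cases)
    then obtain r where r: "q = real_of_rat r" "0 < real_of_rat r" "h - s < q" "q < h"
      using q by simp
    have "dist (F q) (F h) < \<bar>F h\<bar> - b" using r by (intro sd) (auto simp: dist_real_def)
    moreover have "\<bar>F q\<bar> \<le> b" using b[of r] r F(3) by simp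
    ultimately show False by (auto simp: dist_real_def abs_if split: if_splits)
  qed
  have mlim: "(Q k x \<longlongrightarrow> m k x) (at_right 0)" if "x \<in> G" for k x
  proof (rule tendstoI)
    fix e :: real assume "e > 0"
    obtain i where i: "1 / real (Suc i) < e" using \<open>e > 0\<close> by (rule nat_approx_posE)
    have "x \<in> G1 k" using that by (simp add: G_def)
    then obtain j where "\<forall>q::rat. 0 < q \<and> real_of_rat q < 1 / real (Suc j) \<longrightarrow>
        \<bar>Q k x (real_of_rat q) - m k x\<bar> \<le> 1 / real (Suc i)"
      unfolding G1_def by fast
    then have j: "\<And>q::rat. 0 < q \<Longrightarrow> real_of_rat q < 1 / real (Suc j) \<Longrightarrow>
        \<bar>Q k x (real_of_rat q) - m k x\<bar> \<le> 1 / real (Suc i)" by simp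
    have "dist (Q k x h) (m k x) < e" if h: "0 < h" "h < 1 / real (Suc j)" for h
    proof -
      have "\<bar>Q k x h - m k x\<bar> \<le> 1 / real (Suc i)"
        by (rule dense[OF continuous_diff[OF Qc[OF h(1)] continuous_const] h j])
      with i show ?thesis by (simp add: dist_real_def)
    qed
    then show "\<forall>\<^sub>F h in at_right 0. dist (Q k x h) (m k x) < e"
      unfolding eventually_at_right_field by (intro exI[of _ "1 / real (Suc j)"]) auto
  qed
  have mL: "\<bar>m k x\<bar> \<le> L * norm v" if "(Q k x \<longlongrightarrow> m k x) (at_right 0)" for k x
  proof (rule tendsto_le[OF _ tendsto_const tendsto_rabs[OF that]])
    show "\<forall>\<^sub>F h in at_right 0. \<bar>Q k x h\<bar> \<le> L * norm v"
      unfolding eventually_at_right_field using Qb by (intro exI[of _ 1]) auto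
  qed simp
  have seqlim: "m k x = l" if "(Q k x \<longlongrightarrow> l) (at_right 0)" for k x l
  proof -
    have "filterlim (\<lambda>n. 1 / real (Suc n)) (at_right 0) sequentially"
      unfolding filterlim_at using LIMSEQ_Suc[OF lim_1_over_n[where 'a=real]] by auto
    from filterlim_compose[OF that this] show ?thesis
      unfolding m_def by (rule limI)
  qed
  have neg: "negligible (- G)"
  proof (rule negligible_if_lines_negligible[of _ v])
    show "- G \<in> sets borel" using G by (metis borel_comp)
    fix p :: 'a
    have lipg: "(L * norm v)-lipschitz_on UNIV (\<lambda>t. u k (p + t *\<^sub>R v))" for k
    proof (rule lipschitz_onI)
      fix s t :: real
      have "dist (u k (p + s *\<^sub>R v)) (u k (p + t *\<^sub>R v)) \<le> L * dist (p + s *\<^sub>R v) (p + t *\<^sub>R v)"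
        by (rule lipschitz_onD[OF u]) auto
      also have "dist (p + s *\<^sub>R v) (p + t *\<^sub>R v) = norm v * dist s t"
        by (simp add: dist_norm scaleR_diff_left[symmetric] mult.commute)
      finally show "dist (u k (p + s *\<^sub>R v)) (u k (p + t *\<^sub>R v)) \<le> L * norm v * dist s t" by simp
    qed (use L in simp)
    obtain N m' where N: "negligible N"
      and m': "\<And>k t. t \<notin> N \<Longrightarrow> ((\<lambda>h. (u k (p + (t + h) *\<^sub>R v) - u k (p + t *\<^sub>R v)) / h) \<longlongrightarrow> m' k t) (at_right 0)"
      and m'2: "\<And>t e. \<lbrakk>t \<notin> N; 0 < e\<rbrakk> \<Longrightarrow>
      \<exists>d>0. \<forall>h k. 0 < h \<and> h < d \<longrightarrow> \<bar>u k (p + (t + h) *\<^sub>R v) - u k (p + t *\<^sub>R v)\<bar> \<le> ((SUP k. \<bar>m' k t\<bar>) + e) * h"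
      by (rule lipschitz_sequence_right_derivatives[where \<gamma> = "\<lambda>k t. u k (p + t *\<^sub>R v)", OF lipg]) (rule that)
    have "p + t *\<^sub>R v \<in> G" if t: "t \<notin> N" for t
    proof -
      let ?x = "p + t *\<^sub>R v"
      have eq: "(u k (p + (t + h) *\<^sub>R v) - u k (p + t *\<^sub>R v)) / h = Q k ?x h" for k h
        by (simp add: Q_def scaleR_add_left add.assoc)
      have lim: "(Q k ?x \<longlongrightarrow> m' k t) (at_right 0)" for k
        using m'[OF t, of k] unfolding eq .
      then have mm: "m k ?x = m' k t" for k by (rule seqlim)
      have "?x \<in> G1 k" for k
        unfolding G1_def
      proof (intro CollectI allI)
        fix i
        obtain b where "b > 0" and b: "\<And>h. 0 < h \<Longrightarrow> h < b \<Longrightarrow> dist (Q k ?x h) (m k ?x) < 1 / real (Suc i)"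
          using tendstoD[OF lim[of k], of "1 / real (Suc i)"] unfolding eventually_at_right_field mm by auto
        obtain j where j: "1 / real (Suc j) < b" using \<open>b > 0\<close> by (rule nat_approx_posE)
        show "\<exists>j. \<forall>q. 0 < q \<and> real_of_rat q < 1 / real (Suc j) \<longrightarrow> \<bar>Q k ?x (real_of_rat q) - m k ?x\<bar> \<le> 1 / real (Suc i)"
        proof (intro exI[of _ j] allI impI)
          fix q :: rat assume q: "0 < q \<and> real_of_rat q < 1 / real (Suc j)"
          then show "\<bar>Q k ?x (real_of_rat q) - m k ?x\<bar> \<le> 1 / real (Suc i)"
            using b[of "real_of_rat q"] j unfolding dist_real_def
            by (meson less_imp_le less_trans zero_less_of_rat_iff)
        qed
      qed
      moreover have "?x \<in> G2"
        unfolding G2_def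
      proof (intro CollectI allI)
        fix i
        have "min \<bar>m k ?x\<bar> (L * norm v) = \<bar>m' k t\<bar>" for k
          using mL[of k ?x] lim[of k] mm[of k] by simp
        then have Seq: "M ?x = (SUP k. \<bar>m' k t\<bar>)" by (simp add: M_def)
        obtain b where "b > 0" and b: "\<And>h k. 0 < h \<Longrightarrow> h < b \<Longrightarrow>
           \<bar>u k (p + (t + h) *\<^sub>R v) - u k (p + t *\<^sub>R v)\<bar> \<le> ((SUP k. \<bar>m' k t\<bar>) + 1 / real (Suc i)) * h"
          using m'2[OF t, of "1 / real (Suc i)"] by auto
        have b': "\<bar>Q k ?x h\<bar> \<le> (SUP k. \<bar>m' k t\<bar>) + 1 / real (Suc i)" if "0 < h" "h < b" for h k
          using b[OF that, of k] that unfolding eq[symmetric] by (simp add: abs_divide pos_divide_le_eq)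
        obtain j where j: "1 / real (Suc j) < b" using \<open>b > 0\<close> by (rule nat_approx_posE)
        show "\<exists>j. \<forall>q. \<forall>k. 0 < q \<and> real_of_rat q < 1 / real (Suc j) \<longrightarrow> \<bar>Q k ?x (real_of_rat q)\<bar> \<le>
            M ?x + 1 / real (Suc i)"
          unfolding Seq
        proof (intro exI[of _ j] allI impI)
          fix q :: rat and k assume q: "0 < q \<and> real_of_rat q < 1 / real (Suc j)"
          then show "\<bar>Q k ?x (real_of_rat q)\<bar> \<le> (SUP k. \<bar>m' k t\<bar>) + 1 / real (Suc i)"
            using b'[of "real_of_rat q" k] j by (meson less_trans zero_less_of_rat_iff)
        qed
      qed
      ultimately show ?thesis by (simp add: G_def)
    qed
    then have "{t. p + t *\<^sub>R v \<in> - G} \<subseteq> N" by blast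
    then show "negligible {t. p + t *\<^sub>R v \<in> - G}" using N negligible_subset by blast
  qed
  show ?thesis
  proof (rule that[of "- G" m, OF neg])
    fix x assume "x \<notin> - G"
    then have x: "x \<in> G" by simp
    show "((\<lambda>h. (u k (x + h *\<^sub>R v) - u k x) / h) \<longlongrightarrow> m k x) (at_right 0)" for k
      using mlim[OF x, of k] unfolding Q_def .
    fix e :: real assume "e > 0"
    obtain i where i: "1 / real (Suc i) < e" using \<open>e > 0\<close> by (rule nat_approx_posE)
    have Seq: "M x = (SUP k. \<bar>m k x\<bar>)"
      unfolding M_def using mL mlim[OF x] by (intro SUP_cong) auto
    have "x \<in> G2" using x by (simp add: G_def)
    then obtain j where "\<forall>(q::rat) k. 0 < q \<and> real_of_rat q < 1 / real (Suc j) \<longrightarrow>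
        \<bar>Q k x (real_of_rat q)\<bar> \<le> (SUP k. \<bar>m k x\<bar>) + 1 / real (Suc i)"
      unfolding G2_def mem_Collect_eq Seq by fast
    then have j: "\<And>(q::rat) k. 0 < q \<Longrightarrow> real_of_rat q < 1 / real (Suc j) \<Longrightarrow>
        \<bar>Q k x (real_of_rat q)\<bar> \<le> (SUP k. \<bar>m k x\<bar>) + 1 / real (Suc i)" by simp
    show "\<exists>d>0. \<forall>h k. 0 < h \<and> h < d \<longrightarrow> \<bar>u k (x + h *\<^sub>R v) - u k x\<bar> \<le> ((SUP k. \<bar>m k x\<bar>) + e) * h"
    proof (intro exI[of _ "1 / real (Suc j)"] conjI allI impI)
      fix h k assume h: "0 < h \<and> h < 1 / real (Suc j)"
      have "\<bar>Q k x h\<bar> \<le> (SUP k. \<bar>m k x\<bar>) + 1 / real (Suc i)"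
        by (rule dense[OF Qc _ _ j]) (use h in auto)
      with i have "\<bar>Q k x h\<bar> \<le> (SUP k. \<bar>m k x\<bar>) + e" by linarith
      then show "\<bar>u k (x + h *\<^sub>R v) - u k x\<bar> \<le> ((SUP k. \<bar>m k x\<bar>) + e) * h"
        using h by (simp add: Q_def abs_divide pos_divide_le_eq)
    qed simp
  qed
qed

text \<open>By compactness of the unit sphere finitely many directions of \<open>D\<close> suffice,
  and the Lipschitz bound controls the error of replacing a direction by a nearby one. The estimate
  is one-sided so that it can be applied to a function and to its negative for different
  reasons.\<close>

lemma lipschitz_le_little_o_dense:
  fixes \<phi> :: "'a::euclidean_space \<Rightarrow> real"
  assumes lip: "C-lipschitz_on UNIV \<phi>" and zero: "\<phi> 0 = 0" and dense: "closure D = UNIV"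
    and D: "\<And>v e. v \<in> D \<Longrightarrow> 0 < e \<Longrightarrow> \<exists>d>0. \<forall>t. 0 < t \<and> t < d \<longrightarrow> \<phi> (t *\<^sub>R v) \<le> e * t"
    and "0 < e"
  shows "\<exists>d>0. \<forall>h. norm h < d \<longrightarrow> \<phi> h \<le> e * norm h"
proof -
  have C: "C \<ge> 0" using lip by (rule lipschitz_on_nonneg)
  \<comment> \<open>Replacing \<open>h\<close> by \<open>norm h *\<^sub>R v\<close> costs at most
    \<open>C * s * norm h\<close>, half of the allowed error; \<open>C + 1\<close> covers
    \<open>C = 0\<close>.\<close>
  define s where "s = e / (2 * (C + 1))"
  have s: "s > 0" "C * s \<le> e / 2" using C \<open>e > 0\<close> by (auto simp: s_def field_simps)
  have "sphere 0 1 \<subseteq> (\<Union>v\<in>D. ball v s)"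
  proof
    fix x :: 'a
    have "x \<in> closure D" using dense by simp
    then obtain v where "v \<in> D" "dist v x < s" using closure_approachable s(1) by metis
    then show "x \<in> (\<Union>v\<in>D. ball v s)" by (auto simp: dist_commute)
  qed
  then obtain V where V: "V \<subseteq> D" "finite V" "sphere 0 1 \<subseteq> (\<Union>v\<in>V. ball v s)"
    using compactE_image[OF compact_sphere[of 0 1], of D "\<lambda>v. ball v s"] by (metis open_ball)
  have "\<forall>v\<in>V. \<exists>d>0. \<forall>t. 0 < t \<and> t < d \<longrightarrow> \<phi> (t *\<^sub>R v) \<le> e / 2 * t"
  proof
    fix v assume "v \<in> V"
    then show "\<exists>d>0. \<forall>t. 0 < t \<and> t < d \<longrightarrow> \<phi> (t *\<^sub>R v) \<le> e / 2 * t"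
      using V(1) \<open>e > 0\<close> by (intro D) auto
  qed
  then obtain d where d: "\<And>v. v \<in> V \<Longrightarrow> d v > 0" "\<And>v t. v \<in> V \<Longrightarrow> 0 < t \<Longrightarrow> t < d v \<Longrightarrow> \<phi> (t *\<^sub>R v) \<le> e / 2 * t"
    by metis
  define d0 where "d0 = Min (insert 1 (d ` V))"
  have d0: "d0 > 0" "\<And>v. v \<in> V \<Longrightarrow> d0 \<le> d v" using V(2) d(1) by (auto simp: d0_def)
  have "\<phi> h \<le> e * norm h" if h: "norm h < d0" for h
  proof (cases "h = 0")
    case False
    then have "h /\<^sub>R norm h \<in> sphere 0 1" by simp
    then have "h /\<^sub>R norm h \<in> (\<Union>v\<in>V. ball v s)" using V(3) by (rule subsetD[rotated])
    then obtain v where v: "v \<in> V" "dist v (h /\<^sub>R norm h) < s" by (metis UN_E mem_ball)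
    have "\<phi> h - \<phi> (norm h *\<^sub>R v) \<le> C * dist h (norm h *\<^sub>R v)"
      using lipschitz_onD[OF lip, of h "norm h *\<^sub>R v"] by (auto simp: dist_real_def)
    also have "dist h (norm h *\<^sub>R v) = norm h * dist v (h /\<^sub>R norm h)"
    proof -
      have "h = norm h *\<^sub>R (h /\<^sub>R norm h)" using False by simp
      then have "dist h (norm h *\<^sub>R v) = dist (norm h *\<^sub>R (h /\<^sub>R norm h)) (norm h *\<^sub>R v)" by simp
      also have "\<dots> = norm h * dist v (h /\<^sub>R norm h)"
        by (simp only: dist_norm scaleR_diff_right[symmetric] norm_scaleR abs_norm_cancel norm_minus_commute)
      finally show ?thesis .
    qed
    also have "C * (norm h * dist v (h /\<^sub>R norm h)) \<le> C * (norm h * s)"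
      using v C by (intro mult_left_mono) auto
    also have "\<dots> \<le> e / 2 * norm h"
      using mult_right_mono[OF s(2), of "norm h"] by (simp add: mult.commute mult.left_commute)
    also have "\<phi> (norm h *\<^sub>R v) \<le> e / 2 * norm h"
      using d(2)[OF v(1), of "norm h"] False h d0(2)[OF v(1)] by simp
    ultimately show ?thesis by simp
  qed (simp add: zero)
  with d0(1) show ?thesis by blast
qed

lemma lipschitz_norm_gradient_le:
  fixes f :: "'a::euclidean_space \<Rightarrow> real"
  assumes lip: "L-lipschitz_on UNIV f" and der: "(f has_derivative (\<lambda>h. g \<bullet> h)) (at x)"
  shows "norm g \<le> L"
proof (rule field_le_epsilon)
  fix e :: real assume "e > 0"
  then obtain d where d: "d > 0" "\<And>y. norm (y - x) < d \<Longrightarrow> norm (f y - f x - g \<bullet> (y - x)) \<le> e * norm (y - x)"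
    using der unfolding has_derivative_at_alt by blast
  show "norm g \<le> L + e"
  proof (cases "g = 0")
    case True
    then show ?thesis using lipschitz_on_nonneg[OF lip] \<open>e > 0\<close> by simp
  next
    case False
    \<comment> \<open>Stepping along \<open>g\<close> itself turns the inner product into the square
      of \<open>norm g\<close>; this \<open>t\<close> makes the step have length
      \<open>d / 2\<close>.\<close>
    define t where "t = d / (2 * norm g)"
    have t: "t > 0" "norm (t *\<^sub>R g) < d" using d(1) False by (auto simp: t_def)
    have "norm (f (x + t *\<^sub>R g) - f x - g \<bullet> (t *\<^sub>R g)) \<le> e * norm (t *\<^sub>R g)"
      using d(2)[of "x + t *\<^sub>R g"] t(2) by simp
    moreover have "\<bar>f (x + t *\<^sub>R g) - f x\<bar> \<le> L * norm (t *\<^sub>R g)"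
      using lipschitz_onD[OF lip, of "x + t *\<^sub>R g" x] by (simp add: dist_real_def dist_norm)
    ultimately have "g \<bullet> (t *\<^sub>R g) \<le> (L + e) * norm (t *\<^sub>R g)"
      by (simp add: algebra_simps abs_le_iff)
    then have "t * (norm g * norm g) \<le> t * ((L + e) * norm g)"
      using t(1) by (simp add: dot_square_norm power2_eq_square mult_ac)
    then show ?thesis using t(1) False by simp
  qed
qed

section \<open>From directional derivatives to gradients and metric differentials\<close>

lemma cSUP_le_add:
  fixes a b :: "nat \<Rightarrow> real"
  assumes "\<And>k. a k \<le> b k + c" "bdd_above (range b)"
  shows "(SUP k. a k) \<le> (SUP k. b k) + c"
proof (rule cSUP_least)
  fix k
  have "b k \<le> (SUP k. b k)" using assms(2) by (intro cSUP_upper) auto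
  then show "a k \<le> (SUP k. b k) + c" using assms(1)[of k] by linarith
qed simp

lemma negligible_UN_countable:
  assumes "countable I" "\<And>i. i \<in> I \<Longrightarrow> negligible (F i)"
  shows "negligible (\<Union>i\<in>I. F i)"
  using assms by (intro negligible_countable_Union) auto

lemma countable_rational_vectors:
  "countable {v::'a::euclidean_space. \<forall>b\<in>Basis. v \<bullet> b \<in> \<rat>}"
proof (rule countable_subset)
  show "countable ((\<lambda>c. \<Sum>b\<in>Basis. c b *\<^sub>R b) ` (Basis \<rightarrow>\<^sub>E \<rat>) :: 'a set)"
    by (intro countable_image countable_PiE) (auto simp: countable_rat)
  show "{v::'a. \<forall>b\<in>Basis. v \<bullet> b \<in> \<rat>} \<subseteq> (\<lambda>c. \<Sum>b\<in>Basis. c b *\<^sub>R b) ` (Basis \<rightarrow>\<^sub>E \<rat>)"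
  proof
    fix v :: 'a assume "v \<in> {v. \<forall>b\<in>Basis. v \<bullet> b \<in> \<rat>}"
    then have "(\<lambda>b\<in>Basis. v \<bullet> b) \<in> Basis \<rightarrow>\<^sub>E \<rat>" by auto
    moreover have "v = (\<Sum>b\<in>Basis. (\<lambda>b\<in>Basis. v \<bullet> b) b *\<^sub>R b)" by (simp add: euclidean_representation)
    ultimately show "v \<in> (\<lambda>c. \<Sum>b\<in>Basis. c b *\<^sub>R b) ` (Basis \<rightarrow>\<^sub>E \<rat>)" by blast
  qed
qed

lemma closure_rational_vectors:
  "closure {v::'a::euclidean_space. \<forall>b\<in>Basis. v \<bullet> b \<in> \<rat>} = UNIV"
proof -
  have "(\<Union>f\<in>Basis \<rightarrow> \<rat>. {\<Sum>i\<in>Basis. f i *\<^sub>R i}) \<subseteq> {v::'a. \<forall>b\<in>Basis. v \<bullet> b \<in> \<rat>}"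
    by auto
  from closure_mono[OF this] show ?thesis
    unfolding closure_rational_coordinates by blast
qed

text \<open>The remainder of the first-order expansion is Lipschitz in \<open>h\<close>, so
  smallness along a dense set of directions gives smallness in all of them. Both signs
  \<open>s\<close> are treated because the compactness lemma bounds from above only.\<close>

lemma has_gradient_if_directional:
  fixes f :: "'a::euclidean_space \<Rightarrow> real"
  assumes lip: "L-lipschitz_on UNIV f" and dense: "closure D = UNIV"
    and lim: "\<And>v. v \<in> D \<Longrightarrow> ((\<lambda>h. (f (x + h *\<^sub>R v) - f x) / h) \<longlongrightarrow> g \<bullet> v) (at_right 0)"
  shows "(f has_derivative (\<lambda>h. g \<bullet> h)) (at x)"
proof -
  have main: "\<exists>d>0. \<forall>h. norm h < d \<longrightarrow> s * (f (x + h) - f x - g \<bullet> h) \<le> e * norm h"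
    if s: "s = 1 \<or> s = - 1" and "e > 0" for s e
  proof (rule lipschitz_le_little_o_dense[OF _ _ dense _ \<open>e > 0\<close>])
    show "(L + norm g)-lipschitz_on UNIV (\<lambda>h. s * (f (x + h) - f x - g \<bullet> h))"
    proof (rule lipschitz_onI)
      fix h k
      have "\<bar>f (x + h) - f (x + k)\<bar> \<le> L * dist h k"
        using lipschitz_onD[OF lip, of "x + h" "x + k"] by (simp add: dist_real_def)
      moreover have "\<bar>g \<bullet> h - g \<bullet> k\<bar> \<le> norm g * dist h k"
        unfolding inner_diff_right[symmetric] dist_norm by (rule Cauchy_Schwarz_ineq2)
      ultimately show "dist (s * (f (x + h) - f x - g \<bullet> h)) (s * (f (x + k) - f x - g \<bullet> k)) \<le> (L + norm g) * dist h k"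
        using s by (auto simp: dist_real_def algebra_simps)
    qed (use lipschitz_on_nonneg[OF lip] in simp)
    show "s * (f (x + 0) - f x - g \<bullet> 0) = 0" by simp
    fix v e assume v: "v \<in> D" and "e > (0::real)"
    obtain d where d: "d > 0" "\<And>h. 0 < h \<Longrightarrow> h < d \<Longrightarrow> dist ((f (x + h *\<^sub>R v) - f x) / h) (g \<bullet> v) < e"
      using tendstoD[OF lim[OF v] \<open>e > 0\<close>] unfolding eventually_at_right_field by auto
    have "s * (f (x + t *\<^sub>R v) - f x - g \<bullet> (t *\<^sub>R v)) \<le> e * t" if "0 < t" "t < d" for t
    proof -
      have "\<bar>(f (x + t *\<^sub>R v) - f x) / t - g \<bullet> v\<bar> * t \<le> e * t"
        using d(2)[OF that] that by (intro mult_right_mono) (auto simp: dist_real_def)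
      also have "\<bar>(f (x + t *\<^sub>R v) - f x) / t - g \<bullet> v\<bar> * t = \<bar>((f (x + t *\<^sub>R v) - f x) / t - g \<bullet> v) * t\<bar>"
        using that by (simp add: abs_mult)
      also have "((f (x + t *\<^sub>R v) - f x) / t - g \<bullet> v) * t = f (x + t *\<^sub>R v) - f x - g \<bullet> (t *\<^sub>R v)"
        using that by (simp add: field_simps)
      finally show ?thesis using s by auto
    qed
    then show "\<exists>d>0. \<forall>t. 0 < t \<and> t < d \<longrightarrow> s * (f (x + t *\<^sub>R v) - f x - g \<bullet> (t *\<^sub>R v)) \<le> e * t"
      using d(1) by blast
  qed
  show ?thesis
    unfolding has_derivative_at_alt
  proof (intro conjI allI impI bounded_linear_inner_right)
    fix e :: real assume "e > 0"
    obtain d1 where d1: "d1 > 0" "\<And>h. norm h < d1 \<Longrightarrow> f (x + h) - f x - g \<bullet> h \<le> e * norm h"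
      using main[of 1 e] \<open>e > 0\<close> by auto
    obtain d2 where d2: "d2 > 0" "\<And>h. norm h < d2 \<Longrightarrow> - (f (x + h) - f x - g \<bullet> h) \<le> e * norm h"
      using main[of "-1" e] \<open>e > 0\<close> by auto
    show "\<exists>d>0. \<forall>y. norm (y - x) < d \<longrightarrow> norm (f y - f x - g \<bullet> (y - x)) \<le> e * norm (y - x)"
    proof (intro exI[of _ "min d1 d2"] conjI allI impI)
      fix y assume "norm (y - x) < min d1 d2"
      then show "norm (f y - f x - g \<bullet> (y - x)) \<le> e * norm (y - x)"
        using d1(2)[of "y - x"] d2(2)[of "y - x"] by (simp add: abs_le_iff)
    qed (use d1 d2 in simp)
  qed
qed

text \<open>Near a point where the set \<open>S\<close> of almost constant difference quotients is not porous, the quotient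
  at \<open>x + t *\<^sub>R w\<close> may be computed at a nearby point of \<open>S\<close>.\<close>

lemma directional_derivative_add:
  fixes f :: "'a::euclidean_space \<Rightarrow> real"
  assumes lip: "L-lipschitz_on UNIV f"
    and lv: "((\<lambda>h. (f (x + h *\<^sub>R v) - f x) / h) \<longlongrightarrow> mv) (at_right 0)"
    and lw: "((\<lambda>h. (f (x + h *\<^sub>R w) - f x) / h) \<longlongrightarrow> mw) (at_right 0)"
    and nonporous: "\<And>c i n. c \<in> \<rat> \<Longrightarrow> let S = {p. \<forall>t. 0 < t \<and> t < 1 / real (Suc i) \<longrightarrow> \<bar>f (p + t *\<^sub>R v) - f p - t * c\<bar> \<le> t / real (Suc n)}
        in x \<in> S \<longrightarrow> (\<forall>e>0. \<exists>d>0. \<forall>h. norm h < d \<longrightarrow> (\<exists>q\<in>S. dist q (x + h) \<le> e * norm h))"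
  shows "((\<lambda>h. (f (x + h *\<^sub>R (v + w)) - f x) / h) \<longlongrightarrow> mv + mw) (at_right 0)"
proof -
  have L: "L \<ge> 0" using lip by (rule lipschitz_on_nonneg)
  \<comment> \<open>The quotient in direction \<open>v + w\<close> splits into this one, whose base
    point moves with \<open>t\<close>, and the quotient in direction \<open>w\<close> at
    \<open>x\<close>.\<close>
  have "((\<lambda>t. (f (x + t *\<^sub>R w + t *\<^sub>R v) - f (x + t *\<^sub>R w)) / t) \<longlongrightarrow> mv) (at_right 0)"
  proof (rule tendstoI)
    fix e :: real assume "e > 0"
    then obtain n where n: "1 / real (Suc n) < e / 4" using nat_approx_posE[of "e/4"] by auto
    define \<eta> where "\<eta> = 1 / real (Suc n)"
    have \<eta>: "\<eta> > 0" "4 * \<eta> < e" using n by (auto simp: \<eta>_def)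
    \<comment> \<open>A rational stand-in for \<open>mv\<close> leaves only countably many sets
      \<open>S\<close>, so that the porous points of all of them form a null set.\<close>
    obtain c where c: "c \<in> \<rat>" "mv < c" "c < mv + \<eta> / 2"
      using Rats_dense_in_real[of mv "mv + \<eta> / 2"] \<eta>(1) by auto
    obtain b where b: "b > 0" "\<And>h. 0 < h \<Longrightarrow> h < b \<Longrightarrow> dist ((f (x + h *\<^sub>R v) - f x) / h) mv < \<eta> / 2"
      using tendstoD[OF lv, of "\<eta> / 2"] \<eta>(1) unfolding eventually_at_right_field by auto
    obtain i where i: "1 / real (Suc i) < b" using b(1) by (rule nat_approx_posE)
    define S where "S = {p. \<forall>t. 0 < t \<and> t < 1 / real (Suc i) \<longrightarrow> \<bar>f (p + t *\<^sub>R v) - f p - t * c\<bar> \<le> t / real (Suc n)}"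
    have "x \<in> S"
      unfolding S_def
    proof (intro CollectI allI impI)
      fix t assume t: "0 < t \<and> t < 1 / real (Suc i)"
      have "dist ((f (x + t *\<^sub>R v) - f x) / t) mv < \<eta> / 2" using b(2)[of t] t i by simp
      then have "\<bar>(f (x + t *\<^sub>R v) - f x) / t - c\<bar> \<le> \<eta>"
        using c unfolding dist_real_def by linarith
      then have "\<bar>(f (x + t *\<^sub>R v) - f x) / t - c\<bar> * t \<le> \<eta> * t" using t by (intro mult_right_mono) auto
      also have "\<bar>(f (x + t *\<^sub>R v) - f x) / t - c\<bar> * t = \<bar>((f (x + t *\<^sub>R v) - f x) / t - c) * t\<bar>"
        using t by (simp add: abs_mult)
      also have "((f (x + t *\<^sub>R v) - f x) / t - c) * t = f (x + t *\<^sub>R v) - f x - t * c"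
        using t by (simp add: field_simps)
      finally show "\<bar>f (x + t *\<^sub>R v) - f x - t * c\<bar> \<le> t / real (Suc n)" by (simp add: \<eta>_def)
    qed
    \<comment> \<open>Moving the base point from \<open>x + t *\<^sub>R w\<close> to a point of
      \<open>S\<close> then changes either value of \<open>f\<close> by at most
      \<open>\<eta> * t\<close>. Two such changes, the definition of \<open>S\<close> and the error
      of \<open>c\<close> add up to \<open>4 * \<eta> * t\<close>.\<close>
    define e' where "e' = \<eta> / ((L + 1) * (norm w + 1))"
    have e': "e' > 0" unfolding e'_def using \<eta>(1) L by (intro divide_pos_pos mult_pos_pos) (auto simp: add_nonneg_pos)
    have Le: "L * (e' * norm w) \<le> \<eta>"
    proof -
      have "L * norm w \<le> (L + 1) * (norm w + 1)" using L by (intro mult_mono) auto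
      then have "\<eta> * (L * norm w) \<le> \<eta> * ((L + 1) * (norm w + 1))" using \<eta>(1) by simp
      moreover have "(L + 1) * (norm w + 1) > 0" using L by (intro mult_pos_pos) (auto simp: add_nonneg_pos)
      ultimately show ?thesis unfolding e'_def by (simp add: pos_divide_le_eq mult_ac)
    qed
    obtain d where d: "d > 0" "\<And>h. norm h < d \<Longrightarrow> \<exists>q\<in>S. dist q (x + h) \<le> e' * norm h"
      using nonporous[OF c(1), of i n, unfolded Let_def, folded S_def] \<open>x \<in> S\<close> e' by blast
    define r where "r = min (1 / real (Suc i)) (d / (norm w + 1))"
    have r: "r > 0" unfolding r_def using d(1) by (simp add: add_nonneg_pos)
    have "dist ((f (x + t *\<^sub>R w + t *\<^sub>R v) - f (x + t *\<^sub>R w)) / t) mv < e" if t: "0 < t" "t < r" for t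
    proof -
      have "t * (norm w + 1) < d" using t(2) by (simp add: r_def pos_less_divide_eq add_nonneg_pos)
      then have "norm (t *\<^sub>R w) < d" using t(1) by (simp add: algebra_simps)
      then obtain q where q: "q \<in> S" "dist q (x + t *\<^sub>R w) \<le> e' * norm (t *\<^sub>R w)" using d(2) by blast
      have Lq: "L * dist q (x + t *\<^sub>R w) \<le> \<eta> * t"
      proof -
        have "L * dist q (x + t *\<^sub>R w) \<le> L * (e' * norm (t *\<^sub>R w))" using q(2) L by (rule mult_left_mono)
        also have "\<dots> = L * (e' * norm w) * t" using t by simp
        also have "\<dots> \<le> \<eta> * t" using Le t by (intro mult_right_mono) auto
        finally show ?thesis .
      qed
      have "\<bar>f q - f (x + t *\<^sub>R w)\<bar> \<le> \<eta> * t"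
        using lipschitz_onD[OF lip, of q "x + t *\<^sub>R w"] Lq by (simp add: dist_real_def)
      moreover have "\<bar>f (q + t *\<^sub>R v) - f (x + t *\<^sub>R w + t *\<^sub>R v)\<bar> \<le> \<eta> * t"
        using lipschitz_onD[OF lip, of "q + t *\<^sub>R v" "x + t *\<^sub>R w + t *\<^sub>R v"] Lq by (simp add: dist_real_def)
      moreover have "\<bar>f (q + t *\<^sub>R v) - f q - t * c\<bar> \<le> \<eta> * t"
        using q(1) t by (simp add: S_def \<eta>_def r_def)
      moreover have "\<bar>t * c - t * mv\<bar> \<le> \<eta> * t"
      proof -
        have "\<bar>t * c - t * mv\<bar> = t * (c - mv)" using t c by (simp add: right_diff_distrib[symmetric] abs_mult)
        also have "\<dots> \<le> t * \<eta>" using t c \<eta> by (intro mult_left_mono) auto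
        finally show ?thesis by (simp add: mult.commute)
      qed
      ultimately have "\<bar>f (x + t *\<^sub>R w + t *\<^sub>R v) - f (x + t *\<^sub>R w) - t * mv\<bar> \<le> 4 * \<eta> * t"
        by linarith
      also have "\<dots> < e * t" using \<eta> t by (intro mult_strict_right_mono) auto
      finally have "\<bar>f (x + t *\<^sub>R w + t *\<^sub>R v) - f (x + t *\<^sub>R w) - t * mv\<bar> / t < e"
        using t by (simp add: pos_divide_less_eq)
      also have "\<bar>f (x + t *\<^sub>R w + t *\<^sub>R v) - f (x + t *\<^sub>R w) - t * mv\<bar> / t
          = \<bar>(f (x + t *\<^sub>R w + t *\<^sub>R v) - f (x + t *\<^sub>R w) - t * mv) / t\<bar>"
        using t by (simp add: abs_divide)
      also have "(f (x + t *\<^sub>R w + t *\<^sub>R v) - f (x + t *\<^sub>R w) - t * mv) / t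
          = (f (x + t *\<^sub>R w + t *\<^sub>R v) - f (x + t *\<^sub>R w)) / t - mv"
        using t by (simp add: diff_divide_distrib)
      finally show ?thesis by (simp add: dist_real_def)
    qed
    then show "\<forall>\<^sub>F t in at_right 0. dist ((f (x + t *\<^sub>R w + t *\<^sub>R v) - f (x + t *\<^sub>R w)) / t) mv < e"
      unfolding eventually_at_right_field using r by blast
  qed
  from tendsto_add[OF this lw] show ?thesis
    by (simp add: add_divide_distrib[symmetric] scaleR_add_right add_ac)
qed

text \<open>Off a null set the directional derivatives are additive and homogeneous over the
  rational vectors, which yields gradients. The two suprema are Lipschitz in \<open>h\<close>, so
  they too need comparing only along rational directions: from above by the estimate uniform in
  \<open>k\<close>, from below by one nearly optimal \<open>k\<close>.\<close>

theorem metric_rademacher: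
  fixes u :: "nat \<Rightarrow> 'a::euclidean_space \<Rightarrow> real"
  assumes u: "\<And>k. L-lipschitz_on UNIV (u k)"
  obtains N g where "negligible N"
    "\<And>k x. x \<notin> N \<Longrightarrow> (u k has_derivative (\<lambda>h. g k x \<bullet> h)) (at x)"
    "\<And>x e. \<lbrakk>x \<notin> N; 0 < e\<rbrakk> \<Longrightarrow>
      \<exists>d>0. \<forall>h. norm h < d \<longrightarrow> \<bar>(SUP k. \<bar>u k (x + h) - u k x\<bar>) - (SUP k. \<bar>g k x \<bullet> h\<bar>)\<bar> \<le> e * norm h"
proof -
  have L: "L \<ge> 0" using u[of 0] by (rule lipschitz_on_nonneg)
  define D where "D = {v::'a. \<forall>b\<in>Basis. v \<bullet> b \<in> \<rat>}"
  have D: "countable D" "closure D = UNIV"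
    unfolding D_def by (rule countable_rational_vectors closure_rational_vectors)+
  have Dadd: "v + w \<in> D" if "v \<in> D" "w \<in> D" for v w using that by (auto simp: D_def inner_add_left)
  have Dscale: "r *\<^sub>R v \<in> D" if "v \<in> D" "r \<in> \<rat>" for v r using that by (auto simp: D_def)
  have D0: "0 \<in> D" by (auto simp: D_def)
  have DB: "b \<in> D" if "b \<in> Basis" for b using that by (auto simp: D_def inner_Basis)
  define P where "P v N m \<longleftrightarrow> negligible N \<and>
    (\<forall>k x. x \<notin> N \<longrightarrow> ((\<lambda>h. (u k (x + h *\<^sub>R v) - u k x) / h) \<longlongrightarrow> m k x) (at_right 0)) \<and>
    (\<forall>x e. x \<notin> N \<and> 0 < e \<longrightarrow>
      (\<exists>d>0. \<forall>h k. 0 < h \<and> h < d \<longrightarrow> \<bar>u k (x + h *\<^sub>R v) - u k x\<bar> \<le> ((SUP k. \<bar>m k x\<bar>) + e) * h))" for v N m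
  have "\<exists>N m. P v N m" for v
    unfolding P_def by (rule lipschitz_sequence_directional_derivatives[where u = u and v = v, OF u]) blast
  then obtain N1 m where P: "\<And>v. P v (N1 v) (m v)" by metis
  have N1: "negligible (N1 v)" for v using P by (simp add: P_def)
  have m: "((\<lambda>h. (u k (x + h *\<^sub>R v) - u k x) / h) \<longlongrightarrow> m v k x) (at_right 0)" if "x \<notin> N1 v" for v k x
    using P that by (simp add: P_def)
  have msup: "\<exists>d>0. \<forall>h k. 0 < h \<and> h < d \<longrightarrow> \<bar>u k (x + h *\<^sub>R v) - u k x\<bar> \<le> ((SUP k. \<bar>m v k x\<bar>) + e) * h"
    if "x \<notin> N1 v" "0 < e" for v x e
    using P[of v] that by (simp add: P_def)
  define S where "S v k c i n = {p. \<forall>t. 0 < t \<and> t < 1 / real (Suc i) \<longrightarrow>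
      \<bar>u k (p + t *\<^sub>R v) - u k p - t * c\<bar> \<le> t / real (Suc n)}" for v k c i n
  define Z where "Z v k c i n = {x\<in>S v k c i n. \<not> (\<forall>e>0. \<exists>d>0. \<forall>h. norm h < d \<longrightarrow>
      (\<exists>q\<in>S v k c i n. dist q (x + h) \<le> e * norm h))}" for v k c i n
  have Z: "negligible (Z v k c i n)" for v k c i n unfolding Z_def by (rule negligible_porous_points)
  \<comment> \<open>All parameters range over countable sets, so discarding every exceptional and
    every porous set still removes only a null set.\<close>
  define N where "N = (\<Union>v\<in>D. N1 v) \<union> (\<Union>v\<in>D. \<Union>k. \<Union>c\<in>\<rat>. \<Union>i. \<Union>n. Z v k c i n)"
  have N: "negligible N"
    unfolding N_def using D(1) countable_rat
    by (intro negligible_Un negligible_UN_countable N1 Z) auto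
  define g where "g k x = (\<Sum>b\<in>Basis. m b k x *\<^sub>R b)" for k x
  have mlim: "((\<lambda>h. (u k (x + h *\<^sub>R v) - u k x) / h) \<longlongrightarrow> m v k x) (at_right 0)" if "x \<notin> N" "v \<in> D" for x v k
    by (rule m) (use that in \<open>auto simp: N_def\<close>)
  have meq: "m v k x = l" if "x \<notin> N" "v \<in> D" "((\<lambda>h. (u k (x + h *\<^sub>R v) - u k x) / h) \<longlongrightarrow> l) (at_right 0)" for x v k l
    using tendsto_unique[OF _ mlim[OF that(1,2)] that(3)] by simp
  have add: "m (v + w) k x = m v k x + m w k x" if x: "x \<notin> N" and v: "v \<in> D" and w: "w \<in> D" for x v w k
  proof (rule meq[OF x Dadd[OF v w]], rule directional_derivative_add[OF u mlim[OF x v] mlim[OF x w]])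
    fix c :: real and i n :: nat assume c: "c \<in> \<rat>"
    have "x \<notin> Z v k c i n" using x v c by (auto simp: N_def)
    then show "let S = {p. \<forall>t. 0 < t \<and> t < 1 / real (Suc i) \<longrightarrow> \<bar>u k (p + t *\<^sub>R v) - u k p - t * c\<bar> \<le> t / real (Suc n)}
        in x \<in> S \<longrightarrow> (\<forall>e>0. \<exists>d>0. \<forall>h. norm h < d \<longrightarrow> (\<exists>q\<in>S. dist q (x + h) \<le> e * norm h))"
      unfolding Let_def Z_def S_def by blast
  qed
  have m0: "m 0 k x = 0" if "x \<notin> N" for k x
    by (rule meq[OF that D0]) simp
  \<comment> \<open>One-sided limits give homogeneity for positive factors by rescaling the step;
    negative factors follow from additivity and \<open>m0\<close>.\<close>
  have pos: "m (r *\<^sub>R v) k x = r * m v k x" if x: "x \<notin> N" and v: "v \<in> D" and r: "r \<in> \<rat>" "0 < r" for x v k r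
  proof (rule meq[OF x Dscale[OF v r(1)]])
    have "filterlim (\<lambda>h. r * h) (at_right 0) (at_right 0)"
      by (rule filterlim_times_pos[OF filterlim_ident r(2)]) simp
    from tendsto_mult[OF tendsto_const[of r] filterlim_compose[OF mlim[OF x v, of k] this]]
    show "((\<lambda>h. (u k (x + h *\<^sub>R r *\<^sub>R v) - u k x) / h) \<longlongrightarrow> r * m v k x) (at_right 0)"
      using r(2) by (simp add: mult.commute)
  qed
  have scale: "m (r *\<^sub>R v) k x = r * m v k x" if x: "x \<notin> N" and v: "v \<in> D" and r: "r \<in> \<rat>" for x v k r
  proof -
    consider "r > 0" | "r = 0" | "r < 0" by linarith
    then show ?thesis
    proof cases
      case 3
      have r': "- r \<in> \<rat>" using r by simp
      have "m (r *\<^sub>R v + (- r) *\<^sub>R v) k x = m (r *\<^sub>R v) k x + (- r) * m v k x"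
        using add[OF x Dscale[OF v r] Dscale[OF v r'], of k] pos[OF x v r', of k] 3 by simp
      then show ?thesis using m0[OF x, of k] by simp
    qed (use pos[OF x v r] m0[OF x] in auto)
  qed
  have msum: "m (\<Sum>b\<in>B. (v \<bullet> b) *\<^sub>R b) k x = (\<Sum>b\<in>B. (v \<bullet> b) * m b k x) \<and> (\<Sum>b\<in>B. (v \<bullet> b) *\<^sub>R b) \<in> D"
    if x: "x \<notin> N" and v: "v \<in> D" and B: "B \<subseteq> Basis" for x v k B
    using finite_subset[OF B finite_Basis] B
  proof (induction B rule: finite_induct)
    case empty
    then show ?case using m0[OF x] D0 by simp
  next
    case (insert b B)
    have b: "b \<in> D" "v \<bullet> b \<in> \<rat>" using insert.prems v DB by (auto simp: D_def)
    then show ?case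
      using insert add[OF x Dscale[OF b]] scale[OF x b] Dadd[OF Dscale[OF b]] by simp
  qed
  have mg: "m v k x = g k x \<bullet> v" if "x \<notin> N" "v \<in> D" for x v k
  proof -
    have "m v k x = (\<Sum>b\<in>Basis. (v \<bullet> b) * m b k x)"
      using msum[OF that order_refl, of k] by (simp add: euclidean_representation)
    also have "\<dots> = g k x \<bullet> v" unfolding g_def inner_sum_left by (intro sum.cong) (auto simp: inner_commute mult.commute)
    finally show ?thesis .
  qed
  have der: "(u k has_derivative (\<lambda>h. g k x \<bullet> h)) (at x)" if "x \<notin> N" for k x
    using mlim[OF that] mg[OF that] by (intro has_gradient_if_directional[OF u D(2)]) simp
  have gL: "norm (g k x) \<le> L" if "x \<notin> N" for k x
    by (rule lipschitz_norm_gradient_le[OF u der[OF that]])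
  show ?thesis
  proof (rule that[OF N der])
    fix x e assume x: "x \<notin> N" and "e > (0::real)"
    define \<rho> where "\<rho> h = (SUP k. \<bar>u k (x + h) - u k x\<bar>)" for h
    define \<sigma> where "\<sigma> h = (SUP k. \<bar>g k x \<bullet> h\<bar>)" for h
    have bg: "\<bar>g k x \<bullet> h\<bar> \<le> L * norm h" for k h
      using Cauchy_Schwarz_ineq2[of "g k x" h] mult_right_mono[OF gL[OF x, of k], of "norm h"] by simp
    have bu: "\<bar>u k (x + h) - u k x\<bar> \<le> L * norm h" for k h
      using lipschitz_onD[OF u, of "x + h" x k] by (simp add: dist_real_def dist_norm)
    have bddg: "bdd_above (range (\<lambda>k. \<bar>g k x \<bullet> h\<bar>))" for h by (intro bdd_aboveI2[of _ _ "L * norm h"] bg)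
    have bddu: "bdd_above (range (\<lambda>k. \<bar>u k (x + h) - u k x\<bar>))" for h by (intro bdd_aboveI2[of _ _ "L * norm h"] bu)
    have \<rho>lip: "\<rho> h \<le> \<rho> h' + L * norm (h - h')" for h h'
      unfolding \<rho>_def
    proof (rule cSUP_le_add[OF _ bddu])
      fix k
      have "\<bar>u k (x + h) - u k (x + h')\<bar> \<le> L * norm (h - h')"
        using lipschitz_onD[OF u, of "x + h" "x + h'" k] by (simp add: dist_real_def dist_norm)
      then show "\<bar>u k (x + h) - u k x\<bar> \<le> \<bar>u k (x + h') - u k x\<bar> + L * norm (h - h')" by linarith
    qed
    have \<sigma>lip: "\<sigma> h \<le> \<sigma> h' + L * norm (h - h')" for h h'
      unfolding \<sigma>_def
    proof (rule cSUP_le_add[OF _ bddg])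
      fix k
      show "\<bar>g k x \<bullet> h\<bar> \<le> \<bar>g k x \<bullet> h'\<bar> + L * norm (h - h')"
        using bg[of k "h - h'"] by (simp add: inner_diff_right)
    qed
    have \<sigma>scale: "\<sigma> (t *\<^sub>R v) = t * \<sigma> v" if "t > 0" for t v
    proof -
      have "\<sigma> (t *\<^sub>R v) \<le> t * \<sigma> v" if "t > 0" for t v
        unfolding \<sigma>_def
      proof (rule cSUP_least)
        fix k
        have "\<bar>g k x \<bullet> v\<bar> \<le> (SUP k. \<bar>g k x \<bullet> v\<bar>)" by (intro cSUP_upper bddg) simp
        then show "\<bar>g k x \<bullet> t *\<^sub>R v\<bar> \<le> t * (SUP k. \<bar>g k x \<bullet> v\<bar>)"
          using that by (simp add: abs_mult)
      qed simp
      from this[OF that, of v] this[of "inverse t" "t *\<^sub>R v"] that show ?thesis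
        by (simp add: field_simps)
    qed
    have \<rho>0: "\<rho> 0 = 0" "\<sigma> 0 = 0" by (auto simp: \<rho>_def \<sigma>_def)
    have lip2: "(2 * L)-lipschitz_on UNIV (\<lambda>h. s * (\<rho> h - \<sigma> h))" if "s = 1 \<or> s = - 1" for s
    proof (rule lipschitz_onI)
      fix h h'
      show "dist (s * (\<rho> h - \<sigma> h)) (s * (\<rho> h' - \<sigma> h')) \<le> 2 * L * dist h h'"
        using \<rho>lip[of h h'] \<rho>lip[of h' h] \<sigma>lip[of h h'] \<sigma>lip[of h' h] that
        by (auto simp: dist_real_def dist_norm norm_minus_commute abs_le_iff)
    qed (use L in simp)
    \<comment> \<open>Here one \<open>d\<close> must serve all \<open>k\<close> at once, which is
      what \<open>msup\<close> provides.\<close>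
    have up: "\<exists>d>0. \<forall>t. 0 < t \<and> t < d \<longrightarrow> 1 * (\<rho> (t *\<^sub>R v) - \<sigma> (t *\<^sub>R v)) \<le> e * t" if v: "v \<in> D" and "e > 0" for v e
    proof -
      have "x \<notin> N1 v" using x v by (auto simp: N_def)
      then obtain d where d: "d > 0" "\<And>h k. 0 < h \<Longrightarrow> h < d \<Longrightarrow> \<bar>u k (x + h *\<^sub>R v) - u k x\<bar> \<le> (\<sigma> v + e) * h"
        using msup[of x v e] \<open>e > 0\<close> unfolding \<sigma>_def mg[OF x v] by blast
      have "1 * (\<rho> (t *\<^sub>R v) - \<sigma> (t *\<^sub>R v)) \<le> e * t" if t: "0 < t" "t < d" for t
      proof -
        have "\<rho> (t *\<^sub>R v) \<le> (\<sigma> v + e) * t" unfolding \<rho>_def by (intro cSUP_least d(2) t) simp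
        then show ?thesis using \<sigma>scale[OF t(1), of v] by (simp add: algebra_simps)
      qed
      with d(1) show ?thesis by blast
    qed
    \<comment> \<open>A single \<open>k\<close> whose derivative almost attains the supremum bounds
      the increments from below.\<close>
    have low: "\<exists>d>0. \<forall>t. 0 < t \<and> t < d \<longrightarrow> (- 1) * (\<rho> (t *\<^sub>R v) - \<sigma> (t *\<^sub>R v)) \<le> e * t" if v: "v \<in> D" and "e > 0" for v e
    proof -
      obtain k where k: "\<sigma> v - e / 2 < \<bar>g k x \<bullet> v\<bar>"
        using less_cSUP_iff[of UNIV "\<lambda>k. \<bar>g k x \<bullet> v\<bar>" "\<sigma> v - e / 2"] bddg[of v] \<open>e > 0\<close> unfolding \<sigma>_def by auto
      obtain d where d: "d > 0" "\<And>h. 0 < h \<Longrightarrow> h < d \<Longrightarrow> dist ((u k (x + h *\<^sub>R v) - u k x) / h) (g k x \<bullet> v) < e / 2"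
        using tendstoD[OF mlim[OF x v, of k], of "e / 2"] \<open>e > 0\<close> unfolding eventually_at_right_field mg[OF x v] by auto
      have "(- 1) * (\<rho> (t *\<^sub>R v) - \<sigma> (t *\<^sub>R v)) \<le> e * t" if t: "0 < t" "t < d" for t
      proof -
        have "\<sigma> v - e \<le> \<bar>(u k (x + t *\<^sub>R v) - u k x) / t\<bar>"
          using d(2)[OF t] k unfolding dist_real_def by linarith
        then have "(\<sigma> v - e) * t \<le> \<bar>u k (x + t *\<^sub>R v) - u k x\<bar>"
          using t by (simp add: abs_divide pos_le_divide_eq)
        also have "\<dots> \<le> \<rho> (t *\<^sub>R v)" unfolding \<rho>_def by (intro cSUP_upper bddu) simp
        finally show ?thesis using \<sigma>scale[OF t(1), of v] by (simp add: algebra_simps)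
      qed
      with d(1) show ?thesis by blast
    qed
    obtain d1 where d1: "d1 > 0" "\<And>h. norm h < d1 \<Longrightarrow> 1 * (\<rho> h - \<sigma> h) \<le> e * norm h"
      using lipschitz_le_little_o_dense[OF lip2[of 1] _ D(2) up \<open>e > 0\<close>] \<rho>0 by auto
    obtain d2 where d2: "d2 > 0" "\<And>h. norm h < d2 \<Longrightarrow> (- 1) * (\<rho> h - \<sigma> h) \<le> e * norm h"
      using lipschitz_le_little_o_dense[OF lip2[of "- 1"] _ D(2) low \<open>e > 0\<close>] \<rho>0 by auto
    have "\<bar>\<rho> h - \<sigma> h\<bar> \<le> e * norm h" if "norm h < min d1 d2" for h
      using d1(2)[of h] d2(2)[of h] that by (simp add: abs_le_iff)
    then show "\<exists>d>0. \<forall>h. norm h < d \<longrightarrow> \<bar>(SUP k. \<bar>u k (x + h) - u k x\<bar>) - (SUP k. \<bar>g k x \<bullet> h\<bar>)\<bar> \<le> e * norm h"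
      unfolding \<rho>_def \<sigma>_def using d1(1) d2(1) by (intro exI[of _ "min d1 d2"]) auto
  qed
qed

section \<open>Mollification and Lusin approximation by C1 functions\<close>

lemma integrable_continuous_bounded_support:
  fixes f :: "'a::euclidean_space \<Rightarrow> 'b::{banach, second_countable_topology}"
  assumes "continuous_on UNIV f" "\<And>z. R < norm z \<Longrightarrow> f z = 0"
  shows "integrable lborel f"
proof -
  have "integrable lborel (\<lambda>x. indicator (cball 0 R) x *\<^sub>R f x)"
    by (intro borel_integrable_compact continuous_on_subset[OF assms(1)]) auto
  also have "(\<lambda>x. indicator (cball 0 R) x *\<^sub>R f x) = f"
    using assms(2) by (auto simp: fun_eq_iff indicator_def not_le)
  finally show ?thesis .
qed

lemma norm_integral_le_bounded_support:
  fixes f :: "'a::euclidean_space \<Rightarrow> 'b::{banach, second_countable_topology}"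
  assumes "continuous_on UNIV f" "\<And>z. R < norm z \<Longrightarrow> f z = 0"
    and B: "\<And>z. norm z \<le> R \<Longrightarrow> norm (f z) \<le> B"
  shows "norm (\<integral>z. f z \<partial>lborel) \<le> B * measure lborel (cball (0::'a) R)"
proof -
  have int: "integrable lborel f"
    using assms(1,2) by (rule integrable_continuous_bounded_support)
  have "norm (\<integral>z. f z \<partial>lborel) \<le> (\<integral>z. norm (f z) \<partial>lborel)" by (rule integral_norm_bound)
  also have "\<dots> \<le> (\<integral>z. B * indicator (cball (0::'a) R) z \<partial>lborel)"
  proof (rule integral_mono)
    show "integrable lborel (\<lambda>z. B * indicator (cball (0::'a) R) z)"
      by (intro integrable_mult_right integrable_real_indicator) (simp_all add: emeasure_bounded_finite[unfolded infinity_ennreal_def])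
    show "norm (f z) \<le> B * indicator (cball 0 R) z" for z
      using assms(2)[of z] B[of z] by (cases "norm z \<le> R") auto
  qed (use int in simp)
  also have "\<dots> = B * measure lborel (cball (0::'a) R)" by simp
  finally show ?thesis .
qed

lemma integral_lborel_translate:
  fixes f :: "'a::euclidean_space \<Rightarrow> 'b::{banach, second_countable_topology}"
  assumes "f \<in> borel_measurable borel"
  shows "(\<integral>z. f (a + z) \<partial>lborel) = (\<integral>z. f z \<partial>lborel)"
proof -
  have "(\<integral>z. f z \<partial>lborel) = (\<integral>z. f z \<partial>distr lborel borel ((+) a))"
    by (simp only: lborel_distr_plus)
  also have "\<dots> = (\<integral>z. f (a + z) \<partial>lborel)"
    using assms by (intro integral_distr) auto
  finally show ?thesis by simp
qed

text \<open>The square of the positive part has derivative \<open>2 * max 0 q\<close>, which is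
  2-Lipschitz. This makes the kernel below differentiable across the boundary of its support, with
  quadratic remainder.\<close>

lemma max_0_square_taylor:
  fixes p q :: real
  shows "\<bar>(max 0 p)\<^sup>2 - (max 0 q)\<^sup>2 - 2 * max 0 q * (p - q)\<bar> \<le> (p - q)\<^sup>2"
proof -
  consider "p \<ge> 0" "q \<ge> 0" | "p \<ge> 0" "q < 0" | "p < 0" "q \<ge> 0" | "p < 0" "q < 0" by linarith
  then show ?thesis
  proof cases
    case 1
    then have "(max 0 p)\<^sup>2 - (max 0 q)\<^sup>2 - 2 * max 0 q * (p - q) = (p - q)\<^sup>2"
      by (simp add: power2_eq_square algebra_simps)
    then show ?thesis by simp
  next
    case 2
    then have "p\<^sup>2 \<le> (p - q)\<^sup>2" by (intro power_mono) auto
    with 2 show ?thesis by simp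
  next
    case 3
    then have "q * p \<le> 0" by (simp add: mult_nonneg_nonpos)
    then have a: "0 \<le> q\<^sup>2 - 2 * (p * q)" by (simp add: mult.commute) (smt (verit) zero_le_power2)
    have "- q\<^sup>2 - 2 * q * (p - q) = q\<^sup>2 - 2 * (p * q)" by (simp add: power2_eq_square algebra_simps)
    moreover have "q\<^sup>2 - 2 * (p * q) \<le> (p - q)\<^sup>2" by (simp add: power2_eq_square algebra_simps)
    ultimately show ?thesis using 3 a by simp
  qed simp
qed

text \<open>A bump with one continuous derivative is enough here, and the polynomial form keeps all
  its bounds explicit. It is not normalized; \<open>moll_mass\<close> divides out its
  integral.\<close>

definition moll_kernel :: "real \<Rightarrow> 'a::euclidean_space \<Rightarrow> real" where
  "moll_kernel \<delta> z = (max 0 (\<delta>\<^sup>2 - z \<bullet> z))\<^sup>2"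

text \<open>This is minus the gradient of the kernel, that is, the gradient at \<open>h = 0\<close>
  of \<open>moll_kernel \<delta> (z - h)\<close>. The sign fits the translation that moves an
  increment of \<open>x\<close> onto the kernel.\<close>

definition moll_kernel_grad :: "real \<Rightarrow> 'a::euclidean_space \<Rightarrow> 'a" where
  "moll_kernel_grad \<delta> z = (4 * max 0 (\<delta>\<^sup>2 - z \<bullet> z)) *\<^sub>R z"

text \<open>The type argument fixes the space of integration, which the number \<delta> alone does
  not determine.\<close>

definition moll_mass :: "'a::euclidean_space itself \<Rightarrow> real \<Rightarrow> real" where
  "moll_mass _ \<delta> = (\<integral>z. moll_kernel \<delta> (z::'a) \<partial>lborel)"

definition mollify :: "real \<Rightarrow> ('a::euclidean_space \<Rightarrow> real) \<Rightarrow> 'a \<Rightarrow> real" where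
  "mollify \<delta> u x = (\<integral>z. moll_kernel \<delta> z * u (x + z) \<partial>lborel) / moll_mass TYPE('a) \<delta>"

text \<open>The derivative falls on the kernel, so a bound on the values of \<open>u\<close> near
  \<open>x\<close> already bounds this gradient.\<close>

definition mollify_grad :: "real \<Rightarrow> ('a::euclidean_space \<Rightarrow> real) \<Rightarrow> 'a \<Rightarrow> 'a" where
  "mollify_grad \<delta> u x = (\<integral>z. u (x + z) *\<^sub>R moll_kernel_grad \<delta> z \<partial>lborel) /\<^sub>R moll_mass TYPE('a) \<delta>"

lemma moll_kernel_nonneg: "0 \<le> moll_kernel \<delta> z"
  by (simp add: moll_kernel_def)

lemma moll_kernel_support:
  assumes "0 < \<delta>" "\<delta> \<le> norm z"
  shows "moll_kernel \<delta> z = 0" "moll_kernel_grad \<delta> z = 0"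
proof -
  have "\<delta>\<^sup>2 \<le> (norm z)\<^sup>2" using assms by (intro power_mono) auto
  then have "\<delta>\<^sup>2 - z \<bullet> z \<le> 0" by (simp add: dot_square_norm)
  then show "moll_kernel \<delta> z = 0" "moll_kernel_grad \<delta> z = 0"
    by (simp_all add: moll_kernel_def moll_kernel_grad_def max_def)
qed

lemma continuous_moll_kernel [continuous_intros]:
  "continuous_on S f \<Longrightarrow> continuous_on S (\<lambda>x. moll_kernel \<delta> (f x))"
  "continuous_on S f \<Longrightarrow> continuous_on S (\<lambda>x. moll_kernel_grad \<delta> (f x))"
  unfolding moll_kernel_def moll_kernel_grad_def by (auto intro!: continuous_intros)

lemma norm_moll_kernel_grad_le:
  assumes "0 < \<delta>" "norm z \<le> \<delta>"
  shows "norm (moll_kernel_grad \<delta> z) \<le> 4 * \<delta> ^ 3"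
proof -
  have "norm (moll_kernel_grad \<delta> z) = 4 * max 0 (\<delta>\<^sup>2 - z \<bullet> z) * norm z"
    by (simp add: moll_kernel_grad_def)
  also have "\<dots> \<le> 4 * \<delta>\<^sup>2 * \<delta>"
    using assms by (intro mult_mono) (auto simp: max_def)
  finally show ?thesis by (simp add: power2_eq_square power3_eq_cube mult.assoc)
qed

lemma integrable_moll_kernel:
  fixes w :: "'a::euclidean_space \<Rightarrow> real"
  assumes "0 < \<delta>" "continuous_on UNIV w"
  shows "integrable lborel (\<lambda>z. moll_kernel \<delta> z * w z)"
  by (rule integrable_continuous_bounded_support[of _ \<delta>])
    (use moll_kernel_support[OF assms(1) less_imp_le] in \<open>auto intro!: continuous_intros assms(2)\<close>)

text \<open>On the ball of radius \<open>\<delta> / 2\<close> the kernel is at least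
  \<open>(3 / 4 * \<delta>\<^sup>2)\<^sup>2\<close>, which exceeds \<open>\<delta> ^ 4 / 2\<close>,
  and that ball has \<open>1 / 2 ^ DIM('a)\<close> of the volume of the full one.\<close>

lemma moll_mass_ge:
  assumes \<delta>: "0 < \<delta>"
  shows "\<delta> ^ 4 * measure lborel (cball (0::'a::euclidean_space) \<delta>) / 2 ^ (DIM('a) + 1) \<le> moll_mass TYPE('a) \<delta>"
    and "0 < moll_mass TYPE('a) \<delta>"
proof -
  have "\<delta> ^ 4 / 2 * measure lborel (cball (0::'a) (\<delta>/2)) = (\<integral>z. \<delta> ^ 4 / 2 * indicator (cball (0::'a) (\<delta>/2)) z \<partial>lborel)" by simp
  also have "\<dots> \<le> (\<integral>z. moll_kernel \<delta> (z::'a) \<partial>lborel)"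
  proof (rule integral_mono)
    show "integrable lborel (\<lambda>z. \<delta> ^ 4 / 2 * indicator (cball (0::'a) (\<delta>/2)) z)"
      by (intro integrable_mult_right integrable_real_indicator) (simp_all add: emeasure_bounded_finite[unfolded infinity_ennreal_def])
    show "integrable lborel (moll_kernel \<delta> :: 'a \<Rightarrow> real)"
      using integrable_moll_kernel[OF \<delta>, of "\<lambda>_. 1"] by simp
    fix z :: 'a
    show "\<delta> ^ 4 / 2 * indicator (cball 0 (\<delta>/2)) z \<le> moll_kernel \<delta> z"
    proof (cases "norm z \<le> \<delta> / 2")
      case True
      then have "(norm z)\<^sup>2 \<le> (\<delta> / 2)\<^sup>2" by (intro power_mono) auto
      then have "3 / 4 * \<delta>\<^sup>2 \<le> \<delta>\<^sup>2 - z \<bullet> z" by (simp add: dot_square_norm power_divide)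
      then have "(3 / 4 * \<delta>\<^sup>2)\<^sup>2 \<le> (max 0 (\<delta>\<^sup>2 - z \<bullet> z))\<^sup>2" by (intro power_mono) (auto simp: le_max_iff_disj)
      moreover have "\<delta> ^ 4 / 2 \<le> (3 / 4 * \<delta>\<^sup>2)\<^sup>2"
        by (simp add: power_mult_distrib power_divide power_mult[symmetric])
      ultimately have "\<delta> ^ 4 / 2 \<le> moll_kernel \<delta> z" unfolding moll_kernel_def by linarith
      then show ?thesis using True by simp
    qed (simp add: moll_kernel_nonneg)
  qed
  also have "\<delta> ^ 4 / 2 * measure lborel (cball (0::'a) (\<delta>/2)) = \<delta> ^ 4 * measure lborel (cball (0::'a) \<delta>) / 2 ^ (DIM('a) + 1)"
    using \<delta> by (simp add: content_cball power_divide)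
  finally show "\<delta> ^ 4 * measure lborel (cball (0::'a) \<delta>) / 2 ^ (DIM('a) + 1) \<le> moll_mass TYPE('a) \<delta>"
    by (simp add: moll_mass_def)
  moreover have "0 < \<delta> ^ 4 * measure lborel (cball (0::'a) \<delta>) / 2 ^ (DIM('a) + 1)"
    using \<delta> by simp
  ultimately show "0 < moll_mass TYPE('a) \<delta>" by linarith
qed

lemma abs_moll_kernel_integral_le:
  fixes w :: "'a::euclidean_space \<Rightarrow> real"
  assumes \<delta>: "0 < \<delta>" and w: "continuous_on UNIV w" and B: "\<And>z. norm z \<le> \<delta> \<Longrightarrow> \<bar>w z\<bar> \<le> B"
  shows "\<bar>(\<integral>z. moll_kernel \<delta> z * w z \<partial>lborel) / moll_mass TYPE('a) \<delta>\<bar> \<le> B"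
proof -
  have "\<bar>\<integral>z. moll_kernel \<delta> z * w z \<partial>lborel\<bar> \<le> (\<integral>z. \<bar>moll_kernel \<delta> z * w z\<bar> \<partial>lborel)"
    by (rule integral_abs_bound)
  also have "\<dots> \<le> (\<integral>z. moll_kernel \<delta> (z::'a) * B \<partial>lborel)"
  proof (rule integral_mono)
    show "integrable lborel (\<lambda>z. \<bar>moll_kernel \<delta> z * w z\<bar>)"
      using integrable_moll_kernel[OF \<delta> w] by simp
    show "integrable lborel (\<lambda>z. moll_kernel \<delta> (z::'a) * B)"
      by (rule integrable_moll_kernel[OF \<delta>]) simp
    show "\<bar>moll_kernel \<delta> z * w z\<bar> \<le> moll_kernel \<delta> z * B" for z
      using B[of z] moll_kernel_support(1)[OF \<delta>, of z] moll_kernel_nonneg[of \<delta> z]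
      by (cases "norm z \<le> \<delta>") (auto simp: abs_mult mult_left_mono)
  qed
  also have "\<dots> = B * moll_mass TYPE('a) \<delta>"
    using integrable_moll_kernel[OF \<delta>, of "\<lambda>_::'a. 1"] by (simp add: moll_mass_def)
  finally show ?thesis
    using moll_mass_ge(2)[OF \<delta>, where 'a='a] by (simp add: abs_divide pos_divide_le_eq)
qed

lemma mollify_diff:
  fixes u :: "'a::euclidean_space \<Rightarrow> real"
  assumes \<delta>: "0 < \<delta>" and u: "continuous_on UNIV u"
  shows "mollify \<delta> u x - mollify \<delta> u y
    = (\<integral>z. moll_kernel \<delta> z * (u (x + z) - u (y + z)) \<partial>lborel) / moll_mass TYPE('a) \<delta>"
proof -
  have c: "continuous_on UNIV (\<lambda>z. u (a + z))" for a
    by (rule continuous_on_compose2[OF u]) (auto intro!: continuous_intros)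
  show ?thesis
    unfolding mollify_def diff_divide_distrib[symmetric]
    by (subst Bochner_Integration.integral_diff[symmetric])
      (auto intro!: integrable_moll_kernel \<delta> c simp: right_diff_distrib)
qed

lemma mollify_const_diff:
  fixes u :: "'a::euclidean_space \<Rightarrow> real"
  assumes \<delta>: "0 < \<delta>" and u: "continuous_on UNIV u"
  shows "mollify \<delta> u x - b = (\<integral>z. moll_kernel \<delta> z * (u (x + z) - b) \<partial>lborel) / moll_mass TYPE('a) \<delta>"
proof -
  have c: "continuous_on UNIV (\<lambda>z. u (x + z))"
    by (rule continuous_on_compose2[OF u]) (auto intro!: continuous_intros)
  have "(\<integral>z. moll_kernel \<delta> z * (u (x + z) - b) \<partial>lborel)
    = (\<integral>z. moll_kernel \<delta> z * u (x + z) \<partial>lborel) - (\<integral>z. moll_kernel \<delta> (z::'a) * b \<partial>lborel)"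
    unfolding right_diff_distrib
    by (rule Bochner_Integration.integral_diff) (intro integrable_moll_kernel \<delta> c continuous_on_const)+
  also have "(\<integral>z. moll_kernel \<delta> (z::'a) * b \<partial>lborel) = b * moll_mass TYPE('a) \<delta>"
    using integrable_moll_kernel[OF \<delta>, of "\<lambda>_::'a. 1"] by (simp add: moll_mass_def)
  finally show ?thesis
    using moll_mass_ge(2)[OF \<delta>, where 'a='a] by (simp add: mollify_def diff_divide_distrib)
qed

lemma abs_mollify_diff_le:
  fixes u :: "'a::euclidean_space \<Rightarrow> real"
  assumes \<delta>: "0 < \<delta>" and u: "L-lipschitz_on UNIV u"
  shows "\<bar>mollify \<delta> u x - u x\<bar> \<le> L * \<delta>"
proof -
  have L: "L \<ge> 0" using u by (rule lipschitz_on_nonneg)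
  have uc: "continuous_on UNIV u" using u by (rule lipschitz_on_continuous_on)
  have c: "continuous_on UNIV (\<lambda>z. u (x + z) - u x)"
    by (intro continuous_intros continuous_on_compose2[OF uc]) auto
  show ?thesis
    unfolding mollify_const_diff[OF \<delta> uc]
  proof (rule abs_moll_kernel_integral_le[OF \<delta> c])
    fix z :: 'a assume z: "norm z \<le> \<delta>"
    have "\<bar>u (x + z) - u x\<bar> \<le> L * norm z"
      using lipschitz_onD[OF u, of "x + z" x] by (simp add: dist_real_def dist_norm)
    also have "\<dots> \<le> L * \<delta>" using z L by (rule mult_left_mono)
    finally show "\<bar>u (x + z) - u x\<bar> \<le> L * \<delta>" .
  qed
qed

lemma lipschitz_on_mollify:
  fixes u :: "'a::euclidean_space \<Rightarrow> real"
  assumes \<delta>: "0 < \<delta>" and u: "L-lipschitz_on UNIV u"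
  shows "L-lipschitz_on UNIV (mollify \<delta> u)"
proof (rule lipschitz_onI)
  fix x y :: 'a
  have uc: "continuous_on UNIV u" using u by (rule lipschitz_on_continuous_on)
  have c: "continuous_on UNIV (\<lambda>z. u (x + z) - u (y + z))"
    by (intro continuous_intros continuous_on_compose2[OF uc]) auto
  show "dist (mollify \<delta> u x) (mollify \<delta> u y) \<le> L * dist x y"
    unfolding dist_real_def mollify_diff[OF \<delta> uc]
  proof (rule abs_moll_kernel_integral_le[OF \<delta> c])
    fix z :: 'a
    show "\<bar>u (x + z) - u (y + z)\<bar> \<le> L * dist x y"
      using lipschitz_onD[OF u, of "x + z" "y + z"] by (simp add: dist_real_def)
  qed
qed (rule lipschitz_on_nonneg[OF u])

lemma continuous_scaleR_moll_kernel_grad: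
  fixes w :: "'a::euclidean_space \<Rightarrow> real"
  assumes "0 < \<delta>" "continuous_on UNIV w"
  shows "continuous_on UNIV (\<lambda>z. w z *\<^sub>R moll_kernel_grad \<delta> z)" "integrable lborel (\<lambda>z. w z *\<^sub>R moll_kernel_grad \<delta> z)"
proof -
  show c: "continuous_on UNIV (\<lambda>z. w z *\<^sub>R moll_kernel_grad \<delta> z)"
    by (intro continuous_intros assms(2))
  show "integrable lborel (\<lambda>z. w z *\<^sub>R moll_kernel_grad \<delta> z)"
    by (rule integrable_continuous_bounded_support[OF c, of \<delta>])
      (use moll_kernel_support[OF assms(1) less_imp_le] in auto)
qed

text \<open>The kernel gradient is at most \<open>4 * \<delta> ^ 3\<close>; dividing by the lower
  bound of the mass gives the factor \<open>2 ^ (DIM('a) + 3) / \<delta>\<close>. A function of size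
  of order \<delta> on the ball thus has a mollified gradient bounded independently of
  \<delta>.\<close>

lemma norm_moll_kernel_grad_integral_le:
  fixes w :: "'a::euclidean_space \<Rightarrow> real"
  assumes \<delta>: "0 < \<delta>" and w: "continuous_on UNIV w" and B: "\<And>z. norm z \<le> \<delta> \<Longrightarrow> \<bar>w z\<bar> \<le> B"
  shows "norm ((\<integral>z. w z *\<^sub>R moll_kernel_grad \<delta> z \<partial>lborel) /\<^sub>R moll_mass TYPE('a) \<delta>) \<le> 2 ^ (DIM('a) + 3) / \<delta> * B"
proof -
  let ?V = "measure lborel (cball (0::'a) \<delta>)" and ?c = "moll_mass TYPE('a) \<delta>"
  have B0: "B \<ge> 0" using B[of 0] \<delta> by simp
  have c: "?c > 0" by (rule moll_mass_ge(2)[OF \<delta>])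
  have "norm (\<integral>z. w z *\<^sub>R moll_kernel_grad \<delta> z \<partial>lborel) \<le> (B * (4 * \<delta> ^ 3)) * ?V"
  proof (rule norm_integral_le_bounded_support[OF continuous_scaleR_moll_kernel_grad(1)[OF \<delta> w]])
    show "w z *\<^sub>R moll_kernel_grad \<delta> z = 0" if "\<delta> < norm z" for z
      using moll_kernel_support(2)[OF \<delta>, of z] that by simp
    show "norm (w z *\<^sub>R moll_kernel_grad \<delta> z) \<le> B * (4 * \<delta> ^ 3)" if "norm z \<le> \<delta>" for z
      using B[OF that] norm_moll_kernel_grad_le[OF \<delta> that] B0 by (simp add: mult_mono)
  qed
  also have "\<dots> = 2 ^ (DIM('a) + 3) / \<delta> * B * (\<delta> ^ 4 * ?V / 2 ^ (DIM('a) + 1))"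
    using \<delta> by (simp add: power_add field_simps eval_nat_numeral)
  also have "\<dots> \<le> 2 ^ (DIM('a) + 3) / \<delta> * B * ?c"
    using moll_mass_ge(1)[OF \<delta>, where 'a='a] \<delta> B0 by (intro mult_left_mono) auto
  finally show ?thesis using c by (simp add: field_simps)
qed

lemma norm_mollify_grad_le:
  fixes u :: "'a::euclidean_space \<Rightarrow> real"
  assumes \<delta>: "0 < \<delta>" and u: "continuous_on UNIV u" and B: "\<And>z. norm z \<le> \<delta> \<Longrightarrow> \<bar>u (x + z)\<bar> \<le> B"
  shows "norm (mollify_grad \<delta> u x) \<le> 2 ^ (DIM('a) + 3) / \<delta> * B"
  unfolding mollify_grad_def
  by (rule norm_moll_kernel_grad_integral_le[OF \<delta> continuous_on_compose2[OF u] B]) (auto intro!: continuous_intros)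

lemma continuous_mollify_grad:
  fixes u :: "'a::euclidean_space \<Rightarrow> real"
  assumes \<delta>: "0 < \<delta>" and u: "L-lipschitz_on UNIV u"
  shows "continuous_on UNIV (mollify_grad \<delta> u)"
proof (rule lipschitz_on_continuous_on[of "2 ^ (DIM('a) + 3) / \<delta> * L"], rule lipschitz_onI)
  have uc: "continuous_on UNIV u" using u by (rule lipschitz_on_continuous_on)
  fix x y :: 'a
  have c: "continuous_on UNIV (\<lambda>z. u (a + z))" for a
    by (rule continuous_on_compose2[OF uc]) (auto intro!: continuous_intros)
  have "mollify_grad \<delta> u x - mollify_grad \<delta> u y
    = (\<integral>z. (u (x + z) - u (y + z)) *\<^sub>R moll_kernel_grad \<delta> z \<partial>lborel) /\<^sub>R moll_mass TYPE('a) \<delta>"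
    unfolding mollify_grad_def scaleR_diff_right[symmetric]
    by (subst Bochner_Integration.integral_diff[symmetric])
      (auto intro!: continuous_scaleR_moll_kernel_grad(2) \<delta> c simp: scaleR_diff_left)
  then have "dist (mollify_grad \<delta> u x) (mollify_grad \<delta> u y)
    = norm ((\<integral>z. (u (x + z) - u (y + z)) *\<^sub>R moll_kernel_grad \<delta> z \<partial>lborel) /\<^sub>R moll_mass TYPE('a) \<delta>)"
    by (simp add: dist_norm)
  also have "\<dots> \<le> 2 ^ (DIM('a) + 3) / \<delta> * (L * dist x y)"
  proof (rule norm_moll_kernel_grad_integral_le[OF \<delta>])
    show "\<bar>u (x + z) - u (y + z)\<bar> \<le> L * dist x y" for z
      using lipschitz_onD[OF u, of "x + z" "y + z"] by (simp add: dist_real_def)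
  qed (intro continuous_intros c)
  finally show "dist (mollify_grad \<delta> u x) (mollify_grad \<delta> u y) \<le> 2 ^ (DIM('a) + 3) / \<delta> * L * dist x y"
    by (simp add: mult.assoc)
qed (use \<delta> lipschitz_on_nonneg[OF u] in simp)

text \<open>For \<open>norm h \<le> 1\<close> the ball of radius \<open>\<delta> + 1\<close>
  contains the supports of both the kernel and its translate, so the uniform estimate covers every
  point where the integrand is nonzero.\<close>

lemma moll_kernel_taylor:
  fixes z h :: "'a::euclidean_space"
  assumes \<delta>: "0 < \<delta>" and z: "norm z \<le> \<delta> + 1" and h: "norm h \<le> 1"
  shows "\<bar>moll_kernel \<delta> (z - h) - moll_kernel \<delta> z - moll_kernel_grad \<delta> z \<bullet> h\<bar> \<le> (2 * \<delta>\<^sup>2 + (2 * \<delta> + 3)\<^sup>2) * (norm h)\<^sup>2"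
proof -
  define q where "q = \<delta>\<^sup>2 - z \<bullet> z"
  define p where "p = \<delta>\<^sup>2 - (z - h) \<bullet> (z - h)"
  have pq: "p - q = 2 * (z \<bullet> h) - (norm h)\<^sup>2"
    by (simp add: p_def q_def inner_diff_left inner_diff_right inner_commute power2_norm_eq_inner)
  have "\<bar>p - q\<bar> \<le> 2 * \<bar>z \<bullet> h\<bar> + (norm h)\<^sup>2"
    unfolding pq by (simp add: abs_le_iff) (smt (verit) zero_le_power2)
  also have "\<bar>z \<bullet> h\<bar> \<le> (\<delta> + 1) * norm h"
    using Cauchy_Schwarz_ineq2[of z h] mult_right_mono[OF z, of "norm h"] by simp
  also have "(norm h)\<^sup>2 \<le> 1 * norm h"
    unfolding power2_eq_square using h by (intro mult_right_mono) auto
  finally have "\<bar>p - q\<bar> \<le> (2 * \<delta> + 3) * norm h" by (simp add: algebra_simps)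
  then have "\<bar>p - q\<bar>\<^sup>2 \<le> ((2 * \<delta> + 3) * norm h)\<^sup>2" by (intro power_mono) auto
  then have 1: "(p - q)\<^sup>2 \<le> (2 * \<delta> + 3)\<^sup>2 * (norm h)\<^sup>2" by (simp add: power_mult_distrib)
  have "q \<le> \<delta>\<^sup>2" by (simp add: q_def)
  then have "max 0 q \<le> \<delta>\<^sup>2" by simp
  then have 2: "2 * max 0 q * (norm h)\<^sup>2 \<le> 2 * \<delta>\<^sup>2 * (norm h)\<^sup>2" by (intro mult_right_mono) auto
  have "moll_kernel \<delta> (z - h) - moll_kernel \<delta> z - moll_kernel_grad \<delta> z \<bullet> h
      = ((max 0 p)\<^sup>2 - (max 0 q)\<^sup>2 - 2 * max 0 q * (p - q)) - 2 * max 0 q * (norm h)\<^sup>2"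
    unfolding pq moll_kernel_def moll_kernel_grad_def p_def[symmetric] q_def[symmetric] inner_scaleR_left
    by (simp add: algebra_simps)
  moreover have "0 \<le> 2 * max 0 q * (norm h)\<^sup>2" by simp
  moreover have "(2 * \<delta>\<^sup>2 + (2 * \<delta> + 3)\<^sup>2) * (norm h)\<^sup>2 = 2 * \<delta>\<^sup>2 * (norm h)\<^sup>2 + (2 * \<delta> + 3)\<^sup>2 * (norm h)\<^sup>2"
    by (simp add: distrib_right)
  ultimately show ?thesis
    using max_0_square_taylor[of p q] 1 2 by linarith
qed

text \<open>Translation invariance moves the increment \<open>h\<close> from \<open>u\<close> to the
  kernel. The Taylor remainder of the kernel then integrates to at most
  \<open>M * (norm h)\<^sup>2\<close>.\<close>

lemma has_derivative_mollify:
  fixes u :: "'a::euclidean_space \<Rightarrow> real"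
  assumes \<delta>: "0 < \<delta>" and u: "L-lipschitz_on UNIV u"
  shows "(mollify \<delta> u has_derivative (\<lambda>h. mollify_grad \<delta> u x \<bullet> h)) (at x)"
proof -
  let ?c = "moll_mass TYPE('a) \<delta>"
  have c: "?c > 0" by (rule moll_mass_ge(2)[OF \<delta>])
  have L: "L \<ge> 0" using u by (rule lipschitz_on_nonneg)
  have uc: "continuous_on UNIV u" using u by (rule lipschitz_on_continuous_on)
  have ucx: "continuous_on UNIV (\<lambda>z. u (a + z))" for a
    by (rule continuous_on_compose2[OF uc]) (auto intro!: continuous_intros)
  define B where "B = \<bar>u x\<bar> + L * (\<delta> + 1)"
  have B: "\<bar>u (x + z)\<bar> \<le> B" if "norm z \<le> \<delta> + 1" for z
  proof -
    have "\<bar>u (x + z) - u x\<bar> \<le> L * norm z"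
      using lipschitz_onD[OF u, of "x + z" x] by (simp add: dist_real_def dist_norm)
    also have "\<dots> \<le> L * (\<delta> + 1)" using that L by (rule mult_left_mono)
    finally show ?thesis unfolding B_def by linarith
  qed
  have B0: "B \<ge> 0" using L \<delta> by (simp add: B_def)
  define M where "M = B * (2 * \<delta>\<^sup>2 + (2 * \<delta> + 3)\<^sup>2) * measure lborel (cball (0::'a) (\<delta> + 1)) / ?c"
  have M: "M \<ge> 0" using B0 c by (simp add: M_def)
  have main: "\<bar>mollify \<delta> u (x + h) - mollify \<delta> u x - mollify_grad \<delta> u x \<bullet> h\<bar> \<le> M * (norm h)\<^sup>2" if h: "norm h \<le> 1" for h
  proof -
    have k0: "moll_kernel \<delta> (z - h) = 0" if "\<delta> + 1 < norm z" for z
      using that h norm_triangle_ineq2[of z h] by (intro moll_kernel_support(1)[OF \<delta>]) simp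
    have i1: "integrable lborel (\<lambda>z. moll_kernel \<delta> (z - h) * u (x + z))"
      by (rule integrable_continuous_bounded_support[of _ "\<delta> + 1"]) (use k0 in \<open>auto intro!: continuous_intros ucx\<close>)
    have i2: "integrable lborel (\<lambda>z. moll_kernel \<delta> z * u (x + z))"
      by (rule integrable_moll_kernel[OF \<delta> ucx])
    have i3: "integrable lborel (\<lambda>z. (u (x + z) *\<^sub>R moll_kernel_grad \<delta> z) \<bullet> h)"
      by (intro integrable_inner_left continuous_scaleR_moll_kernel_grad(2) \<delta> ucx)
    let ?f = "\<lambda>z. u (x + z) * (moll_kernel \<delta> (z - h) - moll_kernel \<delta> z - moll_kernel_grad \<delta> z \<bullet> h)"
    have "(\<integral>z. moll_kernel \<delta> z * u (x + h + z) \<partial>lborel) = (\<integral>z. moll_kernel \<delta> (h + z - h) * u (x + (h + z)) \<partial>lborel)"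
      by (simp add: add.assoc)
    also have "\<dots> = (\<integral>z. moll_kernel \<delta> (z - h) * u (x + z) \<partial>lborel)"
      by (rule integral_lborel_translate) (intro borel_measurable_continuous_onI continuous_intros ucx)
    finally have fin: "(\<integral>z. moll_kernel \<delta> z * u (x + h + z) \<partial>lborel) = (\<integral>z. moll_kernel \<delta> (z - h) * u (x + z) \<partial>lborel)" .
    have W: "(\<integral>z. u (x + z) *\<^sub>R moll_kernel_grad \<delta> z \<partial>lborel) \<bullet> h = (\<integral>z. (u (x + z) *\<^sub>R moll_kernel_grad \<delta> z) \<bullet> h \<partial>lborel)"
      by (rule integral_inner_left[symmetric, OF continuous_scaleR_moll_kernel_grad(2)[OF \<delta> ucx]])
    have gen: "p / ?c - q / ?c - inverse ?c * r = (p - q - r) / ?c" for p q r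
      by (simp add: divide_inverse algebra_simps)
    have "mollify \<delta> u (x + h) - mollify \<delta> u x - mollify_grad \<delta> u x \<bullet> h =
        ((\<integral>z. moll_kernel \<delta> (z - h) * u (x + z) \<partial>lborel) - (\<integral>z. moll_kernel \<delta> z * u (x + z) \<partial>lborel)
        - (\<integral>z. (u (x + z) *\<^sub>R moll_kernel_grad \<delta> z) \<bullet> h \<partial>lborel)) / ?c"
      unfolding mollify_def mollify_grad_def inner_scaleR_left fin W by (rule gen)
    also have "\<dots> = (\<integral>z. moll_kernel \<delta> (z - h) * u (x + z) - moll_kernel \<delta> z * u (x + z)
        - (u (x + z) *\<^sub>R moll_kernel_grad \<delta> z) \<bullet> h \<partial>lborel) / ?c"
      by (simp only: Bochner_Integration.integral_diff[OF i1 i2]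
          Bochner_Integration.integral_diff[OF Bochner_Integration.integrable_diff[OF i1 i2] i3])
    also have "\<dots> = (\<integral>z. ?f z \<partial>lborel) / ?c"
      by (rule arg_cong[where f="\<lambda>r. r / ?c"], rule Bochner_Integration.integral_cong) (auto simp: algebra_simps)
    finally have eq: "mollify \<delta> u (x + h) - mollify \<delta> u x - mollify_grad \<delta> u x \<bullet> h = (\<integral>z. ?f z \<partial>lborel) / ?c" .
    have "norm (\<integral>z. ?f z \<partial>lborel) \<le> (B * ((2 * \<delta>\<^sup>2 + (2 * \<delta> + 3)\<^sup>2) * (norm h)\<^sup>2)) * measure lborel (cball (0::'a) (\<delta> + 1))"
    proof (rule norm_integral_le_bounded_support)
      show "continuous_on UNIV ?f" by (intro continuous_intros ucx)
      show "?f z = 0" if "\<delta> + 1 < norm z" for z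
        using k0[OF that] moll_kernel_support[OF \<delta>, of z] that by simp
      show "norm (?f z) \<le> B * ((2 * \<delta>\<^sup>2 + (2 * \<delta> + 3)\<^sup>2) * (norm h)\<^sup>2)" if "norm z \<le> \<delta> + 1" for z
        unfolding real_norm_def abs_mult
        using B[OF that] moll_kernel_taylor[OF \<delta> that h] B0 by (intro mult_mono) auto
    qed
    then have "\<bar>\<integral>z. ?f z \<partial>lborel\<bar> / ?c \<le> (B * ((2 * \<delta>\<^sup>2 + (2 * \<delta> + 3)\<^sup>2) * (norm h)\<^sup>2)) * measure lborel (cball (0::'a) (\<delta> + 1)) / ?c"
      using c by (intro divide_right_mono) auto
    then show ?thesis unfolding eq M_def using c by (simp add: abs_divide mult_ac)
  qed
  show ?thesis
    unfolding has_derivative_at_alt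
  proof (intro conjI allI impI bounded_linear_inner_right)
    fix e :: real assume "e > 0"
    show "\<exists>d>0. \<forall>y. norm (y - x) < d \<longrightarrow>
        norm (mollify \<delta> u y - mollify \<delta> u x - mollify_grad \<delta> u x \<bullet> (y - x)) \<le> e * norm (y - x)"
    proof (intro exI[of _ "min 1 (e / (M + 1))"] conjI allI impI)
      show "0 < min 1 (e / (M + 1))" using \<open>e > 0\<close> M by simp
      fix y assume y: "norm (y - x) < min 1 (e / (M + 1))"
      then have "norm (y - x) * (M + 1) < e" using M by (simp add: pos_less_divide_eq)
      then have "M * norm (y - x) \<le> e" by (simp add: algebra_simps) (smt (verit) norm_ge_zero)
      then have "M * norm (y - x) * norm (y - x) \<le> e * norm (y - x)" by (rule mult_right_mono) simp
      with main[of "y - x"] y show "norm (mollify \<delta> u y - mollify \<delta> u x - mollify_grad \<delta> u x \<bullet> (y - x)) \<le> e * norm (y - x)"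
        by (simp add: power2_eq_square mult.assoc)
    qed
  qed
qed

text \<open>An Egorov argument: the radius on which differentiability is effective becomes uniform
  off a set of small measure.\<close>

lemma approximately_affine_sets:
  fixes u :: "'a::euclidean_space \<Rightarrow> real"
  assumes u: "L-lipschitz_on UNIV u" and E: "E \<in> lmeasurable" and "0 < \<epsilon>" "0 < \<eta>"
  obtains F r where "F \<subseteq> E" "F \<in> lmeasurable" "measure lebesgue (E - F) < \<eta>" "0 < r"
    "\<And>x. x \<in> F \<Longrightarrow> \<exists>c. \<forall>h. norm h \<le> r \<longrightarrow> \<bar>u (x + h) - u x - c \<bullet> h\<bar> \<le> \<epsilon> * norm h"
proof -
  define D where "D = {v::'a. \<forall>b\<in>Basis. v \<bullet> b \<in> \<rat>}"
  have D: "countable D" "closure D = UNIV"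
    unfolding D_def by (rule countable_rational_vectors closure_rational_vectors)+
  have uc: "continuous_on UNIV u" using u by (rule lipschitz_on_continuous_on)
  \<comment> \<open>For a fixed slope the condition is closed in \<open>x\<close>; with rational
    slopes \<open>T j\<close> is a countable union of closed sets. The room between
    \<open>\<epsilon> / 2\<close> and \<epsilon> pays for rounding the gradient.\<close>
  define T where "T j = (\<Union>c\<in>D. {x. \<forall>h. norm h \<le> 1 / real (Suc j) \<longrightarrow> \<bar>u (x + h) - u x - c \<bullet> h\<bar> \<le> \<epsilon> * norm h})" for j
  have closed: "closed {x. \<forall>h. norm h \<le> 1 / real (Suc j) \<longrightarrow> \<bar>u (x + h) - u x - c \<bullet> h\<bar> \<le> \<epsilon> * norm h}" for j c
    by (intro closed_Collect_all closed_Collect_imp open_Collect_const closed_Collect_le continuous_intros continuous_on_compose2[OF uc]) auto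
  have T: "T j \<in> sets borel" for j
    unfolding T_def using D(1) closed by (intro sets.countable_UN') auto
  have Tinc: "T j \<subseteq> T (Suc j)" for j
  proof -
    have le: "norm h \<le> 1 / real (Suc j)" if "norm h \<le> 1 / real (Suc (Suc j))" for h :: 'a
      using that by (rule order_trans) (simp add: frac_le)
    show ?thesis
      unfolding T_def
    proof (rule UN_mono[OF order_refl], rule Collect_mono, intro impI allI)
      fix c x and h :: 'a
      assume a: "\<forall>h. norm h \<le> 1 / real (Suc j) \<longrightarrow> \<bar>u (x + h) - u x - c \<bullet> h\<bar> \<le> \<epsilon> * norm h"
        and "norm h \<le> 1 / real (Suc (Suc j))"
      then show "\<bar>u (x + h) - u x - c \<bullet> h\<bar> \<le> \<epsilon> * norm h" using le by simp
    qed
  qed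
  \<comment> \<open>The constant sequence turns the theorem into Rademacher's theorem for
    \<open>u\<close>.\<close>
  obtain N and g :: "nat \<Rightarrow> 'a \<Rightarrow> 'a"
    where N: "negligible N" and der: "\<And>k x. x \<notin> N \<Longrightarrow> (u has_derivative (\<lambda>h. g k x \<bullet> h)) (at x)"
    by (rule metric_rademacher[where u = "\<lambda>_. u", OF u]) (rule that)
  have cov: "- N \<subseteq> (\<Union>j. T j)"
  proof
    fix x assume "x \<in> - N"
    then have "(u has_derivative (\<lambda>h. g (0::nat) x \<bullet> h)) (at x)" using der by simp
    then obtain d where d: "d > 0" "\<And>y. norm (y - x) < d \<Longrightarrow> norm (u y - u x - g 0 x \<bullet> (y - x)) \<le> \<epsilon> / 2 * norm (y - x)"
      unfolding has_derivative_at_alt using \<open>0 < \<epsilon>\<close> half_gt_zero by blast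
    obtain j where j: "1 / real (Suc j) < d" using d(1) by (rule nat_approx_posE)
    have "g 0 x \<in> closure D" using D(2) by simp
    then obtain c where c: "c \<in> D" "dist c (g 0 x) < \<epsilon> / 2" using closure_approachable \<open>0 < \<epsilon>\<close> half_gt_zero by metis
    have "\<bar>u (x + h) - u x - c \<bullet> h\<bar> \<le> \<epsilon> * norm h" if h: "norm h \<le> 1 / real (Suc j)" for h
    proof -
      have "\<bar>u (x + h) - u x - g 0 x \<bullet> h\<bar> \<le> \<epsilon> / 2 * norm h"
        using d(2)[of "x + h"] h j by simp
      moreover have "\<bar>(c - g 0 x) \<bullet> h\<bar> \<le> norm (c - g 0 x) * norm h" by (rule Cauchy_Schwarz_ineq2)
      moreover have "norm (c - g 0 x) * norm h \<le> \<epsilon> / 2 * norm h"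
        using c(2) by (intro mult_right_mono) (auto simp: dist_norm)
      moreover have "(c - g 0 x) \<bullet> h = c \<bullet> h - g 0 x \<bullet> h" by (rule inner_diff_left)
      ultimately show ?thesis by linarith
    qed
    then have "x \<in> T j" unfolding T_def using c(1) by blast
    then show "x \<in> (\<Union>j. T j)" by blast
  qed
  have dec: "decseq (\<lambda>j. E - T j)" using Tinc by (intro decseq_SucI) blast
  have Em: "E - T j \<in> lmeasurable" for j using E T by (intro fmeasurable_Diff) auto
  have "(\<lambda>j. measure lebesgue (E - T j)) \<longlonglongrightarrow> measure lebesgue (\<Inter>j. E - T j)"
    using dec Em fmeasurableD2[OF Em] by (intro Lim_measure_decseq) auto
  moreover have "negligible (\<Inter>j. E - T j)"
    by (rule negligible_subset[OF N]) (use cov in blast)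
  ultimately have "(\<lambda>j. measure lebesgue (E - T j)) \<longlonglongrightarrow> 0"
    by (simp add: negligible_imp_measure0)
  then have "\<forall>\<^sub>F j in sequentially. measure lebesgue (E - T j) < \<eta>"
    using \<open>0 < \<eta>\<close> by (rule order_tendstoD)
  then obtain j where j: "measure lebesgue (E - T j) < \<eta>"
    unfolding eventually_sequentially by blast
  show ?thesis
  proof (rule that[of "E \<inter> T j" "1 / real (Suc j)"])
    show "E \<inter> T j \<in> lmeasurable" using E T by (intro fmeasurable_Int_fmeasurable) auto
    show "measure lebesgue (E - E \<inter> T j) < \<eta>" using j by (simp add: Diff_Int)
    show "\<exists>c. \<forall>h. norm h \<le> 1 / real (Suc j) \<longrightarrow> \<bar>u (x + h) - u x - c \<bullet> h\<bar> \<le> \<epsilon> * norm h" if "x \<in> E \<inter> T j" for x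
      using that unfolding T_def by blast
  qed auto
qed

section \<open>Approximation by continuously differentiable functions off a set of small
  measure\<close>

lemma onorm_inner_le: "onorm (\<lambda>h. g \<bullet> h) \<le> norm (g::'a::euclidean_space)"
  by (rule onorm_le) (metis Cauchy_Schwarz_ineq2 real_norm_def)

text \<open>With \<open>g\<close> a mollification of \<open>u\<close>, pairs of points at distance
  at least \<open>K * \<delta>\<close> are handled by the uniform closeness of \<open>g\<close> and
  \<open>u\<close>. For closer pairs \<open>u\<close> is affine up to a small error near
  \<open>x\<close>, mollification preserves the affine part, and the gradient of the mollified error
  is small.\<close>

lemma lusin_approximation_step:
  fixes u :: "'a::euclidean_space \<Rightarrow> real"
  assumes u: "L-lipschitz_on UNIV u" and E: "E \<in> lmeasurable" and "0 < \<epsilon>" "0 < \<eta>" "0 < \<tau>"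
  obtains g G F where "\<And>x. (g has_derivative (\<lambda>h. G x \<bullet> h)) (at x)" "continuous_on UNIV G"
    "\<And>x. norm (G x) \<le> L" "\<And>x. \<bar>g x - u x\<bar> \<le> \<tau>"
    "F \<subseteq> E" "F \<in> lmeasurable" "measure lebesgue (E - F) < \<eta>" "\<epsilon>-lipschitz_on F (\<lambda>x. u x - g x)"
proof -
  have L: "L \<ge> 0" using u by (rule lipschitz_on_nonneg)
  have uc: "continuous_on UNIV u" using u by (rule lipschitz_on_continuous_on)
  define C where "C = (2::real) ^ (DIM('a) + 3)"
  have C: "C > 0" by (simp add: C_def)
  \<comment> \<open>Two values of \<open>g - u\<close> differ by at most
    \<open>2 * (L * \<delta>)\<close>, which is below \<epsilon> times the distance as soon as the
    distance is at least \<open>K * \<delta>\<close>.\<close>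
  define K where "K = 2 * L / \<epsilon> + 1"
  have K: "K \<ge> 1" "2 * L \<le> \<epsilon> * K" using L \<open>0 < \<epsilon>\<close> by (auto simp: K_def field_simps)
  \<comment> \<open>For close pairs the mollified remainder contributes
    \<open>C * (\<epsilon>' * (K + 1))\<close> and the remainder itself \<epsilon>' to the Lipschitz
    constant; together they make exactly \<epsilon>.\<close>
  define \<epsilon>' where "\<epsilon>' = \<epsilon> / (C * (K + 1) + 1)"
  have CK: "C * (K + 1) + 1 > 0" using C K by (simp add: add_pos_pos)
  have \<epsilon>': "\<epsilon>' > 0" "\<epsilon>' * (C * (K + 1) + 1) = \<epsilon>" using \<open>0 < \<epsilon>\<close> CK by (auto simp: \<epsilon>'_def)
  obtain F r where F: "F \<subseteq> E" "F \<in> lmeasurable" "measure lebesgue (E - F) < \<eta>" and r: "0 < r"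
    and aff: "\<And>x. x \<in> F \<Longrightarrow> \<exists>c. \<forall>h. norm h \<le> r \<longrightarrow> \<bar>u (x + h) - u x - c \<bullet> h\<bar> \<le> \<epsilon>' * norm h"
    using approximately_affine_sets[OF u E \<epsilon>'(1) \<open>0 < \<eta>\<close>] by metis
  \<comment> \<open>The first bound gives closeness \<tau>. The second keeps the
    \<delta>-neighbourhood of a segment shorter than \<open>K * \<delta>\<close> within the radius
    \<open>r\<close> of affine approximation.\<close>
  define \<delta> where "\<delta> = min (\<tau> / (L + 1)) (r / (K + 1))"
  have \<delta>: "\<delta> > 0" using r K L \<open>0 < \<tau>\<close> by (simp add: \<delta>_def)
  have L\<delta>: "L * \<delta> \<le> \<tau>"
  proof -
    have "L * \<delta> \<le> (L + 1) * (\<tau> / (L + 1))" using L \<delta> by (intro mult_mono) (auto simp: \<delta>_def)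
    then show ?thesis using L by simp
  qed
  have K\<delta>: "(K + 1) * \<delta> \<le> r"
  proof -
    have "(K + 1) * \<delta> \<le> (K + 1) * (r / (K + 1))" using K by (intro mult_left_mono) (auto simp: \<delta>_def)
    then show ?thesis using K by simp
  qed
  define g where "g = mollify \<delta> u"
  have near: "\<bar>g y - g x - (u y - u x)\<bar> \<le> \<epsilon> * norm (y - x)" if x: "x \<in> F" and xy: "norm (y - x) < K * \<delta>" for x y
  proof -
    obtain c where c: "\<And>h. norm h \<le> r \<Longrightarrow> \<bar>u (x + h) - u x - c \<bullet> h\<bar> \<le> \<epsilon>' * norm h" using aff[OF x] by blast
    define w where "w z = u z - u x - c \<bullet> (z - x)" for z
    have w: "(L + norm c)-lipschitz_on UNIV w"
    proof (rule lipschitz_onI)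
      fix p q
      have "\<bar>u p - u q\<bar> \<le> L * dist p q" using lipschitz_onD[OF u, of p q] by (simp add: dist_real_def)
      moreover have "\<bar>c \<bullet> (p - q)\<bar> \<le> norm c * dist p q" unfolding dist_norm by (rule Cauchy_Schwarz_ineq2)
      moreover have "w p - w q = (u p - u q) - c \<bullet> (p - q)" by (simp add: w_def inner_diff_right)
      ultimately show "dist (w p) (w q) \<le> (L + norm c) * dist p q"
        unfolding dist_real_def distrib_right by linarith
    qed (use L in simp)
    have wc: "continuous_on UNIV w" using w by (rule lipschitz_on_continuous_on)
    have wb: "\<bar>w (\<xi> + z)\<bar> \<le> \<epsilon>' * ((K + 1) * \<delta>)" if \<xi>: "\<xi> \<in> closed_segment x y" and z: "norm z \<le> \<delta>" for \<xi> z
    proof -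
      have "norm (\<xi> - x) \<le> norm (y - x)" using \<xi> by (rule segment_bound1)
      then have "norm (\<xi> + z - x) \<le> (K + 1) * \<delta>"
        using norm_triangle_ineq[of "\<xi> - x" z] z xy by (simp add: algebra_simps)
      moreover from this have "norm (\<xi> + z - x) \<le> r" using K\<delta> by linarith
      then have "\<bar>w (\<xi> + z)\<bar> \<le> \<epsilon>' * norm (\<xi> + z - x)"
        using c[of "\<xi> + z - x"] by (simp add: w_def)
      ultimately show ?thesis using \<epsilon>'(1) by (smt (verit) mult_left_mono)
    qed
    have "norm (mollify \<delta> w y - mollify \<delta> w x) \<le> C * (\<epsilon>' * (K + 1)) * norm (y - x)"
    proof (rule differentiable_bound[OF convex_closed_segment[of x y]])
      fix \<xi> assume \<xi>: "\<xi> \<in> closed_segment x y"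
      show "(mollify \<delta> w has_derivative (\<lambda>h. mollify_grad \<delta> w \<xi> \<bullet> h)) (at \<xi> within closed_segment x y)"
        using has_derivative_mollify[OF \<delta> w] by (rule has_derivative_at_withinI)
      have "norm (mollify_grad \<delta> w \<xi>) \<le> C / \<delta> * (\<epsilon>' * ((K + 1) * \<delta>))"
        unfolding C_def by (rule norm_mollify_grad_le[OF \<delta> wc wb[OF \<xi>]])
      also have "\<dots> = C * (\<epsilon>' * (K + 1))" using \<delta> by simp
      finally show "onorm (\<lambda>h. mollify_grad \<delta> w \<xi> \<bullet> h) \<le> C * (\<epsilon>' * (K + 1))"
        using onorm_inner_le order_trans by blast
    qed auto
    \<comment> \<open>The affine part contributes a constant to the integrand, which the
      normalization by the mass reproduces.\<close>
    moreover have "mollify \<delta> w y - mollify \<delta> w x = g y - g x - c \<bullet> (y - x)"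
    proof -
      have "mollify \<delta> w y - mollify \<delta> w x
        = (\<integral>z. moll_kernel \<delta> z * (u (y + z) - (u (x + z) + c \<bullet> (y - x))) \<partial>lborel) / moll_mass TYPE('a) \<delta>"
        unfolding mollify_diff[OF \<delta> wc] by (simp add: w_def inner_diff_right algebra_simps)
      also have "\<dots> = (\<integral>z. moll_kernel \<delta> z * (u (y + z) - u (x + z)) \<partial>lborel) / moll_mass TYPE('a) \<delta> - c \<bullet> (y - x)"
      proof -
        have i1: "integrable lborel (\<lambda>z. moll_kernel \<delta> z * (u (y + z) - u (x + z)))"
          by (rule integrable_moll_kernel[OF \<delta>]) (intro continuous_intros continuous_on_compose2[OF uc], auto)
        have i2: "integrable lborel (\<lambda>z::'a. moll_kernel \<delta> z * (c \<bullet> (y - x)))"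
          by (rule integrable_moll_kernel[OF \<delta>]) simp
        have "(\<integral>z. moll_kernel \<delta> z * (u (y + z) - (u (x + z) + c \<bullet> (y - x))) \<partial>lborel)
          = (\<integral>z. moll_kernel \<delta> z * (u (y + z) - u (x + z)) - moll_kernel \<delta> z * (c \<bullet> (y - x)) \<partial>lborel)"
          by (rule Bochner_Integration.integral_cong) (auto simp: algebra_simps)
        also have "\<dots> = (\<integral>z. moll_kernel \<delta> z * (u (y + z) - u (x + z)) \<partial>lborel) - moll_mass TYPE('a) \<delta> * (c \<bullet> (y - x))"
          using integrable_moll_kernel[OF \<delta>, of "\<lambda>_::'a. 1"]
          by (subst Bochner_Integration.integral_diff[OF i1 i2]) (simp add: moll_mass_def)
        finally show ?thesis
          using moll_mass_ge(2)[OF \<delta>, where 'a='a] by (simp add: diff_divide_distrib)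
      qed
      finally show ?thesis unfolding g_def mollify_diff[OF \<delta> uc] .
    qed
    ultimately have 1: "\<bar>g y - g x - c \<bullet> (y - x)\<bar> \<le> C * (\<epsilon>' * (K + 1)) * norm (y - x)" by simp
    have "K * \<delta> \<le> r" using K\<delta> \<delta> by (simp add: algebra_simps)
    then have 2: "\<bar>u y - u x - c \<bullet> (y - x)\<bar> \<le> \<epsilon>' * norm (y - x)"
      using c[of "y - x"] xy by simp
    have "\<epsilon> * norm (y - x) = (\<epsilon>' * (C * (K + 1) + 1)) * norm (y - x)"
      by (simp only: \<epsilon>'(2))
    also have "\<dots> = C * (\<epsilon>' * (K + 1)) * norm (y - x) + \<epsilon>' * norm (y - x)"
      by (simp add: algebra_simps)
    finally show ?thesis using 1 2 by linarith
  qed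
  have far: "\<bar>g y - g x - (u y - u x)\<bar> \<le> \<epsilon> * norm (y - x)" if xy: "K * \<delta> \<le> norm (y - x)" for x y
  proof -
    have "\<bar>g y - g x - (u y - u x)\<bar> \<le> 2 * (L * \<delta>)"
      using abs_mollify_diff_le[OF \<delta> u, of x] abs_mollify_diff_le[OF \<delta> u, of y] unfolding g_def by linarith
    also have "\<dots> \<le> \<epsilon> * (K * \<delta>)" using mult_right_mono[OF K(2), of \<delta>] \<delta> by simp
    also have "\<dots> \<le> \<epsilon> * norm (y - x)" using xy \<open>0 < \<epsilon>\<close> by (intro mult_left_mono) auto
    finally show ?thesis .
  qed
  show ?thesis
  proof (rule that[of g "mollify_grad \<delta> u" F])
    show "(g has_derivative (\<lambda>h. mollify_grad \<delta> u x \<bullet> h)) (at x)" for x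
      unfolding g_def by (rule has_derivative_mollify[OF \<delta> u])
    show "norm (mollify_grad \<delta> u x) \<le> L" for x
      by (rule lipschitz_norm_gradient_le[OF lipschitz_on_mollify[OF \<delta> u] has_derivative_mollify[OF \<delta> u]])
    show "\<bar>g x - u x\<bar> \<le> \<tau>" for x
      using abs_mollify_diff_le[OF \<delta> u, of x] L\<delta> unfolding g_def by linarith
    show "\<epsilon>-lipschitz_on F (\<lambda>x. u x - g x)"
    proof (rule lipschitz_onI)
      fix x y assume "x \<in> F" "y \<in> F"
      have "\<bar>g y - g x - (u y - u x)\<bar> \<le> \<epsilon> * norm (y - x)"
      proof (cases "norm (y - x) < K * \<delta>")
        case True
        with \<open>x \<in> F\<close> show ?thesis by (rule near)
      next
        case False
        then show ?thesis by (intro far) (simp only: not_less)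
      qed
      then show "dist (u x - g x) (u y - g y) \<le> \<epsilon> * dist x y"
        by (simp add: dist_real_def dist_norm norm_minus_commute abs_le_iff)
    qed (use \<open>0 < \<epsilon>\<close> in simp)
  qed (use F continuous_mollify_grad[OF \<delta> u] in auto)
qed

text \<open>The remainder of each approximation step is restricted to the set where its Lipschitz constant has
  halved and then extended again, so that the gradients of the successive mollifications are summable.\<close>

theorem lipschitz_lusin_C1:
  fixes u :: "'a::euclidean_space \<Rightarrow> real"
  assumes u: "L-lipschitz_on UNIV u" and "0 < L" and E: "E \<in> lmeasurable" and "0 < \<eta>"
  obtains g G F where "\<And>x. (g has_derivative (\<lambda>h. G x \<bullet> h)) (at x)" "continuous_on UNIV G"
    "\<And>x. norm (G x) \<le> 2 * L" "F \<subseteq> E" "F \<in> lmeasurable" "measure lebesgue (E - F) \<le> \<eta>" "\<And>x. x \<in> F \<Longrightarrow> g x = u x"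
proof -
  \<comment> \<open>The state is the current remainder and the set on which it is still exact. The
    clause for \<open>n = 0\<close> pins the start to \<open>u\<close> and \<open>E\<close>, since
    dependent choice yields only some initial state satisfying \<open>?P 0\<close>.\<close>
  let ?P = "\<lambda>n (w, F). (L / 2 ^ n)-lipschitz_on UNIV w \<and> F \<in> lmeasurable \<and> (n = 0 \<longrightarrow> w = u \<and> F = E)"
  let ?R = "\<lambda>n w F w' F' g G. (\<forall>x. (g has_derivative (\<lambda>h. G x \<bullet> h)) (at x)) \<and> continuous_on UNIV G \<and>
        (\<forall>x. norm (G x) \<le> L / 2 ^ n) \<and> (\<forall>x. \<bar>g x - w x\<bar> \<le> 1 / 2 ^ n) \<and> F' \<subseteq> F \<and>
        measure lebesgue (F - F') < \<eta> / 2 ^ Suc n \<and> (\<forall>x\<in>F'. w' x = w x - g x)"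
  let ?Q = "\<lambda>n (w, F) (w', F'). \<exists>g G. ?R n w F w' F' g G"
  have "\<exists>f. \<forall>n. ?P n (f n) \<and> ?Q n (f n) (f (Suc n))"
  proof (rule dependent_nat_choice)
    show "\<exists>x. ?P 0 x" using u E by (intro exI[of _ "(u, E)"]) simp
    fix s n assume P: "?P n s"
    obtain w F where s: "s = (w, F)" by (cases s)
    have w: "(L / 2 ^ n)-lipschitz_on UNIV w" and F: "F \<in> lmeasurable" using P by (auto simp: s)
    have pos: "0 < L / 2 ^ Suc n" "0 < \<eta> / 2 ^ Suc n" "0 < (1::real) / 2 ^ n"
      using \<open>0 < L\<close> \<open>0 < \<eta>\<close> by simp_all
    obtain g G F' where g: "\<And>x. (g has_derivative (\<lambda>h. G x \<bullet> h)) (at x)" "continuous_on UNIV G"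
      "\<And>x. norm (G x) \<le> L / 2 ^ n" "\<And>x. \<bar>g x - w x\<bar> \<le> 1 / 2 ^ n"
      and F': "F' \<subseteq> F" "F' \<in> lmeasurable" "measure lebesgue (F - F') < \<eta> / 2 ^ Suc n"
      and lip: "(L / 2 ^ Suc n)-lipschitz_on F' (\<lambda>x. w x - g x)"
      by (rule lusin_approximation_step[OF w F pos]) (rule that)
    obtain w' where w': "(L / 2 ^ Suc n)-lipschitz_on UNIV w'" "\<And>x. x \<in> F' \<Longrightarrow> w' x = w x - g x"
      by (rule mcshane_extension[OF lip]) (rule that)
    have "?P (Suc n) (w', F') \<and> ?Q n s (w', F')"
      unfolding s prod.case using w' F' g by blast
    then show "\<exists>y. ?P (Suc n) y \<and> ?Q n s y" by blast
  qed
  then obtain f where f': "\<forall>n. ?P n (f n) \<and> ?Q n (f n) (f (Suc n))" by (rule exE)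
  have f1: "?P n (f n)" for n using spec[OF f', of n] by (rule conjunct1)
  have f2: "?Q n (f n) (f (Suc n))" for n using spec[OF f', of n] by (rule conjunct2)
  define W where "W n = fst (f n)" for n
  define F where "F n = snd (f n)" for n
  have ff: "f n = (W n, F n)" for n by (simp add: W_def F_def)
  have F: "F n \<in> lmeasurable" and W: "(L / 2 ^ n)-lipschitz_on UNIV (W n)" for n using f1[of n] by (auto simp: ff)
  have init: "W 0 = u" "F 0 = E" using f1[of 0] by (auto simp: ff)
  have "\<forall>n. \<exists>g G. ?R n (W n) (F n) (W (Suc n)) (F (Suc n)) g G"
    using f2 unfolding ff prod.case by blast
  then obtain g G where R: "\<And>n. ?R n (W n) (F n) (W (Suc n)) (F (Suc n)) (g n) (G n)" by metis
  define Fi where "Fi = (\<Inter>n. F n)"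
  have Fis: "Fi \<in> sets lebesgue" unfolding Fi_def using F by (intro sets.countable_INT) auto
  have FiE: "Fi \<subseteq> E" unfolding Fi_def using init by blast
  have Fm: "Fi \<in> lmeasurable" using FiE Fis E by (rule fmeasurableI2[rotated 1])
  have Fsub: "F (Suc n) \<subseteq> F n" for n using R[of n] by blast
  have FE: "F n \<subseteq> E" for n
    by (induction n) (use init Fsub in blast)+
  have meas: "measure lebesgue (E - F n) \<le> \<eta> * (1 - 1 / 2 ^ n)" for n
  proof (induction n)
    case (Suc n)
    have "E - F (Suc n) = (E - F n) \<union> (F n - F (Suc n))" using FE Fsub by blast
    then have "measure lebesgue (E - F (Suc n)) \<le> measure lebesgue (E - F n) + measure lebesgue (F n - F (Suc n))"
      using E F by (simp add: measure_Un_le fmeasurableD sets.Diff)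
    also have "\<dots> \<le> \<eta> * (1 - 1 / 2 ^ n) + \<eta> / 2 ^ Suc n" using Suc R[of n] by linarith
    also have "\<dots> = \<eta> * (1 - 1 / 2 ^ Suc n)" by (simp add: field_simps)
    finally show ?case .
  qed (simp add: init)
  have measFi: "measure lebesgue (E - Fi) \<le> \<eta>"
  proof -
    have "(\<lambda>n. measure lebesgue (E - F n)) \<longlonglongrightarrow> measure lebesgue (\<Union>n. E - F n)"
    proof (rule Lim_measure_incseq)
      show "range (\<lambda>n. E - F n) \<subseteq> sets lebesgue" using E F by auto
      show "incseq (\<lambda>n. E - F n)" using Fsub by (intro incseq_SucI) blast
      have eq: "(\<Union>n. E - F n) = E - Fi" by (auto simp: Fi_def)
      have "E - Fi \<in> lmeasurable" using E Fis by (intro fmeasurable_Diff) auto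
      from fmeasurableD2[OF this] show "emeasure lebesgue (\<Union>n. E - F n) \<noteq> \<infinity>"
        unfolding eq infinity_ennreal_def .
    qed
    moreover have "(\<Union>n. E - F n) = E - Fi" by (auto simp: Fi_def)
    moreover have "measure lebesgue (E - F n) \<le> \<eta>" for n
      using meas[of n] mult_left_mono[of "1 - 1 / 2 ^ n" 1 \<eta>] \<open>0 < \<eta>\<close> by (auto intro: order_trans)
    ultimately show ?thesis by (metis LIMSEQ_le_const2)
  qed
  have gd: "(g n has_derivative (\<lambda>h. G n x \<bullet> h)) (at x)" for n x using R[of n] by blast
  have Gb: "norm (G n x) \<le> L / 2 ^ n" for n x using R[of n] by blast
  have gw: "\<bar>g n x - W n x\<bar> \<le> 1 / 2 ^ n" for n x using R[of n] by blast
  have Weq: "W (Suc n) x = W n x - g n x" if "x \<in> Fi" for n x using R[of n] that by (auto simp: Fi_def)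
  show ?thesis
  \<comment> \<open>If \<open>Fi\<close> is empty, \<open>E\<close> itself has measure at most
    \<eta> and the zero function works. Otherwise a point of \<open>Fi\<close> anchors the series:
    termwise differentiation needs convergence of the values at one point.\<close>
  proof (cases "Fi = {}")
    case True
    show ?thesis
      by (rule that[of "\<lambda>_. 0" "\<lambda>_. 0" "{}"]) (use measFi True \<open>0 < L\<close> in auto)
  next
    case False
    then obtain x0 where x0: "x0 \<in> Fi" by blast
    \<comment> \<open>The partial sums telescope to \<open>u x - W n x\<close>. The remainder tends
      to \<open>0\<close> because each mollification is within \<open>1 / 2 ^ n\<close> of the
      function it approximates.\<close>
    have sums: "(\<lambda>n. g n x) sums u x" if x: "x \<in> Fi" for x
    proof -
      have "(\<Sum>j<n. g j x) = u x - W n x" for n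
        by (induction n) (use Weq[OF x] init in auto)
      moreover have "(\<lambda>n. W n x) \<longlonglongrightarrow> 0"
      proof (rule LIMSEQ_imp_Suc, rule Lim_null_comparison)
        show "\<forall>\<^sub>F n in sequentially. norm (W (Suc n) x) \<le> (1 / 2) ^ n"
          using gw[of _ x] Weq[OF x] by (intro always_eventually) (simp add: power_one_over abs_minus_commute)
      qed (rule LIMSEQ_power_zero, simp)
      then have "(\<lambda>n. u x - W n x) \<longlonglongrightarrow> u x - 0" by (intro tendsto_diff tendsto_const)
      ultimately show ?thesis by (simp add: sums_def)
    qed
    define GG where "GG x = (\<Sum>n. G n x)" for x
    have summ: "summable (\<lambda>n. L / 2 ^ n)"
      using summable_mult[OF summable_geometric[of "1/2::real"], of L] by (simp add: power_one_over)
    have unif: "uniform_limit UNIV (\<lambda>n x. \<Sum>i<n. G i x) GG sequentially"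
      unfolding GG_def by (rule Weierstrass_m_test[OF Gb summ])
    have "\<exists>gg. \<forall>x\<in>UNIV. (\<lambda>n. g n x) sums (gg x) \<and> (gg has_derivative (\<lambda>h. GG x \<bullet> h)) (at x within UNIV)"
    proof (rule has_derivative_series[OF convex_UNIV, where f' = "\<lambda>n x h. G n x \<bullet> h" and x = x0 and l = "u x0"])
      fix e :: real assume "e > 0"
      have "\<forall>\<^sub>F n in sequentially. \<forall>x\<in>UNIV. dist (\<Sum>i<n. G i x) (GG x) < e"
        using unif \<open>e > 0\<close> unfolding uniform_limit_iff by blast
      then show "\<forall>\<^sub>F n in sequentially. \<forall>x\<in>UNIV. \<forall>h. norm ((\<Sum>i<n. G i x \<bullet> h) - GG x \<bullet> h) \<le> e * norm h"
      proof (rule eventually_mono, intro ballI allI)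
        fix n x h assume a: "\<forall>x\<in>UNIV. dist (\<Sum>i<n. G i x) (GG x) < e"
        have "norm ((\<Sum>i<n. G i x \<bullet> h) - GG x \<bullet> h) = \<bar>((\<Sum>i<n. G i x) - GG x) \<bullet> h\<bar>"
          by (simp add: inner_diff_left inner_sum_left)
        also have "\<dots> \<le> norm ((\<Sum>i<n. G i x) - GG x) * norm h" by (rule Cauchy_Schwarz_ineq2)
        also have "\<dots> \<le> e * norm h" using a by (intro mult_right_mono) (auto simp: dist_norm less_imp_le)
        finally show "norm ((\<Sum>i<n. G i x \<bullet> h) - GG x \<bullet> h) \<le> e * norm h" .
      qed
    qed (use gd sums[OF x0] in auto)
    then obtain gg where gg: "\<And>x. (\<lambda>n. g n x) sums (gg x)" "\<And>x. (gg has_derivative (\<lambda>h. GG x \<bullet> h)) (at x)" by auto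
    show ?thesis
    proof (rule that[of gg GG Fi])
      show "continuous_on UNIV GG"
      proof (rule uniform_limit_theorem[OF _ unif])
        show "\<forall>\<^sub>F n in sequentially. continuous_on UNIV (\<lambda>x. \<Sum>i<n. G i x)"
          using R by (intro always_eventually allI continuous_on_sum) blast
      qed simp
      show "norm (GG x) \<le> 2 * L" for x
      proof -
        have sn: "summable (\<lambda>n. norm (G n x))"
          by (rule summable_comparison_test'[OF summ]) (use Gb in simp)
        have "norm (GG x) \<le> (\<Sum>n. norm (G n x))" unfolding GG_def by (rule summable_norm[OF sn])
        also have "\<dots> \<le> (\<Sum>n. L / 2 ^ n)" by (rule suminf_le[OF Gb sn summ])
        also have "\<dots> = 2 * L"
          using suminf_mult[OF summable_geometric[of "1/2::real"], of L] suminf_geometric[of "1/2::real"]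
          by (simp add: power_one_over)
        finally show ?thesis .
      qed
      show "gg x = u x" if "x \<in> Fi" for x using gg(1)[of x] sums[OF that] sums_unique2 by blast
    qed (use gg(2) FiE Fm measFi in auto)
  qed
qed

section \<open>Perturbations of linear isomorphisms\<close>

text \<open>Everything rests on \<open>G\<close> expanding distances by at least
  \<open>c - \<epsilon>\<close>: this gives injectivity, the Lipschitz bound of the inverse and,
  applied to the derivative, its invertibility.\<close>

lemma C1_map_perturbation_diffeomorphism:
  fixes \<Lambda> \<eta> :: "'a::euclidean_space \<Rightarrow> 'a"
  assumes \<Lambda>: "linear \<Lambda>" and low: "\<And>x. c * norm x \<le> norm (\<Lambda> x)"
    and \<eta>: "C1_map \<eta>" "\<epsilon>-lipschitz_on UNIV \<eta>" and "\<epsilon> < c"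
  shows "C1_diffeomorphism (\<lambda>x. \<Lambda> x + \<eta> x)" "(1 / (c - \<epsilon>))-lipschitz_on UNIV (inv (\<lambda>x. \<Lambda> x + \<eta> x))"
proof -
  define G where "G x = \<Lambda> x + \<eta> x" for x
  have \<epsilon>: "0 \<le> \<epsilon>" using \<eta>(2) by (rule lipschitz_on_nonneg)
  then have c: "c > 0" "c - \<epsilon> > 0" using \<open>\<epsilon> < c\<close> by auto
  have bl\<Lambda>: "bounded_linear \<Lambda>" using \<Lambda> by (rule linear_conv_bounded_linear[THEN iffD1])
  have Gc: "(c - \<epsilon>) * norm (x - y) \<le> norm (G x - G y)" for x y
  proof -
    have "G x - G y = \<Lambda> (x - y) + (\<eta> x - \<eta> y)" by (simp add: G_def linear_diff[OF \<Lambda>])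
    then have "norm (\<Lambda> (x - y)) \<le> norm (G x - G y) + norm (\<eta> x - \<eta> y)"
      by (metis add_diff_cancel_right' norm_triangle_ineq4)
    moreover have "norm (\<eta> x - \<eta> y) \<le> \<epsilon> * norm (x - y)"
      using lipschitz_onD[OF \<eta>(2), of x y] by (simp add: dist_norm)
    ultimately show ?thesis using low[of "x - y"] by (simp add: left_diff_distrib)
  qed
  have inj\<Lambda>: "inj \<Lambda>"
  proof (rule linear_injective_0[OF \<Lambda>, THEN iffD2], intro allI impI)
    fix x assume "\<Lambda> x = 0"
    then have "c * norm x \<le> 0" using low[of x] by simp
    then show "x = 0" using c(1) by (simp add: mult_le_0_iff)
  qed
  then have surj\<Lambda>: "surj \<Lambda>" using \<Lambda> linear_injective_imp_surjective by blast
  have injG: "inj G"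
  proof (rule injI)
    fix x y assume "G x = G y"
    then have "(c - \<epsilon>) * norm (x - y) \<le> 0" using Gc[of x y] by simp
    then show "x = y" using c(2) by (simp add: mult_le_0_iff)
  qed
  have surjG: "surj G"
  proof (rule surjI[of _ "\<lambda>y. SOME x. G x = y"], rule someI_ex)
    fix y
    \<comment> \<open>Its fixed points are the preimages of \<open>y\<close> under \<open>G\<close>,
      and it contracts by the factor \<open>\<epsilon> / c\<close>.\<close>
    define T where "T x = inv \<Lambda> (y - \<eta> x)" for x
    have L: "\<Lambda> (T x) = y - \<eta> x" for x unfolding T_def using surj\<Lambda> by (rule surj_f_inv_f)
    have "\<exists>!x. T x = x"
    proof (rule banach_fix_type[of "\<epsilon> / c"])
      show "\<forall>x z. dist (T x) (T z) \<le> \<epsilon> / c * dist x z"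
      proof (intro allI)
        fix x z
        have "c * norm (T x - T z) \<le> norm (\<Lambda> (T x - T z))" by (rule low)
        also have "\<Lambda> (T x - T z) = - (\<eta> x - \<eta> z)" by (simp add: linear_diff[OF \<Lambda>] L)
        also have "norm (- (\<eta> x - \<eta> z)) \<le> \<epsilon> * dist x z"
          using lipschitz_onD[OF \<eta>(2), of x z] by (simp only: norm_minus_cancel dist_norm UNIV_I)
        finally show "dist (T x) (T z) \<le> \<epsilon> / c * dist x z"
          using c(1) by (simp add: dist_norm field_simps)
      qed
    qed (use \<epsilon> c \<open>\<epsilon> < c\<close> in auto)
    then obtain x where "T x = x" by blast
    then have "G x = y" using L[of x] by (simp add: G_def)
    then show "\<exists>x. G x = y" by blast
  qed
  have invG: "G (inv G y) = y" "inv G (G x) = x" for x y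
    using surjG injG by (auto simp: surj_f_inv_f inv_f_f)
  have lipinv: "(1 / (c - \<epsilon>))-lipschitz_on UNIV (inv G)"
  proof (rule lipschitz_onI)
    fix x y
    show "dist (inv G x) (inv G y) \<le> 1 / (c - \<epsilon>) * dist x y"
      using Gc[of "inv G x" "inv G y"] c(2) by (simp add: invG dist_norm field_simps)
  qed (use c in simp)
  obtain \<eta>' where \<eta>': "\<And>x. (\<eta> has_derivative blinfun_apply (\<eta>' x)) (at x)" "continuous_on UNIV \<eta>'"
    using \<eta>(1) unfolding C1_map_def by blast
  define G' where "G' x = Blinfun \<Lambda> + \<eta>' x" for x
  have G'app: "blinfun_apply (G' x) h = \<Lambda> h + \<eta>' x h" for x h
    by (simp add: G'_def plus_blinfun.rep_eq bounded_linear_Blinfun_apply[OF bl\<Lambda>])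
  have Gder: "(G has_derivative blinfun_apply (G' x)) (at x)" for x
  proof -
    have "(G has_derivative (\<lambda>h. \<Lambda> h + \<eta>' x h)) (at x)"
      unfolding G_def by (intro derivative_intros bounded_linear_imp_has_derivative bl\<Lambda> \<eta>')
    also have "(\<lambda>h. \<Lambda> h + \<eta>' x h) = blinfun_apply (G' x)" by (simp add: fun_eq_iff G'app)
    finally show ?thesis .
  qed
  have G'cont: "continuous_on UNIV G'"
    unfolding G'_def by (intro continuous_intros \<eta>')
  have \<eta>'b: "norm (\<eta>' x h) \<le> \<epsilon> * norm h" for x h
  proof (rule field_le_epsilon)
    fix e :: real assume "e > 0"
    define e' where "e' = e / (norm h + 1)"
    have e': "e' > 0" "e' * norm h \<le> e" using \<open>e > 0\<close>
      by (auto simp: e'_def field_simps add_pos_nonneg intro!: divide_pos_pos)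
    obtain d where d: "d > 0" "\<And>y. norm (y - x) < d \<Longrightarrow> norm (\<eta> y - \<eta> x - \<eta>' x (y - x)) \<le> e' * norm (y - x)"
      using \<eta>'(1)[of x] e'(1) unfolding has_derivative_at_alt by blast
    define t where "t = d / (2 * (norm h + 1))"
    have hp: "norm h + 1 > 0" by (simp add: add_nonneg_pos)
    have t: "t > 0" "norm (t *\<^sub>R h) < d"
    proof -
      show "t > 0" using d(1) hp by (simp add: t_def)
      have "t * norm h \<le> t * (norm h + 1)" using \<open>t > 0\<close> by (intro mult_left_mono) auto
      also have "\<dots> = d / 2" unfolding t_def using hp by (simp only: times_divide_eq_left) (simp add: field_simps)
      finally show "norm (t *\<^sub>R h) < d" using \<open>t > 0\<close> d(1) by simp
    qed
    have "norm (\<eta> (x + t *\<^sub>R h) - \<eta> x - \<eta>' x (t *\<^sub>R h)) \<le> e' * norm (t *\<^sub>R h)"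
      using d(2)[of "x + t *\<^sub>R h"] t(2) by simp
    moreover have "norm (\<eta> (x + t *\<^sub>R h) - \<eta> x) \<le> \<epsilon> * norm (t *\<^sub>R h)"
      using lipschitz_onD[OF \<eta>(2), of "x + t *\<^sub>R h" x] by (simp add: dist_norm)
    moreover have "norm (\<eta>' x (t *\<^sub>R h)) \<le> norm (\<eta> (x + t *\<^sub>R h) - \<eta> x) + norm (\<eta> (x + t *\<^sub>R h) - \<eta> x - \<eta>' x (t *\<^sub>R h))"
      by (metis norm_triangle_sub norm_minus_commute add.commute)
    ultimately have "norm (\<eta>' x (t *\<^sub>R h)) \<le> \<epsilon> * norm (t *\<^sub>R h) + e' * norm (t *\<^sub>R h)" by linarith
    then have "t * norm (\<eta>' x h) \<le> t * (\<epsilon> * norm h + e' * norm h)"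
      using t(1) by (simp add: blinfun.scaleR_right algebra_simps)
    then have "norm (\<eta>' x h) \<le> \<epsilon> * norm h + e' * norm h" using t(1) by simp
    with e'(2) show "norm (\<eta>' x h) \<le> \<epsilon> * norm h + e" by linarith
  qed
  have G'low: "(c - \<epsilon>) * norm h \<le> norm (G' x h)" for x h
  proof -
    have "norm (\<Lambda> h) \<le> norm (G' x h) + norm (\<eta>' x h)"
      unfolding G'app by (metis add_diff_cancel_right' norm_triangle_ineq4)
    then show ?thesis using low[of h] \<eta>'b[of x h] by (simp add: left_diff_distrib)
  qed
  have G'inj: "inj (blinfun_apply (G' x))" for x
  proof (rule injI)
    fix h k assume "G' x h = G' x k"
    then have "(c - \<epsilon>) * norm (h - k) \<le> 0" using G'low[of "h - k" x] by (simp add: blinfun.diff_right)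
    then show "h = k" using c(2) by (simp add: mult_le_0_iff)
  qed
  have G'lin: "linear (blinfun_apply (G' x))" for x
    by (intro bounded_linear.linear blinfun.bounded_linear_right)
  have G'surj: "surj (blinfun_apply (G' x))" for x
    using G'lin G'inj linear_injective_imp_surjective by blast
  define J where "J x = inv (blinfun_apply (G' x))" for x
  have J: "G' x (J x k) = k" "J x (G' x k) = k" for x k
    unfolding J_def using G'surj G'inj by (auto simp: surj_f_inv_f inv_f_f)
  have Jlin: "linear (J x)" for x
    using G'lin[of x] G'inj[of x] unfolding J_def
    by (metis G'surj linear_inj_imp_surj inj_linear_imp_inv_linear)
  have Jbl: "bounded_linear (J x)" for x using Jlin by (rule linear_conv_bounded_linear[THEN iffD1])
  have Jb: "norm (J x k) \<le> norm k / (c - \<epsilon>)" for x k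
    using G'low[of "J x k" x] c(2) by (simp add: J field_simps)
  define I' where "I' y = Blinfun (J (inv G y))" for y
  have I'app: "blinfun_apply (I' y) = J (inv G y)" for y
    unfolding I'_def by (rule bounded_linear_Blinfun_apply[OF Jbl])
  have invcont: "continuous_on UNIV (inv G)" using lipinv by (rule lipschitz_on_continuous_on)
  have Ider: "(inv G has_derivative blinfun_apply (I' y)) (at y)" for y
    unfolding I'app
  proof (rule has_derivative_inverse_basic[where f = G and T = UNIV and f' = "blinfun_apply (G' (inv G y))"])
    show "J (inv G y) \<circ> blinfun_apply (G' (inv G y)) = id" by (auto simp: fun_eq_iff J)
    show "continuous (at y) (inv G)" using invcont by (simp add: continuous_on_eq_continuous_at)
  qed (auto simp: Gder Jbl invG)
  have I'cont: "continuous_on UNIV I'"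
    unfolding continuous_on_iff
  proof (intro ballI allI impI)
    fix y :: 'a and e :: real assume "e > 0"
    have "continuous_on UNIV (\<lambda>y. G' (inv G y))"
      by (rule continuous_on_compose2[OF G'cont invcont]) simp
    then have cont: "continuous (at y) (\<lambda>y. G' (inv G y))" by (simp add: continuous_on_eq_continuous_at)
    \<comment> \<open>Each of the two inverses in the estimate below has norm at most
      \<open>1 / (c - \<epsilon>)\<close>; the square compensates for both.\<close>
    have "e * (c - \<epsilon>)\<^sup>2 / 2 > 0" using \<open>e > 0\<close> c by simp
    then obtain d where d: "d > 0" "\<And>z. dist z y < d \<Longrightarrow> dist (G' (inv G z)) (G' (inv G y)) < e * (c - \<epsilon>)\<^sup>2 / 2"
      using cont unfolding continuous_at_eps_delta by metis
    have "dist (I' z) (I' y) < e" if z: "dist z y < d" for z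
    proof -
      let ?A = "G' (inv G z)" and ?B = "G' (inv G y)"
      have "norm ((I' z - I' y) k) \<le> e / 2 * norm k" for k
      proof -
        \<comment> \<open>The resolvent identity: the inverse of \<open>?A\<close> minus that of
          \<open>?B\<close> is the inverse of \<open>?A\<close> after \<open>?B - ?A\<close> after
          the inverse of \<open>?B\<close>.\<close>
        have "(I' z - I' y) k = J (inv G z) (?B (J (inv G y) k) - ?A (J (inv G y) k))"
          by (simp add: minus_blinfun.rep_eq I'app J linear_diff[OF Jlin])
        also have "\<dots> = J (inv G z) ((?B - ?A) (J (inv G y) k))" by (simp add: minus_blinfun.rep_eq)
        also have "norm \<dots> \<le> norm ((?B - ?A) (J (inv G y) k)) / (c - \<epsilon>)" by (rule Jb)
        also have "\<dots> \<le> (norm (?B - ?A) * norm (J (inv G y) k)) / (c - \<epsilon>)"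
          using c(2) by (intro divide_right_mono norm_blinfun) auto
        also have "\<dots> \<le> (e * (c - \<epsilon>)\<^sup>2 / 2 * (norm k / (c - \<epsilon>))) / (c - \<epsilon>)"
          using d(2)[OF z] c(2) Jb[of "inv G y" k] \<open>e > 0\<close>
          by (intro divide_right_mono mult_mono) (auto simp: dist_norm norm_minus_commute)
        also have "\<dots> = e / 2 * norm k"
        proof -
          have "(e * q\<^sup>2 / 2 * (norm k / q)) / q = e / 2 * norm k" if "q > 0" for q
            using that by (simp add: power2_eq_square)
          then show ?thesis using c(2) .
        qed
        finally show ?thesis .
      qed
      then have "norm (I' z - I' y) \<le> e / 2" using \<open>e > 0\<close> by (intro norm_blinfun_bound) auto
      then show ?thesis using \<open>e > 0\<close> by (simp add: dist_norm)
    qed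
    then show "\<exists>d>0. \<forall>z\<in>UNIV. dist z y < d \<longrightarrow> dist (I' z) (I' y) < e" using d(1) by blast
  qed
  have "C1_diffeomorphism G"
    unfolding C1_diffeomorphism_def C1_map_def bij_def
    using injG surjG Gder G'cont Ider I'cont by blast
  then show "C1_diffeomorphism (\<lambda>x. \<Lambda> x + \<eta> x)" unfolding G_def[abs_def] .
  show "(1 / (c - \<epsilon>))-lipschitz_on UNIV (inv (\<lambda>x. \<Lambda> x + \<eta> x))" using lipinv unfolding G_def[abs_def] .
qed

section \<open>Hausdorff measure\<close>

text \<open>In the top dimension the weight of a ball is its volume, so the covers of a null set by
  small balls of small total volume bound every content.\<close>

lemma hausdorff_measure_negligible:
  fixes N :: "'a::euclidean_space set"
  assumes N: "negligible N"
  shows "hausdorff_measure (real DIM('a)) N = 0"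
proof -
  let ?v = "unit_ball_vol (real DIM('a))"
  have v: "?v > 0" by (rule unit_ball_vol_pos) simp
  have "hausdorff_content (real DIM('a)) \<delta> N = 0" if "\<delta> > 0" for \<delta>
  proof -
    have "hausdorff_content (real DIM('a)) \<delta> N \<le> 0"
    proof (rule ennreal_le_epsilon)
      fix e :: real assume "e > 0"
      have pos: "0 < e / ?v" "0 < \<delta> / 2" using \<open>e > 0\<close> \<open>\<delta> > 0\<close> v by simp_all
      obtain a :: "nat \<Rightarrow> 'a" and r where r: "\<And>i. 0 \<le> r i" "\<And>i. r i \<le> \<delta> / 2" "N \<subseteq> (\<Union>i. cball (a i) (r i))"
        and sum: "(\<Sum>i. ennreal (r i ^ DIM('a))) \<le> ennreal (e / ?v)"
        by (rule negligible_cball_cover[OF N pos]) (rule that)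
      have w: "hausdorff_weight (real DIM('a)) (cball (a i) (r i)) = ennreal ?v * ennreal (r i ^ DIM('a))" for i
        using r(1)[of i] by (simp add: hausdorff_weight_def diameter_cball powr_realpow' ennreal_mult[symmetric])
      have "hausdorff_content (real DIM('a)) \<delta> N \<le> (\<Sum>i. hausdorff_weight (real DIM('a)) (cball (a i) (r i)))"
        unfolding hausdorff_content_def
      proof (rule INF_lower, intro CollectI conjI allI)
        fix i
        show "diameter (cball (a i) (r i)) \<le> \<delta>" using r(1,2)[of i] by (simp add: diameter_cball)
      qed (use r in auto)
      also have "\<dots> = ennreal ?v * (\<Sum>i. ennreal (r i ^ DIM('a)))" unfolding w by (rule ennreal_suminf_cmult)
      also have "\<dots> \<le> ennreal ?v * ennreal (e / ?v)" using sum by (rule mult_left_mono) simp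
      also have "\<dots> = ennreal (?v * (e / ?v))" by (rule ennreal_mult[symmetric]) (use v \<open>e > 0\<close> in auto)
      also have "?v * (e / ?v) = e"
        using nonzero_mult_div_cancel_left[OF less_imp_neq[OF v, THEN not_sym]] by (simp only: times_divide_eq_right)
      finally show "hausdorff_content (real DIM('a)) \<delta> N \<le> 0 + ennreal e" by simp
    qed
    then show ?thesis by simp
  qed
  then show ?thesis unfolding hausdorff_measure_def by simp
qed

lemma hausdorff_measure_0_cover:
  assumes T: "hausdorff_measure s T = 0" and "0 < e"
  obtains U :: "nat \<Rightarrow> 'a::metric_space set"
  where "T \<subseteq> (\<Union>i. U i)" "\<And>i. bounded (U i)" "(\<Sum>i. hausdorff_weight s (U i)) < ennreal e"
proof -
  \<comment> \<open>The scale \<open>1\<close> is arbitrary: the measure dominates the content at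
    every scale.\<close>
  have "hausdorff_content s 1 T \<le> hausdorff_measure s T"
    unfolding hausdorff_measure_def by (rule SUP_upper) simp
  then have "hausdorff_content s 1 T < ennreal e" using T \<open>0 < e\<close> by simp
  then obtain U where "T \<subseteq> (\<Union>i. U i)" "\<And>i. bounded (U i)" "(\<Sum>i. hausdorff_weight s (U i)) < ennreal e"
    unfolding hausdorff_content_def INF_less_iff by blast
  then show ?thesis by (rule that)
qed

lemma content_cbox_split_coordinates:
  fixes \<iota> :: "'m::finite \<Rightarrow> 'n::finite" and y :: "real ^ 'm"
  assumes \<iota>: "inj \<iota>" and "0 \<le> d" "0 \<le> R"
  defines "a \<equiv> \<chi> j. if j \<in> range \<iota> then y $ inv \<iota> j - d else - R"
    and "b \<equiv> \<chi> j. if j \<in> range \<iota> then y $ inv \<iota> j + d else R"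
  shows "measure lborel (cbox a b) = (2 * d) ^ CARD('m) * (2 * R) ^ card (- range \<iota>)"
    and "\<And>z. \<lbrakk>\<And>k. \<bar>z $ \<iota> k - y $ k\<bar> \<le> d; \<And>j. \<bar>z $ j\<bar> \<le> R\<rbrakk> \<Longrightarrow> z \<in> cbox a b"
proof -
  have "a \<in> cbox a b" using assms by (auto simp: mem_box_cart)
  then have "measure lborel (cbox a b) = (\<Prod>j\<in>UNIV. b $ j - a $ j)"
    by (intro content_cbox_cart) auto
  also have "\<dots> = (\<Prod>j\<in>range \<iota>. b $ j - a $ j) * (\<Prod>j\<in>- range \<iota>. b $ j - a $ j)"
    by (subst prod.union_disjoint[symmetric]) auto
  also have "(\<Prod>j\<in>range \<iota>. b $ j - a $ j) = (\<Prod>j\<in>range \<iota>. 2 * d)"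
    by (rule prod.cong) (auto simp: a_def b_def)
  also have "\<dots> = (2 * d) ^ CARD('m)" using \<iota> by (simp add: card_image)
  also have "(\<Prod>j\<in>- range \<iota>. b $ j - a $ j) = (\<Prod>j\<in>- range \<iota>. 2 * R)"
    by (rule prod.cong) (auto simp: a_def b_def)
  also have "\<dots> = (2 * R) ^ card (- range \<iota>)" by simp
  finally show "measure lborel (cbox a b) = (2 * d) ^ CARD('m) * (2 * R) ^ card (- range \<iota>)" .
  fix z :: "real ^ 'n" assume z: "\<And>k. \<bar>z $ \<iota> k - y $ k\<bar> \<le> d" "\<And>j. \<bar>z $ j\<bar> \<le> R"
  show "z \<in> cbox a b"
    unfolding mem_box_cart
  proof
    fix j
    show "a $ j \<le> z $ j \<and> z $ j \<le> b $ j"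
    proof (cases "j \<in> range \<iota>")
      case True
      then obtain k where "j = \<iota> k" by blast
      then show ?thesis using z(1)[of k] \<iota> by (simp add: a_def b_def inv_f_f abs_le_iff)
    next
      case False
      then show ?thesis using z(2)[of j] by (simp add: a_def b_def abs_le_iff)
    qed
  qed
qed

text \<open>A piece of \<open>T\<close> of diameter \<open>d\<close> has its image in a cube of
  half-side \<open>C * d\<close>; the part of the cylinder over it with coordinates bounded by
  \<open>R\<close> lies in a box. The box volumes are proportional to the Hausdorff weights, so no
  passage through Lebesgue measure on the target is required.\<close>

lemma negligible_fst_part_preimage:
  fixes \<iota> :: "'m::finite \<Rightarrow> 'n::finite" and \<phi> :: "'x::metric_space \<Rightarrow> real ^ 'm"
  assumes \<iota>: "inj \<iota>" and \<phi>: "C-lipschitz_on T \<phi>" and T: "hausdorff_measure (real CARD('m)) T = 0"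
  shows "negligible {z::real ^ 'n. fst_part \<iota> z \<in> \<phi> ` T}"
proof -
  let ?v = "unit_ball_vol (real CARD('m))"
  let ?Z = "\<lambda>(R::nat) W. {z::real ^ 'n. (\<forall>j. \<bar>z $ j\<bar> \<le> real R) \<and> fst_part \<iota> z \<in> \<phi> ` W}"
  have C: "C \<ge> 0" using \<phi> by (rule lipschitz_on_nonneg)
  have "negligible (?Z R T)" for R :: nat
    unfolding negligible_outer_le
  proof (intro allI impI)
    fix e :: real assume "e > 0"
    \<comment> \<open>The ratio of box volume to weight: the side \<open>2 * (C * d)\<close> equals
      \<open>4 * C\<close> times \<open>d / 2\<close>, and the other sides contribute powers of
      \<open>2 * R\<close>.\<close>
    define M where "M = (4 * C) ^ CARD('m) * (2 * real R) ^ card (- range \<iota>) / ?v"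
    have M: "M \<ge> 0" using C by (simp add: M_def)
    have eM: "e / (M + 1) > 0" using \<open>e > 0\<close> M by simp
    obtain U where U: "T \<subseteq> (\<Union>i. U i)" "\<And>i. bounded (U i)"
      and sum: "(\<Sum>i. hausdorff_weight (real CARD('m)) (U i)) < ennreal (e / (M + 1))"
      by (rule hausdorff_measure_0_cover[OF T eM]) (rule that)
    have "\<exists>B. B \<in> sets borel \<and> ?Z R (U i \<inter> T) \<subseteq> B \<and>
        emeasure lborel B \<le> ennreal M * hausdorff_weight (real CARD('m)) (U i)" for i
    proof (cases "U i \<inter> T = {}")
      case True
      then show ?thesis by (intro exI[of _ "{}"]) auto
    next
      case False
      \<comment> \<open>The map \<phi> is Lipschitz only on \<open>T\<close>, so the box must be
        centred at the image of a point of \<open>T\<close>.\<close>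
      then obtain t where t: "t \<in> U i" "t \<in> T" by blast
      define d where "d = diameter (U i)"
      have d: "d \<ge> 0" using U(2)[of i] by (simp add: d_def diameter_ge_0)
      define a where "a = (\<chi> j. if j \<in> range \<iota> then \<phi> t $ inv \<iota> j - C * d else - real R)"
      define b where "b = (\<chi> j. if j \<in> range \<iota> then \<phi> t $ inv \<iota> j + C * d else real R)"
      have Cd: "0 \<le> C * d" using C d by simp
      note box = content_cbox_split_coordinates[OF \<iota> Cd of_nat_0_le_iff[of R], where y = "\<phi> t", folded a_def b_def]
      have "?Z R (U i \<inter> T) \<subseteq> cbox a b"
      proof
        fix z assume z: "z \<in> ?Z R (U i \<inter> T)"
        then obtain s where s: "s \<in> U i" "s \<in> T" "fst_part \<iota> z = \<phi> s" by auto
        have "dist (\<phi> s) (\<phi> t) \<le> C * dist s t" using \<phi> s t by (intro lipschitz_onD)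
        also have "\<dots> \<le> C * d"
          using C diameter_bounded_bound[OF U(2) s(1) t(1)] by (intro mult_left_mono) (auto simp: d_def)
        finally have st: "norm (\<phi> s - \<phi> t) \<le> C * d" by (simp add: dist_norm)
        show "z \<in> cbox a b"
        proof (rule box(2))
          fix k
          have "z $ \<iota> k = \<phi> s $ k" using s(3) by (metis fst_part_def vec_lambda_beta)
          then show "\<bar>z $ \<iota> k - \<phi> t $ k\<bar> \<le> C * d"
            using component_le_norm_cart[of "\<phi> s - \<phi> t" k] st by simp
        qed (use z in auto)
      qed
      moreover have "emeasure lborel (cbox a b) \<le> ennreal M * hausdorff_weight (real CARD('m)) (U i)"
      proof -
        have "measure lborel (cbox a b) = M * (?v * (d / 2) ^ CARD('m))"
        proof -
          have "(2 * (C * d)) ^ CARD('m) = (4 * C) ^ CARD('m) * (d / 2) ^ CARD('m)"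
          proof -
            have "2 * (C * d) = (4 * C) * (d / 2)" by simp
            then show ?thesis by (simp only: power_mult_distrib)
          qed
          moreover have "?v \<noteq> 0" using unit_ball_vol_pos[of "real CARD('m)"] by linarith
          ultimately show ?thesis unfolding box(1) M_def by (simp only: times_divide_eq_left nonzero_mult_div_cancel_left nonzero_mult_div_cancel_right mult_ac) simp
        qed
        moreover have "hausdorff_weight (real CARD('m)) (U i) = ennreal (?v * (d / 2) ^ CARD('m))"
          using t d by (auto simp: hausdorff_weight_def d_def powr_realpow')
        ultimately show ?thesis
          using M d by (simp add: emeasure_eq_measure2 emeasure_lborel_cbox_finite[THEN less_imp_neq] ennreal_mult[symmetric])
      qed
      ultimately show ?thesis by (intro exI[of _ "cbox a b"]) auto
    qed
    then have "\<forall>i. \<exists>B. B \<in> sets borel \<and> ?Z R (U i \<inter> T) \<subseteq> B \<and>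
        emeasure lborel B \<le> ennreal M * hausdorff_weight (real CARD('m)) (U i)" by (rule allI)
    from choice[OF this] obtain B where B': "\<forall>i. B i \<in> sets borel \<and> ?Z R (U i \<inter> T) \<subseteq> B i \<and>
        emeasure lborel (B i) \<le> ennreal M * hausdorff_weight (real CARD('m)) (U i)" by (rule exE)
    have B: "\<And>i. B i \<in> sets borel"
      "\<And>i. ?Z R (U i \<inter> T) \<subseteq> B i"
      "\<And>i. emeasure lborel (B i) \<le> ennreal M * hausdorff_weight (real CARD('m)) (U i)"
      using B' by (simp_all only: conj_assoc)
    have "emeasure lborel (\<Union>i. B i) \<le> (\<Sum>i. emeasure lborel (B i))"
      using B(1) by (intro emeasure_subadditive_countably) auto
    also have "\<dots> \<le> (\<Sum>i. ennreal M * hausdorff_weight (real CARD('m)) (U i))"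
      by (intro suminf_le B(3) summableI)
    also have "\<dots> = ennreal M * (\<Sum>i. hausdorff_weight (real CARD('m)) (U i))" by (rule ennreal_suminf_cmult)
    also have "\<dots> \<le> ennreal M * ennreal (e / (M + 1))" using sum by (intro mult_left_mono) auto
    also have "\<dots> = ennreal (M * (e / (M + 1)))" by (rule ennreal_mult[symmetric]) (use M eM in auto)
    also have "\<dots> \<le> ennreal e" using M \<open>e > 0\<close> by (intro ennreal_leI) (simp add: field_simps)
    finally have em: "emeasure lebesgue (\<Union>i. B i) \<le> ennreal e" using B(1) by simp
    have Bs: "(\<Union>i. B i) \<in> sets lebesgue" using B(1) by auto
    have "(\<Union>i. B i) \<in> lmeasurable" using Bs le_less_trans[OF em ennreal_less_top] by (simp add: fmeasurable_def)
    moreover have "measure lebesgue (\<Union>i. B i) \<le> e"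
      using em \<open>e > 0\<close> unfolding measure_def by (intro enn2real_leI) auto
    moreover have "?Z R T \<subseteq> (\<Union>i. B i)"
    proof
      fix z assume z: "z \<in> ?Z R T"
      then obtain t where t: "t \<in> T" "fst_part \<iota> z = \<phi> t" by auto
      then obtain i where "t \<in> U i" using U(1) by blast
      then have "z \<in> B i" using B(2)[of i] z t by blast
      then show "z \<in> (\<Union>i. B i)" by blast
    qed
    ultimately show "\<exists>S. ?Z R T \<subseteq> S \<and> S \<in> lmeasurable \<and> measure lebesgue S \<le> e"
      by blast
  qed
  then have "negligible (\<Union>R::nat. ?Z R T)"
    by (rule negligible_Union_nat)
  moreover have "{z::real ^ 'n. fst_part \<iota> z \<in> \<phi> ` T} \<subseteq> (\<Union>R::nat. ?Z R T)"
  proof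
    fix z :: "real ^ 'n" assume z: "z \<in> {z. fst_part \<iota> z \<in> \<phi> ` T}"
    obtain R :: nat where "norm z \<le> real R" using real_arch_simple by blast
    then have "\<bar>z $ j\<bar> \<le> real R" for j using component_le_norm_cart[of z j] by linarith
    then show "z \<in> (\<Union>R::nat. ?Z R T)" using z by blast
  qed
  ultimately show ?thesis by (rule negligible_subset)
qed

text \<open>For \<iota> the identity the cylinder over \<open>S\<close> is \<open>S\<close>
  itself.\<close>

lemma negligible_if_hausdorff_measure_0:
  fixes S :: "(real ^ 'n::finite) set"
  assumes "hausdorff_measure (real CARD('n)) S = 0"
  shows "negligible S"
proof -
  have "negligible {z::real ^ 'n. fst_part id z \<in> (\<lambda>x. x) ` S}"
    by (rule negligible_fst_part_preimage[OF inj_on_id lipschitz_on_id assms])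
  moreover have "fst_part id z = z" for z :: "real ^ 'n" by (simp add: fst_part_def)
  ultimately show ?thesis by simp
qed

section \<open>Metric differentials of Lipschitz maps\<close>

text \<open>Inclusion-exclusion in each ball: the density of the intersection is at least the sum of
  the two densities minus one.\<close>

lemma lebesgue_density_point_Int:
  fixes S T :: "'a::euclidean_space set"
  assumes S: "S \<in> sets lebesgue" "lebesgue_density_point x S" and T: "T \<in> sets lebesgue" "lebesgue_density_point x T"
  shows "lebesgue_density_point x (S \<inter> T)"
  unfolding lebesgue_density_point_def
proof (rule tendsto_sandwich[of "\<lambda>r. measure lebesgue (S \<inter> ball x r) / measure lebesgue (ball x r)
      + measure lebesgue (T \<inter> ball x r) / measure lebesgue (ball x r) - 1" _ _ "\<lambda>_. 1"])
  have m: "X \<inter> ball x r \<in> lmeasurable" if "X \<in> sets lebesgue" for X r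
    using that fmeasurable_Int_fmeasurable[OF lmeasurable_ball that, of x r] by (simp add: Int_commute)
  have ev: "\<forall>\<^sub>F r in at_right (0::real). 0 < r" by (rule eventually_at_right_less)
  show "\<forall>\<^sub>F r in at_right 0. measure lebesgue (S \<inter> ball x r) / measure lebesgue (ball x r)
      + measure lebesgue (T \<inter> ball x r) / measure lebesgue (ball x r) - 1
      \<le> measure lebesgue (S \<inter> T \<inter> ball x r) / measure lebesgue (ball x r)"
    using ev
  proof eventually_elim
    fix r :: real assume r: "0 < r"
    let ?b = "measure lebesgue (ball x r)"
    have b: "?b > 0" using r by (simp add: content_ball_gt_0_iff)
    have "measure lebesgue (S \<inter> ball x r) + measure lebesgue (T \<inter> ball x r)
      = measure lebesgue ((S \<inter> ball x r) \<union> (T \<inter> ball x r)) + measure lebesgue ((S \<inter> ball x r) \<inter> (T \<inter> ball x r))"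
      using measure_Un3[OF m[OF S(1), of r] m[OF T(1), of r]] by simp
    also have "measure lebesgue ((S \<inter> ball x r) \<union> (T \<inter> ball x r)) \<le> ?b"
      using fmeasurable.Un[OF m[OF S(1), of r] m[OF T(1), of r]]
      by (intro measure_mono_fmeasurable) (auto intro: fmeasurableD)
    also have "(S \<inter> ball x r) \<inter> (T \<inter> ball x r) = S \<inter> T \<inter> ball x r" by blast
    finally have "(measure lebesgue (S \<inter> ball x r) + measure lebesgue (T \<inter> ball x r)) / ?b \<le> (?b + measure lebesgue (S \<inter> T \<inter> ball x r)) / ?b"
      using b by (intro divide_right_mono) auto
    then show "measure lebesgue (S \<inter> ball x r) / ?b + measure lebesgue (T \<inter> ball x r) / ?b - 1
      \<le> measure lebesgue (S \<inter> T \<inter> ball x r) / ?b"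
      using b by (simp add: add_divide_distrib)
  qed
  show "\<forall>\<^sub>F r in at_right 0. measure lebesgue (S \<inter> T \<inter> ball x r) / measure lebesgue (ball x r) \<le> 1"
    using ev
  proof eventually_elim
    fix r :: real assume r: "0 < r"
    have b: "measure lebesgue (ball x r) > 0" using r by (simp add: content_ball_gt_0_iff)
    have "measure lebesgue (S \<inter> T \<inter> ball x r) \<le> measure lebesgue (ball x r)"
      using S(1) T(1) by (intro measure_mono_fmeasurable) auto
    then show "measure lebesgue (S \<inter> T \<inter> ball x r) / measure lebesgue (ball x r) \<le> 1" using b by simp
  qed
  show "((\<lambda>r. measure lebesgue (S \<inter> ball x r) / measure lebesgue (ball x r)
      + measure lebesgue (T \<inter> ball x r) / measure lebesgue (ball x r) - 1) \<longlongrightarrow> 1) (at_right 0)"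
    using tendsto_diff[OF tendsto_add[OF S(2)[unfolded lebesgue_density_point_def] T(2)[unfolded lebesgue_density_point_def]] tendsto_const[of 1]]
    by simp
qed (rule tendsto_const)

section \<open>Uniqueness and existence of the approximate metric differential\<close>

lemma is_seminorm_scaleR: "is_seminorm \<sigma> \<Longrightarrow> \<sigma> (c *\<^sub>R v) = \<bar>c\<bar> * \<sigma> v"
  by (simp add: is_seminorm_def)

lemma seminorm_bounded:
  fixes \<sigma> :: "'a::euclidean_space \<Rightarrow> real"
  assumes \<sigma>: "is_seminorm \<sigma>"
  obtains K where "K \<ge> 0" "\<And>v. \<sigma> v \<le> K * norm v" "\<And>v w. \<bar>\<sigma> v - \<sigma> w\<bar> \<le> K * norm (v - w)"
proof -
  have tri: "\<sigma> (v + w) \<le> \<sigma> v + \<sigma> w" for v w using \<sigma> by (simp add: is_seminorm_def)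
  have nn: "0 \<le> \<sigma> v" for v using \<sigma> by (simp add: is_seminorm_def)
  have z: "\<sigma> 0 = 0" using is_seminorm_scaleR[OF \<sigma>, of 0 0] by simp
  define K where "K = (\<Sum>b\<in>Basis. \<sigma> b)"
  have K: "K \<ge> 0" using nn by (simp add: K_def sum_nonneg)
  have sumle: "\<sigma> (\<Sum>b\<in>B. f b) \<le> (\<Sum>b\<in>B. \<sigma> (f b))" if "finite B" for B :: "'a set" and f
    using that by (induction B rule: finite_induct) (auto simp: z intro: order_trans[OF tri])
  have bound: "\<sigma> v \<le> K * norm v" for v
  proof -
    have "\<sigma> v = \<sigma> (\<Sum>b\<in>Basis. (v \<bullet> b) *\<^sub>R b)" by (simp add: euclidean_representation)
    also have "\<dots> \<le> (\<Sum>b\<in>Basis. \<sigma> ((v \<bullet> b) *\<^sub>R b))" by (rule sumle) simp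
    also have "\<dots> \<le> (\<Sum>b\<in>Basis. \<sigma> b * norm v)"
    proof (rule sum_mono)
      fix b :: 'a assume b: "b \<in> Basis"
      have "\<bar>v \<bullet> b\<bar> * \<sigma> b \<le> norm v * \<sigma> b"
        using Basis_le_norm[OF b, of v] nn by (rule mult_right_mono)
      then show "\<sigma> ((v \<bullet> b) *\<^sub>R b) \<le> \<sigma> b * norm v"
        by (simp add: is_seminorm_scaleR[OF \<sigma>] mult.commute)
    qed
    also have "\<dots> = K * norm v" by (simp add: K_def sum_distrib_right)
    finally show ?thesis .
  qed
  have neg: "\<sigma> (- v) = \<sigma> v" for v using is_seminorm_scaleR[OF \<sigma>, of "-1" v] by simp
  have "\<bar>\<sigma> v - \<sigma> w\<bar> \<le> K * norm (v - w)" for v w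
    using tri[of "v - w" w] tri[of "w - v" v] bound[of "v - w"] neg[of "v - w"] by (simp add: abs_le_iff)
  then show ?thesis using that K bound by blast
qed

text \<open>The intersection of the two approximating sets still has \<open>x\<close> as a density
  point, so it contains points \<open>q\<close> very close to \<open>x + t *\<^sub>R v\<close>. Both
  expansions hold at \<open>q\<close>, and seminorms are Lipschitz. Uniqueness follows by exchanging
  \<sigma> and \<tau>.\<close>

lemma approx_metric_differential_le:
  fixes f :: "'a::euclidean_space \<Rightarrow> 'x::metric_space"
  assumes s: "has_approx_metric_differential f A x \<sigma>" and t: "has_approx_metric_differential f A x \<tau>"
  shows "\<sigma> v \<le> \<tau> v"
proof (rule field_le_epsilon)
  fix e :: real assume "e > 0"
  obtain B1 where B1: "B1 \<in> sets lebesgue" "B1 \<subseteq> A" "lebesgue_density_point x B1"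
    "((\<lambda>y. (dist (f y) (f x) - \<sigma> (y - x)) / norm (y - x)) \<longlongrightarrow> 0) (at x within B1)" and \<sigma>: "is_seminorm \<sigma>"
    using s unfolding has_approx_metric_differential_def by blast
  obtain B2 where B2: "B2 \<in> sets lebesgue" "B2 \<subseteq> A" "lebesgue_density_point x B2"
    "((\<lambda>y. (dist (f y) (f x) - \<tau> (y - x)) / norm (y - x)) \<longlongrightarrow> 0) (at x within B2)" and \<tau>: "is_seminorm \<tau>"
    using t unfolding has_approx_metric_differential_def by blast
  obtain K1 where K1: "K1 \<ge> 0" "\<And>v w. \<bar>\<sigma> v - \<sigma> w\<bar> \<le> K1 * norm (v - w)" by (rule seminorm_bounded[OF \<sigma>]) blast
  obtain K2 where K2: "K2 \<ge> 0" "\<And>v w. \<bar>\<tau> v - \<tau> w\<bar> \<le> K2 * norm (v - w)" by (rule seminorm_bounded[OF \<tau>]) blast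
  show "\<sigma> v \<le> \<tau> v + e"
  proof (cases "v = 0")
    case True
    then show ?thesis using is_seminorm_scaleR[OF \<sigma>, of 0 0] is_seminorm_scaleR[OF \<tau>, of 0 0] \<open>e > 0\<close> by simp
  next
    case False
    define B where "B = B1 \<inter> B2"
    have B: "B \<in> sets lebesgue" "lebesgue_density_point x B"
      unfolding B_def using B1(1,3) B2(1,3) by (auto intro: lebesgue_density_point_Int)
    define n where "n = norm v"
    have n: "n > 0" using False by (simp add: n_def)
    \<comment> \<open>The bound \<open>1/2\<close> ensures \<open>q \<noteq> x\<close>; the other
      makes the two seminorm errors together at most \<open>e / 2 * t\<close>.\<close>
    define \<eta> where "\<eta> = min (1/2) (e / (2 * (K1 + K2 + 1) * n))"
    have Kp: "2 * (K1 + K2 + 1) * n > 0" using K1 K2 n by (simp add: add_nonneg_pos)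
    have \<eta>: "\<eta> > 0" "\<eta> \<le> 1/2" "(K1 + K2) * (\<eta> * n) \<le> e / 2"
    proof -
      show "\<eta> \<le> 1/2" unfolding \<eta>_def by (rule min.cobounded1)
      show "\<eta> > 0" using Kp \<open>e > 0\<close> by (simp add: \<eta>_def)
      have "(K1 + K2) * (\<eta> * n) \<le> (K1 + K2 + 1) * (\<eta> * n)" using \<open>\<eta> > 0\<close> n by (intro mult_right_mono) auto
      also have "\<dots> = \<eta> * (2 * (K1 + K2 + 1) * n) / 2" by simp
      also have "\<dots> \<le> e / 2"
      proof -
        have "\<eta> \<le> e / (2 * (K1 + K2 + 1) * n)" by (simp add: \<eta>_def)
        then have "\<eta> * (2 * (K1 + K2 + 1) * n) \<le> e" using Kp by (simp add: pos_le_divide_eq)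
        then show ?thesis by simp
      qed
      finally show "(K1 + K2) * (\<eta> * n) \<le> e / 2" .
    qed
    \<comment> \<open>Since \<open>norm (q - x) \<le> 2 * (t * n)\<close>, each expansion costs at
      most \<open>e / 4 * t\<close>, so the total error is \<open>e * t\<close>.\<close>
    define \<epsilon> where "\<epsilon> = e / (8 * n)"
    have \<epsilon>: "\<epsilon> > 0" using \<open>e > 0\<close> n by (simp add: \<epsilon>_def)
    obtain d1 where d1: "d1 > 0" "\<And>y. y \<in> B1 \<Longrightarrow> y \<noteq> x \<Longrightarrow> dist y x < d1 \<Longrightarrow> \<bar>(dist (f y) (f x) - \<sigma> (y - x)) / norm (y - x)\<bar> < \<epsilon>"
      using tendstoD[OF B1(4) \<epsilon>] unfolding eventually_at by (auto simp: dist_real_def)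
    obtain d2 where d2: "d2 > 0" "\<And>y. y \<in> B2 \<Longrightarrow> y \<noteq> x \<Longrightarrow> dist y x < d2 \<Longrightarrow> \<bar>(dist (f y) (f x) - \<tau> (y - x)) / norm (y - x)\<bar> < \<epsilon>"
      using tendstoD[OF B2(4) \<epsilon>] unfolding eventually_at by (auto simp: dist_real_def)
    obtain d3 where d3: "d3 > 0" "\<And>h. h \<noteq> 0 \<Longrightarrow> norm h < d3 \<Longrightarrow> \<exists>q\<in>B. dist q (x + h) \<le> \<eta> * norm h"
      using density_imp_nonporous[OF B \<eta>(1)] by blast
    define t where "t = min (d1 / 4) (min (d2 / 4) (d3 / 2)) / n"
    have t: "t > 0" "t * n < d3" "2 * (t * n) < d1" "2 * (t * n) < d2" using d1(1) d2(1) d3(1) n by (auto simp: t_def)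
    have tv: "norm (t *\<^sub>R v) = t * n" using t(1) by (simp add: n_def)
    obtain q where q: "q \<in> B" "dist q (x + t *\<^sub>R v) \<le> \<eta> * (t * n)"
      using d3(2)[of "t *\<^sub>R v"] t tv False by auto
    have qv: "norm ((q - x) - t *\<^sub>R v) \<le> \<eta> * (t * n)" using q(2) by (simp add: dist_norm algebra_simps)
    have "\<eta> * (t * n) \<le> 1/2 * (t * n)" using \<eta> t n by (intro mult_right_mono) auto
    then have qb: "norm (q - x) \<le> 2 * (t * n)" "norm (q - x) > 0"
      using qv tv norm_triangle_ineq2[of "q - x" "t *\<^sub>R v"] norm_triangle_ineq2[of "t *\<^sub>R v" "q - x"] norm_minus_commute[of "q - x" "t *\<^sub>R v"] t n
        mult_pos_pos[OF t(1) n] by linarith+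
    then have qx: "q \<noteq> x" "q \<in> B1" "q \<in> B2" using q(1) by (auto simp: B_def)
    have dq: "dist q x < d1" "dist q x < d2" using qb(1) t by (auto simp: dist_norm)
    have 1: "\<bar>dist (f q) (f x) - \<sigma> (q - x)\<bar> \<le> \<epsilon> * norm (q - x)"
      using d1(2)[OF qx(2,1) dq(1)] qb(2) by (simp add: abs_divide pos_divide_less_eq)
    have 2: "\<bar>dist (f q) (f x) - \<tau> (q - x)\<bar> \<le> \<epsilon> * norm (q - x)"
      using d2(2)[OF qx(3,1) dq(2)] qb(2) by (simp add: abs_divide pos_divide_less_eq)
    have 3: "\<epsilon> * norm (q - x) \<le> e / 4 * t"
    proof -
      have "\<epsilon> * norm (q - x) \<le> \<epsilon> * (2 * (t * n))" using qb(1) \<epsilon> by (intro mult_left_mono) auto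
      also have "\<dots> = e / 4 * t" using n by (simp add: \<epsilon>_def)
      finally show ?thesis .
    qed
    have 4: "\<bar>\<sigma> (q - x) - \<sigma> (t *\<^sub>R v)\<bar> \<le> K1 * (\<eta> * (t * n))"
      using K2(1) K1(2)[of "q - x" "t *\<^sub>R v"] mult_left_mono[OF qv K1(1)] by linarith
    have 5: "\<bar>\<tau> (q - x) - \<tau> (t *\<^sub>R v)\<bar> \<le> K2 * (\<eta> * (t * n))"
      using K2(2)[of "q - x" "t *\<^sub>R v"] mult_left_mono[OF qv K2(1)] by linarith
    have 6: "K1 * (\<eta> * (t * n)) + K2 * (\<eta> * (t * n)) \<le> e / 2 * t"
    proof -
      have "K1 * (\<eta> * (t * n)) + K2 * (\<eta> * (t * n)) = (K1 + K2) * (\<eta> * n) * t" by (simp add: algebra_simps)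
      also have "\<dots> \<le> e / 2 * t" using \<eta>(3) t(1) by (intro mult_right_mono) auto
      finally show ?thesis .
    qed
    have "\<sigma> (t *\<^sub>R v) \<le> \<tau> (t *\<^sub>R v) + e * t" using 1 2 3 4 5 6 by linarith
    then have "t * \<sigma> v \<le> t * (\<tau> v + e)"
      using t(1) by (simp add: is_seminorm_scaleR[OF \<sigma>] is_seminorm_scaleR[OF \<tau>] algebra_simps)
    then show ?thesis using t(1) by simp
  qed
qed

lemma md_a_eqI:
  fixes f :: "'a::euclidean_space \<Rightarrow> 'x::metric_space"
  assumes "has_approx_metric_differential f A x \<sigma>"
  shows "md_a f A x = \<sigma>"
  unfolding md_a_def
proof (rule the_equality)
  show "has_approx_metric_differential f A x \<sigma>" by (rule assms)
  fix \<tau> assume t: "has_approx_metric_differential f A x \<tau>"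
  show "\<tau> = \<sigma>"
  proof
    fix v
    show "\<tau> v = \<sigma> v"
      using approx_metric_differential_le[OF t assms, of v] approx_metric_differential_le[OF assms t, of v] by simp
  qed
qed

text \<open>The distances to a dense sequence embed the image of \<open>f\<close> isometrically into
  bounded sequences, in the manner of Kuratowski. The metric increment of \<open>f\<close> is
  therefore the supremum treated in \<open>metric_rademacher\<close>, and \<open>A\<close> itself
  serves as the approximating set at its density points.\<close>

lemma metric_differential_of_lipschitz:
  fixes f :: "'a::euclidean_space \<Rightarrow> 'x::metric_space"
  assumes A: "A \<in> sets lebesgue" "A \<noteq> {}" and f: "L-lipschitz_on A f"
  obtains a u g N where "\<And>k. L-lipschitz_on UNIV (u k)" "\<And>k p. p \<in> A \<Longrightarrow> u k p = dist (f p) (f (a k))"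
    "negligible N" "\<And>(k::nat) p. p \<notin> N \<Longrightarrow> (u k has_derivative (\<lambda>h. g k p \<bullet> h)) (at p)"
    "\<And>p. p \<in> A - N \<Longrightarrow> has_approx_metric_differential f A p (\<lambda>v. SUP k. \<bar>g k p \<bullet> v\<bar>)"
proof -
  have L: "L \<ge> 0" using f by (rule lipschitz_on_nonneg)
  obtain T where T: "countable T" "T \<subseteq> A" "A \<subseteq> closure T" by (rule separable)
  then have Tne: "T \<noteq> {}" using A(2) by auto
  define a where "a = from_nat_into T"
  have aT: "range a = T" unfolding a_def using T(1) Tne by (rule range_from_nat_into[rotated])
  have aA: "a k \<in> A" for k using aT T(2) by blast
  have "\<forall>k. \<exists>w. L-lipschitz_on UNIV w \<and> (\<forall>p\<in>A. w p = dist (f p) (f (a k)))"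
  proof
    fix k
    have "L-lipschitz_on A (\<lambda>p. dist (f p) (f (a k)))"
    proof (rule lipschitz_onI)
      fix p q assume "p \<in> A" "q \<in> A"
      have "dist (dist (f p) (f (a k))) (dist (f q) (f (a k))) \<le> dist (f p) (f q)"
        unfolding dist_real_def using abs_dist_diff_le[of "f p" "f (a k)" "f q"] by (simp add: dist_commute)
      also have "\<dots> \<le> L * dist p q" using f \<open>p \<in> A\<close> \<open>q \<in> A\<close> by (rule lipschitz_onD)
      finally show "dist (dist (f p) (f (a k))) (dist (f q) (f (a k))) \<le> L * dist p q" .
    qed (rule L)
    then show "\<exists>w. L-lipschitz_on UNIV w \<and> (\<forall>p\<in>A. w p = dist (f p) (f (a k)))"
      by (rule mcshane_extension) blast
  qed
  then obtain u where u: "\<And>k. L-lipschitz_on UNIV (u k)" and uA: "\<And>k p. p \<in> A \<Longrightarrow> u k p = dist (f p) (f (a k))"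
    by metis
  obtain N0 g where N0: "negligible N0" and der: "\<And>k p. p \<notin> N0 \<Longrightarrow> (u k has_derivative (\<lambda>h. g k p \<bullet> h)) (at p)"
    and sup: "\<And>x e. \<lbrakk>x \<notin> N0; 0 < e\<rbrakk> \<Longrightarrow>
      \<exists>d>0. \<forall>h. norm h < d \<longrightarrow> \<bar>(SUP k. \<bar>u k (x + h) - u k x\<bar>) - (SUP k. \<bar>g k x \<bullet> h\<bar>)\<bar> \<le> e * norm h"
    by (rule metric_rademacher[OF u]) (rule that)
  have distf: "dist (f q) (f p) = (SUP k. \<bar>u k q - u k p\<bar>)" if pq: "p \<in> A" "q \<in> A" for p q
  proof (rule antisym)
    have le: "\<bar>u k q - u k p\<bar> \<le> dist (f q) (f p)" for k
      using abs_dist_diff_le[of "f q" "f (a k)" "f p"] pq by (simp add: uA dist_commute)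
    then show "(SUP k. \<bar>u k q - u k p\<bar>) \<le> dist (f q) (f p)" by (intro cSUP_least) auto
    have bdd: "bdd_above (range (\<lambda>k. \<bar>u k q - u k p\<bar>))" using le by (rule bdd_aboveI2)
    show "dist (f q) (f p) \<le> (SUP k. \<bar>u k q - u k p\<bar>)"
    proof (rule field_le_epsilon)
      fix e :: real assume "e > 0"
      \<comment> \<open>For \<open>a k\<close> within \<open>s\<close> of \<open>p\<close>, the
        value \<open>f (a k)\<close> is within \<open>e / 2\<close> of \<open>f p\<close>, so the
        \<open>k\<close>-th difference misses the full distance by at most \<open>e\<close>.\<close>
      define s where "s = e / 2 / (L + 1)"
      have s: "s > 0" using \<open>e > 0\<close> L by (simp add: s_def)
      have "p \<in> closure T" using T(3) pq(1) by blast
      then obtain y where y: "y \<in> T" "dist y p < s" using closure_approachable s by metis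
      then obtain k where k: "a k = y" using aT by blast
      have "dist (f p) (f (a k)) \<le> L * dist p (a k)" using f pq(1) aA by (rule lipschitz_onD)
      also have "\<dots> \<le> (L + 1) * s" using y k L by (intro mult_mono) (auto simp: dist_commute)
      also have "\<dots> = e / 2"
      proof -
        have "r * (e / 2 / r) = e / 2" if "r > 0" for r using that by simp
        then show ?thesis unfolding s_def using L by (simp only: add_nonneg_pos zero_less_one)
      qed
      finally have "dist (f p) (f (a k)) \<le> e / 2" .
      moreover have "dist (f q) (f p) \<le> dist (f q) (f (a k)) + dist (f p) (f (a k))" by (rule dist_triangle2)
      moreover have "\<bar>u k q - u k p\<bar> \<le> (SUP k. \<bar>u k q - u k p\<bar>)" using bdd by (rule cSUP_upper[rotated]) simp
      ultimately show "dist (f q) (f p) \<le> (SUP k. \<bar>u k q - u k p\<bar>) + e" using pq by (simp add: uA abs_le_iff)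
    qed
  qed
  define N where "N = N0 \<union> {x\<in>A. \<not> lebesgue_density_point x A}"
  have N: "negligible N" unfolding N_def by (intro negligible_Un N0 lebesgue_density_theorem A)
  have "has_approx_metric_differential f A p (\<lambda>v. SUP k. \<bar>g k p \<bullet> v\<bar>)" if p: "p \<in> A - N" for p
  proof -
    have pN: "p \<notin> N0" "p \<in> A" "lebesgue_density_point p A" using p by (auto simp: N_def)
    have bg: "\<bar>g k p \<bullet> h\<bar> \<le> L * norm h" for k h
      using Cauchy_Schwarz_ineq2[of "g k p" h] mult_right_mono[OF lipschitz_norm_gradient_le[OF u der[OF pN(1)], of k], of "norm h"] by simp
    have bdd: "bdd_above (range (\<lambda>k. \<bar>g k p \<bullet> h\<bar>))" for h by (intro bdd_aboveI2[of _ _ "L * norm h"] bg)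
    have up: "\<bar>g k p \<bullet> h\<bar> \<le> (SUP k. \<bar>g k p \<bullet> h\<bar>)" for k h by (intro cSUP_upper bdd) simp
    have semi: "is_seminorm (\<lambda>v. SUP k. \<bar>g k p \<bullet> v\<bar>)"
      unfolding is_seminorm_def
    proof (intro conjI allI)
      show "0 \<le> (SUP k. \<bar>g k p \<bullet> v\<bar>)" for v using up[of 0 v] by linarith
      have le: "(SUP k. \<bar>g k p \<bullet> (c *\<^sub>R v)\<bar>) \<le> \<bar>c\<bar> * (SUP k. \<bar>g k p \<bullet> v\<bar>)" for c v
        using up by (intro cSUP_least) (auto simp: abs_mult mult_left_mono)
      show "(SUP k. \<bar>g k p \<bullet> (c *\<^sub>R v)\<bar>) = \<bar>c\<bar> * (SUP k. \<bar>g k p \<bullet> v\<bar>)" for c v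
      proof (cases "c = 0")
        case False
        have "\<bar>c\<bar> * (SUP k. \<bar>g k p \<bullet> v\<bar>) = \<bar>c\<bar> * (SUP k. \<bar>g k p \<bullet> (inverse c *\<^sub>R c *\<^sub>R v)\<bar>)" using False by simp
        also have "\<dots> \<le> \<bar>c\<bar> * (\<bar>inverse c\<bar> * (SUP k. \<bar>g k p \<bullet> (c *\<^sub>R v)\<bar>))" by (intro mult_left_mono le) simp
        also have "\<dots> = (SUP k. \<bar>g k p \<bullet> (c *\<^sub>R v)\<bar>)" using False by (simp add: abs_inverse)
        finally show ?thesis using le[of c v] by simp
      qed simp
      show "(SUP k. \<bar>g k p \<bullet> (v + w)\<bar>) \<le> (SUP k. \<bar>g k p \<bullet> v\<bar>) + (SUP k. \<bar>g k p \<bullet> w\<bar>)" for v w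
      proof (rule cSUP_least)
        fix k
        show "\<bar>g k p \<bullet> (v + w)\<bar> \<le> (SUP k. \<bar>g k p \<bullet> v\<bar>) + (SUP k. \<bar>g k p \<bullet> w\<bar>)"
          using up[of k v] up[of k w] by (simp add: inner_add_right)
      qed simp
    qed
    have "((\<lambda>y. (dist (f y) (f p) - (SUP k. \<bar>g k p \<bullet> (y - p)\<bar>)) / norm (y - p)) \<longlongrightarrow> 0) (at p within A)"
    proof (rule tendstoI)
      fix e :: real assume "e > 0"
      then obtain d where d: "d > 0" "\<And>h. norm h < d \<Longrightarrow>
          \<bar>(SUP k. \<bar>u k (p + h) - u k p\<bar>) - (SUP k. \<bar>g k p \<bullet> h\<bar>)\<bar> \<le> e / 2 * norm h"
        using sup[OF pN(1), of "e / 2"] by auto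
      show "\<forall>\<^sub>F y in at p within A. dist ((dist (f y) (f p) - (SUP k. \<bar>g k p \<bullet> (y - p)\<bar>)) / norm (y - p)) 0 < e"
        unfolding eventually_at
      proof (intro exI[of _ d] conjI ballI impI)
        fix y assume y: "y \<in> A" "y \<noteq> p \<and> dist y p < d"
        then have "norm (y - p) > 0" "norm (y - p) < d" by (auto simp: dist_norm)
        then have "\<bar>dist (f y) (f p) - (SUP k. \<bar>g k p \<bullet> (y - p)\<bar>)\<bar> \<le> e / 2 * norm (y - p)"
          using d(2)[of "y - p"] by (simp add: distf[OF pN(2) y(1)])
        also have "\<dots> < e * norm (y - p)" using \<open>e > 0\<close> \<open>norm (y - p) > 0\<close> by simp
        finally show "dist ((dist (f y) (f p) - (SUP k. \<bar>g k p \<bullet> (y - p)\<bar>)) / norm (y - p)) 0 < e"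
          using \<open>norm (y - p) > 0\<close> by (simp add: dist_real_def abs_divide pos_divide_less_eq)
      qed (rule d(1))
    qed
    then show ?thesis
      unfolding has_approx_metric_differential_def using pN semi A(1) by blast
  qed
  then show ?thesis
    using that[of u a N g] u uA N der unfolding N_def by blast
qed

text \<open>The kernel of the seminorm is the orthogonal complement of the vectors
  \<open>g k\<close>, so its rank is the dimension of their span.\<close>

lemma seminorm_rank_imp_independent:
  fixes g :: "nat \<Rightarrow> 'a::euclidean_space"
  assumes bdd: "\<And>v. bdd_above (range (\<lambda>k. \<bar>g k \<bullet> v\<bar>))"
    and rank: "m \<le> seminorm_rank (\<lambda>v. SUP k. \<bar>g k \<bullet> v\<bar>)"
  obtains B where "B \<subseteq> range g" "independent B" "card B = m"
proof -
  have "{v. (SUP k. \<bar>g k \<bullet> v\<bar>) = 0} = {v. \<forall>x\<in>range g. orthogonal x v}"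
  proof (intro set_eqI iffI; clarsimp simp: orthogonal_def)
    fix v k assume "(SUP k. \<bar>g k \<bullet> v\<bar>) = 0"
    moreover have "\<bar>g k \<bullet> v\<bar> \<le> (SUP k. \<bar>g k \<bullet> v\<bar>)" by (intro cSUP_upper bdd) simp
    ultimately show "g k \<bullet> v = 0" by simp
  qed
  moreover have "dim {v. \<forall>x\<in>range g. orthogonal x v} + dim (range g) = DIM('a)"
  proof -
    have "{v. \<forall>x\<in>range g. orthogonal x v} = {y \<in> UNIV. \<forall>x \<in> span (range g). orthogonal x y}"
    proof (intro set_eqI iffI CollectI conjI ballI UNIV_I)
      fix v x assume "v \<in> {v. \<forall>x\<in>range g. orthogonal x v}" "x \<in> span (range g)"
      then have "orthogonal v x" by (intro orthogonal_to_span[of x "range g"]) (auto simp: orthogonal_commute)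
      then show "orthogonal x v" by (simp add: orthogonal_commute)
    next
      fix v x assume "v \<in> {y \<in> UNIV. \<forall>x \<in> span (range g). orthogonal x y}" "x \<in> range g"
      then show "orthogonal x v" using span_base by blast
    qed
    moreover have "dim {y \<in> UNIV. \<forall>x \<in> span (range g). orthogonal x y} + dim (span (range g)) = dim (UNIV::'a set)"
      by (rule dim_subspace_orthogonal_to_vectors[OF subspace_span subspace_UNIV subset_UNIV])
    ultimately show ?thesis by simp
  qed
  ultimately have "m \<le> dim (range g)" using rank unfolding seminorm_rank_def by simp
  moreover obtain B where B: "B \<subseteq> range g" "independent B" "card B = dim (range g)"
    by (rule basis_exists[of "range g"])
  ultimately obtain B' where "B' \<subseteq> B" "card B' = m" using obtain_subset_with_card_n by metis
  then show ?thesis using that[of B'] B independent_mono by blast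
qed

section \<open>Rectifying charts\<close>

text \<open>Inside each ball the measures of finitely many disjoint members sum to at most the
  volume of the ball, so only countably many of them are nonzero. This makes the family furnished by
  Zorn's lemma countable.\<close>

lemma countable_disjoint_nonnegligible:
  fixes \<K> :: "'a::euclidean_space set set"
  assumes dis: "pairwise disjnt \<K>" and K: "\<And>K. K \<in> \<K> \<Longrightarrow> compact K \<and> \<not> negligible K"
  shows "countable \<K>"
proof -
  have "countable {K\<in>\<K>. measure lebesgue (K \<inter> ball 0 (real n)) \<noteq> 0}" for n
  proof (rule summable_countable_real, rule nonneg_bdd_above_summable_on)
    show "bdd_above (sum (\<lambda>K. measure lebesgue (K \<inter> ball 0 (real n))) ` {F. F \<subseteq> \<K> \<and> finite F})"
    proof (rule bdd_aboveI2)
      fix F assume "F \<in> {F. F \<subseteq> \<K> \<and> finite F}"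
      then have F: "F \<subseteq> \<K>" "finite F" by auto
      have m: "K \<inter> ball 0 (real n) \<in> lmeasurable" if "K \<in> F" for K
        using K F(1) that by (intro fmeasurable_Int_fmeasurable) (auto simp: lmeasurable_compact)
      have "(\<Sum>K\<in>F. measure lebesgue (K \<inter> ball 0 (real n))) = measure lebesgue (\<Union>K\<in>F. K \<inter> ball 0 (real n))"
      proof (rule measure_UNION'[symmetric, OF F(2) m])
        show "pairwise (\<lambda>i j. disjnt (i \<inter> ball 0 (real n)) (j \<inter> ball 0 (real n))) F"
          using pairwise_subset[OF dis F(1)] unfolding pairwise_def disjnt_def by blast
      qed
      also have "\<dots> \<le> measure lebesgue (ball (0::'a) (real n))"
        using F(2) m by (intro measure_mono_fmeasurable sets.finite_UN) auto
      finally show "(\<Sum>K\<in>F. measure lebesgue (K \<inter> ball 0 (real n))) \<le> measure lebesgue (ball (0::'a) (real n))" .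
    qed
  qed simp
  then have "countable (\<Union>n. {K\<in>\<K>. measure lebesgue (K \<inter> ball 0 (real n)) \<noteq> 0})" by (intro countable_UN) auto
  moreover have "\<K> \<subseteq> (\<Union>n. {K\<in>\<K>. measure lebesgue (K \<inter> ball 0 (real n)) \<noteq> 0})"
  proof
    fix k assume k: "k \<in> \<K>"
    then have ck: "compact k" "\<not> negligible k" using K by auto
    obtain B where B: "\<And>x. x \<in> k \<Longrightarrow> norm x \<le> B" using compact_imp_bounded[OF ck(1)] bounded_iff by blast
    obtain n :: nat where "B < real n" using reals_Archimedean2 by blast
    then have "k \<inter> ball 0 (real n) = k" using B by force
    moreover have "measure lebesgue k \<noteq> 0"
      using ck lmeasurable_compact[OF ck(1)] negligible_iff_measure by blast
    ultimately show "k \<in> (\<Union>n. {K\<in>\<K>. measure lebesgue (K \<inter> ball 0 (real n)) \<noteq> 0})" using k by (intro UN_I[of n]) simp_all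
  qed
  ultimately show ?thesis by (rule countable_subset[rotated])
qed

text \<open>A maximal disjoint family of good compact sets must exhaust \<open>A\<close> up to a
  null set, since a nonnegligible remainder would contain another member.\<close>

lemma compact_exhaustion:
  fixes A :: "'a::euclidean_space set"
  assumes A: "A \<in> sets lebesgue"
    and good: "\<And>B. \<lbrakk>B \<in> sets lebesgue; B \<subseteq> A; \<not> negligible B\<rbrakk> \<Longrightarrow> \<exists>K. compact K \<and> K \<subseteq> B \<and> \<not> negligible K \<and> P K"
  obtains \<K> where "countable \<K>" "pairwise disjnt \<K>" "negligible (A - \<Union>\<K>)"
    "\<And>K. K \<in> \<K> \<Longrightarrow> compact K \<and> K \<subseteq> A \<and> \<not> negligible K \<and> P K"
proof -
  define \<FF> where "\<FF> = {\<K>. pairwise disjnt \<K> \<and> (\<forall>K\<in>\<K>. compact K \<and> K \<subseteq> A \<and> \<not> negligible K \<and> P K)}"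
  have "\<exists>M\<in>\<FF>. \<forall>X\<in>\<FF>. M \<subseteq> X \<longrightarrow> X = M"
  proof (rule subset_Zorn')
    fix C assume C: "subset.chain \<FF> C"
    then have "C \<subseteq> \<FF>" "chain\<^sub>\<subseteq> C" by (auto simp: subset.chain_def chain_subset_def)
    then show "\<Union>C \<in> \<FF>"
      unfolding \<FF>_def by (auto intro!: pairwise_chain_Union)
  qed
  then obtain \<K> where "\<K> \<in> \<FF>" and max: "\<And>X. X \<in> \<FF> \<Longrightarrow> \<K> \<subseteq> X \<Longrightarrow> X = \<K>" by blast
  then have dis: "pairwise disjnt \<K>" and K: "\<And>K. K \<in> \<K> \<Longrightarrow> compact K \<and> K \<subseteq> A \<and> \<not> negligible K \<and> P K"
    by (auto simp: \<FF>_def)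
  have count: "countable \<K>" by (rule countable_disjoint_nonnegligible[OF dis]) (use K in blast)
  have "negligible (A - \<Union>\<K>)"
  proof (rule ccontr)
    assume n: "\<not> negligible (A - \<Union>\<K>)"
    \<comment> \<open>Countability is needed already here: the hypothesis \<open>good\<close>
      applies to measurable remainders only.\<close>
    have "\<Union>\<K> \<in> sets lebesgue"
      using count K by (intro sets.countable_Union) (auto intro: fmeasurableD lmeasurable_compact)
    then have "A - \<Union>\<K> \<in> sets lebesgue" using A by auto
    then obtain k where k: "compact k" "k \<subseteq> A - \<Union>\<K>" "\<not> negligible k" "P k" using good[of "A - \<Union>\<K>"] n by blast
    have "insert k \<K> \<in> \<FF>"
      unfolding \<FF>_def using dis K k by (auto simp: pairwise_insert disjnt_def)
    then have "insert k \<K> = \<K>" by (rule max) blast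
    then have "k = {}" using k(2) by blast
    then show False using k(3) by simp
  qed
  then show ?thesis using that count dis K by blast
qed

section \<open>Selecting nonnegligible pieces\<close>

lemma nonnegligible_countable_piece:
  assumes "\<not> negligible S" "countable I" "S \<subseteq> (\<Union>i\<in>I. F i)"
  obtains i where "i \<in> I" "\<not> negligible (S \<inter> F i)"
proof -
  have "\<exists>i\<in>I. \<not> negligible (S \<inter> F i)"
  proof (rule ccontr)
    assume "\<not> ?thesis"
    then have "negligible (\<Union>i\<in>I. S \<inter> F i)" using assms(2) by (intro negligible_UN_countable) auto
    moreover have "S = (\<Union>i\<in>I. S \<inter> F i)" using assms(3) by blast
    ultimately show False using assms(1) by simp
  qed
  then show ?thesis using that by blast
qed

text \<open>Otherwise the values would be covered by balls with negligible preimages, and by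
  Lindelof countably many of them suffice. Neither \<open>S\<close> nor \<Phi> has to be measurable,
  which allows \<Phi> to be the tuple of gradients.\<close>

lemma nonnegligible_concentration_point:
  fixes \<Phi> :: "'a::euclidean_space \<Rightarrow> 'b::{metric_space, second_countable_topology}"
  assumes "\<not> negligible S"
  obtains p where "p \<in> S" "\<And>e. 0 < e \<Longrightarrow> \<not> negligible {q\<in>S. dist (\<Phi> q) (\<Phi> p) < e}"
proof (rule ccontr)
  assume "\<not> thesis"
  then have "\<forall>p\<in>S. \<exists>e>0. negligible {q\<in>S. dist (\<Phi> q) (\<Phi> p) < e}" using that by blast
  then obtain e where e: "\<And>p. p \<in> S \<Longrightarrow> 0 < e p" "\<And>p. p \<in> S \<Longrightarrow> negligible {q\<in>S. dist (\<Phi> q) (\<Phi> p) < e p}" by metis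
  obtain \<F> where \<F>: "\<F> \<subseteq> (\<lambda>p. ball (\<Phi> p) (e p)) ` S" "countable \<F>" "\<Union>\<F> = (\<Union>p\<in>S. ball (\<Phi> p) (e p))"
    by (rule Lindelof[of "(\<lambda>p. ball (\<Phi> p) (e p)) ` S"]) auto
  have "negligible (\<Union>U\<in>\<F>. {q\<in>S. \<Phi> q \<in> U})"
  proof (rule negligible_UN_countable[OF \<F>(2)])
    fix U assume "U \<in> \<F>"
    then obtain p where "p \<in> S" "U = ball (\<Phi> p) (e p)" using \<F>(1) by blast
    then show "negligible {q\<in>S. \<Phi> q \<in> U}" using e(2)[of p] by (simp add: dist_commute)
  qed
  moreover have "S \<subseteq> (\<Union>U\<in>\<F>. {q\<in>S. \<Phi> q \<in> U})"
  proof
    fix q assume q: "q \<in> S"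
    then have "\<Phi> q \<in> \<Union>\<F>" unfolding \<F>(3) using e(1) by (intro UN_I[of q]) auto
    then show "q \<in> (\<Union>U\<in>\<F>. {q\<in>S. \<Phi> q \<in> U})" using q by blast
  qed
  ultimately show False using assms negligible_subset by blast
qed

text \<open>The vectors \<open>c i\<close> are extended to a basis, and its members become the rows
  of \<Lambda>, the \<open>c i\<close> at the coordinates \<open>\<iota> i\<close>. A vector in the
  kernel is orthogonal to a basis, hence zero.\<close>

lemma linear_completion_of_independent:
  fixes \<iota> :: "'m::finite \<Rightarrow> 'n::finite" and c :: "'m \<Rightarrow> real ^ 'n"
  assumes \<iota>: "inj \<iota>" and c: "inj c" "independent (range c)"
  obtains \<Lambda> :: "real ^ 'n \<Rightarrow> real ^ 'n" where "linear \<Lambda>" "inj \<Lambda>" "\<And>i x. \<Lambda> x $ \<iota> i = c i \<bullet> x"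
proof -
  obtain B where B: "range c \<subseteq> B" "independent B" "UNIV \<subseteq> span B"
    by (rule maximal_independent_subset_extend[of "range c" UNIV]) (use c in auto)
  have fB: "finite B" using B(2) by (rule independent_imp_finite)
  have "card B = CARD('n)" using B by (metis basis_card_eq_dim dim_UNIV DIM_cart DIM_real mult.right_neutral subset_UNIV top.extremum_uniqueI)
  then have "card (B - range c) = card (- range \<iota>)"
    using B(1) c(1) \<iota> by (simp add: card_Diff_subset card_image Compl_eq_Diff_UNIV)
  then obtain b where b: "bij_betw b (- range \<iota>) (B - range c)"
    using finite_same_card_bij[of "- range \<iota>" "B - range c"] fB by auto
  define \<Lambda> where "\<Lambda> x = (\<chi> j. (if j \<in> range \<iota> then c (inv \<iota> j) else b j) \<bullet> x)" for x
  have lin: "linear \<Lambda>"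
    by (rule linearI) (auto simp: \<Lambda>_def vec_eq_iff inner_add_right)
  have \<Lambda>\<iota>: "\<Lambda> x $ \<iota> i = c i \<bullet> x" for i x using \<iota> by (simp add: \<Lambda>_def inv_f_f)
  have "x = 0" if "\<Lambda> x = 0" for x
  proof -
    have "y \<bullet> x = 0" if y: "y \<in> B" for y
    proof (cases "y \<in> range c")
      case True
      then obtain i where "y = c i" by blast
      then show ?thesis using \<Lambda>\<iota>[of x i] \<open>\<Lambda> x = 0\<close> by simp
    next
      case False
      then have "y \<in> b ` (- range \<iota>)" using y b by (simp add: bij_betw_def)
      then obtain j where j: "j \<in> - range \<iota>" "y = b j" by blast
      then have "\<Lambda> x $ j = b j \<bullet> x" by (simp add: \<Lambda>_def)
      then show ?thesis using j \<open>\<Lambda> x = 0\<close> by simp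
    qed
    moreover have "x \<in> span B" using B(3) by blast
    ultimately have "orthogonal x x"
      by (intro orthogonal_to_span[of x B]) (auto simp: orthogonal_def inner_commute)
    then show ?thesis by (simp add: orthogonal_def)
  qed
  then have "inj \<Lambda>" using linear_injective_0[OF lin] by blast
  then show ?thesis using that lin \<Lambda>\<iota> by blast
qed

text \<open>Source of the constant \<open>sqrt m\<close>: each coordinate of the map \<pi> is a
  distance function and hence 1-Lipschitz.\<close>

lemma norm_le_sqrt_card:
  fixes v :: "real ^ 'm::finite"
  assumes "\<And>i. \<bar>v $ i\<bar> \<le> b"
  shows "norm v \<le> sqrt (real CARD('m)) * b"
proof -
  have b: "b \<ge> 0" using assms[of undefined] by linarith
  have "norm v = sqrt (\<Sum>i\<in>UNIV. (v $ i)\<^sup>2)" by (simp add: norm_vec_def L2_set_def)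
  also have "\<dots> \<le> sqrt (\<Sum>i\<in>(UNIV::'m set). b\<^sup>2)"
    using assms b by (intro real_sqrt_le_mono sum_mono) (simp add: abs_le_square_iff[symmetric])
  also have "\<dots> = sqrt (real CARD('m)) * b" using b by (simp add: real_sqrt_mult)
  finally show ?thesis .
qed

lemma dist_eq_dist_fst_part:
  fixes \<iota> :: "'m::finite \<Rightarrow> 'n::finite"
  assumes \<iota>: "inj \<iota>" and uv: "snd_part \<iota> u = snd_part \<iota> v"
  shows "dist u v = dist (fst_part \<iota> u) (fst_part \<iota> v)"
proof -
  have "u $ j = v $ j" if "j \<notin> range \<iota>" for j
    using arg_cong[OF uv, of "\<lambda>w. w $ j"] that by (simp add: snd_part_def)
  then have "(\<Sum>j\<in>UNIV. (u $ j - v $ j)\<^sup>2) = (\<Sum>j\<in>range \<iota>. (u $ j - v $ j)\<^sup>2)"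
    by (intro sum.mono_neutral_right) auto
  also have "\<dots> = (\<Sum>i\<in>UNIV. (u $ \<iota> i - v $ \<iota> i)\<^sup>2)" using \<iota> by (simp add: sum.reindex)
  finally show ?thesis by (simp add: dist_norm norm_vec_def L2_set_def fst_part_def)
qed

text \<open>The requirements on \<open>G\<close> and \<pi> together with (B), (C) and (D), worded as
  in the final theorem so that unfolding produces its goal.\<close>

definition rectifying_chart ::
    "('m::finite \<Rightarrow> 'n::finite) \<Rightarrow> (real ^ 'n \<Rightarrow> 'x::metric_space) \<Rightarrow> (real ^ 'n) set \<Rightarrow>
      (real ^ 'n \<Rightarrow> real ^ 'n) \<Rightarrow> ('x \<Rightarrow> real ^ 'm) \<Rightarrow> bool" where
  "rectifying_chart \<iota> f K G \<pi> \<longleftrightarrow>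
     C1_diffeomorphism G \<and>
     (sqrt (real CARD('m)))-lipschitz_on UNIV \<pi> \<and>
     (let F = f \<circ> inv G in
        (\<forall>z \<in> G ` K. (\<pi> \<circ> F) z = fst_part \<iota> z) \<and>
        (\<forall>z \<in> G ` K. F -` {F z} \<inter> G ` K \<subseteq> {w. fst_part \<iota> w = fst_part \<iota> z}) \<and>
        (\<exists>L. \<forall>y. bilipschitz_on L ({w. snd_part \<iota> w = y} \<inter> G ` K) F))"

text \<open>The hypothesis \<open>fst\<close> is (B) in the original coordinates, and (C) follows
  from it at once. On a slice with fixed second part, distances equal those of the first parts,
  which \<pi> reads off from \<open>F\<close>: this is the lower bound in (D). The upper bound
  composes the Lipschitz bounds of \<open>f\<close> and \<open>inv G\<close>; neither involves
  \<open>y\<close>.\<close>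

lemma rectifying_chartI:
  fixes \<iota> :: "'m::finite \<Rightarrow> 'n::finite" and \<pi> :: "'x::metric_space \<Rightarrow> real ^ 'm"
  assumes \<iota>: "inj \<iota>" and G: "C1_diffeomorphism G" and Ginv: "C-lipschitz_on UNIV (inv G)"
    and \<pi>: "(sqrt (real CARD('m)))-lipschitz_on UNIV \<pi>" and f: "L-lipschitz_on K f"
    and fst: "\<And>x. x \<in> K \<Longrightarrow> \<pi> (f x) = fst_part \<iota> (G x)"
  shows "rectifying_chart \<iota> f K G \<pi>"
proof -
  define F where "F = f \<circ> inv G"
  have injG: "inj G" using G by (simp add: C1_diffeomorphism_def bij_def)
  have FG: "F (G x) = f x" for x using injG by (simp add: F_def)
  have B: "\<pi> (F z) = fst_part \<iota> z" if "z \<in> G ` K" for z using that fst FG by auto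
  define M where "M = max 1 (max (sqrt (real CARD('m))) (L * C))"
  have M: "1 \<le> M" "sqrt (real CARD('m)) \<le> M" "L * C \<le> M" by (auto simp: M_def)
  have "bilipschitz_on M ({w. snd_part \<iota> w = y} \<inter> G ` K) F" for y
    unfolding bilipschitz_on_def
  proof (intro conjI ballI M(1))
    fix u v assume u: "u \<in> {w. snd_part \<iota> w = y} \<inter> G ` K" and v: "v \<in> {w. snd_part \<iota> w = y} \<inter> G ` K"
    have "dist u v = dist (fst_part \<iota> u) (fst_part \<iota> v)" using u v \<iota> by (intro dist_eq_dist_fst_part) auto
    also have "\<dots> = dist (\<pi> (F u)) (\<pi> (F v))" using B u v by simp
    also have "\<dots> \<le> sqrt (real CARD('m)) * dist (F u) (F v)" using lipschitz_onD[OF \<pi>] by simp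
    also have "\<dots> \<le> M * dist (F u) (F v)" using M(2) by (rule mult_right_mono) simp
    finally show "dist u v / M \<le> dist (F u) (F v)" using M(1) by (simp add: pos_divide_le_eq mult.commute)
    have "inv G u \<in> K" "inv G v \<in> K" using u v injG by auto
    then have "dist (F u) (F v) \<le> L * dist (inv G u) (inv G v)"
      unfolding F_def o_def using f by (intro lipschitz_onD)
    also have "\<dots> \<le> L * (C * dist u v)"
      using lipschitz_onD[OF Ginv] lipschitz_on_nonneg[OF f] by (intro mult_left_mono) auto
    also have "\<dots> \<le> M * dist u v" using mult_right_mono[OF M(3), of "dist u v"] by (simp add: mult.assoc)
    finally show "dist (F u) (F v) \<le> M * dist u v" .
  qed
  moreover have "F -` {F z} \<inter> G ` K \<subseteq> {w. fst_part \<iota> w = fst_part \<iota> z}" if "z \<in> G ` K" for z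
  proof
    fix w assume "w \<in> F -` {F z} \<inter> G ` K"
    then have "F w = F z" "w \<in> G ` K" by auto
    then show "w \<in> {w. fst_part \<iota> w = fst_part \<iota> z}" using B[of w] B[of z] that by simp
  qed
  ultimately show ?thesis
    unfolding rectifying_chart_def Let_def F_def[symmetric] using G \<pi> B by auto
qed

text \<open>The correction acts only on the coordinates selected by \<iota>. The factor
  \<open>CARD('m)\<close> is the crude triangle inequality over the summands, each bounded by the
  mean value theorem.\<close>

lemma C1_map_sum_axis:
  fixes \<iota> :: "'m::finite \<Rightarrow> 'n::finite" and g :: "'m \<Rightarrow> real ^ 'n \<Rightarrow> real"
  assumes der: "\<And>i x. (g i has_derivative (\<lambda>h. H i x \<bullet> h)) (at x)" and cont: "\<And>i. continuous_on UNIV (H i)"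
    and bound: "\<And>i x. norm (H i x) \<le> B"
  shows "C1_map (\<lambda>x. \<Sum>i\<in>UNIV. g i x *\<^sub>R (axis (\<iota> i) 1 :: real ^ 'n))"
    and "(real CARD('m) * B)-lipschitz_on UNIV (\<lambda>x. \<Sum>i\<in>UNIV. g i x *\<^sub>R (axis (\<iota> i) 1 :: real ^ 'n))"
proof -
  define \<eta>' where "\<eta>' x = (\<Sum>i\<in>UNIV. blinfun_scaleR_left (axis (\<iota> i) 1 :: real ^ 'n) o\<^sub>L blinfun_inner_right (H i x))" for x
  have app: "blinfun_apply (\<eta>' x) = (\<lambda>h. \<Sum>i\<in>UNIV. (H i x \<bullet> h) *\<^sub>R axis (\<iota> i) 1)" for x
    by (simp add: \<eta>'_def fun_eq_iff blinfun.sum_left)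
  have "((\<lambda>x. \<Sum>i\<in>UNIV. g i x *\<^sub>R (axis (\<iota> i) 1 :: real ^ 'n)) has_derivative blinfun_apply (\<eta>' x)) (at x)" for x
    unfolding app by (intro has_derivative_sum has_derivative_scaleR_left der)
  moreover have "continuous_on UNIV \<eta>'"
    unfolding \<eta>'_def
    by (intro continuous_on_sum bounded_bilinear.continuous_on[OF bounded_bilinear_blinfun_compose] continuous_on_const bounded_linear.continuous_on[OF bounded_linear_blinfun_inner_right] cont)
  ultimately show "C1_map (\<lambda>x. \<Sum>i\<in>UNIV. g i x *\<^sub>R (axis (\<iota> i) 1 :: real ^ 'n))"
    unfolding C1_map_def by blast
  have B: "B \<ge> 0" using bound[of undefined undefined] norm_ge_zero order_trans by blast
  show "(real CARD('m) * B)-lipschitz_on UNIV (\<lambda>x. \<Sum>i\<in>UNIV. g i x *\<^sub>R (axis (\<iota> i) 1 :: real ^ 'n))"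
  proof (rule lipschitz_onI)
    fix x y
    have gl: "norm (g i x - g i y) \<le> B * norm (x - y)" for i
      by (rule differentiable_bound[where S = UNIV and f' = "\<lambda>x h. H i x \<bullet> h"])
        (use der onorm_inner_le bound order_trans in \<open>auto, blast\<close>)
    have "dist (\<Sum>i\<in>UNIV. g i x *\<^sub>R (axis (\<iota> i) 1 :: real ^ 'n)) (\<Sum>i\<in>UNIV. g i y *\<^sub>R axis (\<iota> i) 1)
      = norm (\<Sum>i\<in>UNIV. (g i x - g i y) *\<^sub>R (axis (\<iota> i) 1 :: real ^ 'n))"
      by (simp add: dist_norm sum_subtractf scaleR_diff_left)
    also have "\<dots> \<le> (\<Sum>i\<in>(UNIV::'m set). B * norm (x - y))"
      by (rule sum_norm_le) (use gl in simp)
    also have "\<dots> = real CARD('m) * B * dist x y" by (simp add: dist_norm)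
    finally show "dist (\<Sum>i\<in>UNIV. g i x *\<^sub>R (axis (\<iota> i) 1 :: real ^ 'n)) (\<Sum>i\<in>UNIV. g i y *\<^sub>R axis (\<iota> i) 1)
      \<le> real CARD('m) * B * dist x y" .
  qed (use B in simp)
qed

lemma lusin_C1_finite_family:
  fixes w :: "'m::finite \<Rightarrow> 'a::euclidean_space \<Rightarrow> real"
  assumes w: "\<And>i. \<epsilon>-lipschitz_on UNIV (w i)" and "0 < \<epsilon>" and E: "E \<in> lmeasurable" "\<not> negligible E" "bounded E"
  obtains g H K where "\<And>i x. (g i has_derivative (\<lambda>h. H i x \<bullet> h)) (at x)" "\<And>i. continuous_on UNIV (H i)"
    "\<And>i x. norm (H i x) \<le> 2 * \<epsilon>" "compact K" "K \<subseteq> E" "\<not> negligible K" "\<And>i x. x \<in> K \<Longrightarrow> g i x = w i x"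
proof -
  have ME: "measure lebesgue E > 0"
    using E negligible_iff_measure zero_less_measure_iff by blast
  \<comment> \<open>The \<open>CARD('m)\<close> exceptional sets together then take away at most
    half of \<open>E\<close>.\<close>
  define \<eta> where "\<eta> = measure lebesgue E / (2 * real CARD('m))"
  have \<eta>: "\<eta> > 0" using ME by (simp add: \<eta>_def)
  let ?R = "\<lambda>i g H F. (\<forall>x. (g has_derivative (\<lambda>h. H x \<bullet> h)) (at x)) \<and> continuous_on UNIV H \<and> (\<forall>x. norm (H x) \<le> 2 * \<epsilon>) \<and>
    F \<subseteq> E \<and> F \<in> lmeasurable \<and> measure lebesgue (E - F) \<le> \<eta> \<and> (\<forall>x\<in>F. g x = w i x)"
  have "\<exists>g H F. ?R i g H F" for i
    by (rule lipschitz_lusin_C1[OF w[of i] \<open>0 < \<epsilon>\<close> E(1) \<eta>]) blast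
  then obtain g H F where R: "\<And>i. ?R i (g i) (H i) (F i)" by metis
  define F0 where "F0 = (\<Inter>i. F i)"
  have F: "F i \<in> lmeasurable" "F i \<subseteq> E" for i using R by auto
  have F0s: "F0 \<in> sets lebesgue" unfolding F0_def using F(1) by (intro sets.finite_INT) auto
  have F0E: "F0 \<subseteq> E" unfolding F0_def using F(2) by blast
  have F0m: "F0 \<in> lmeasurable" using F0E F0s E(1) by (rule fmeasurableI2[rotated 1])
  have "measure lebesgue (E - F0) \<le> measure lebesgue E / 2"
  proof -
    have "E - F0 = (\<Union>i. E - F i)" by (auto simp: F0_def)
    moreover have "measure lebesgue (\<Union>i. E - F i) \<le> (\<Sum>i\<in>UNIV. measure lebesgue (E - F i))"
      by (rule measure_UNION_le) (use E(1) F(1) in \<open>auto intro!: sets.Diff dest: fmeasurableD\<close>)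
    ultimately have "measure lebesgue (E - F0) \<le> (\<Sum>i\<in>UNIV. measure lebesgue (E - F i))" by (simp only:)
    also have "\<dots> \<le> (\<Sum>i\<in>(UNIV::'m set). \<eta>)" using R by (intro sum_mono) blast
    also have "\<dots> = measure lebesgue E / 2" by (simp add: \<eta>_def)
    finally show ?thesis .
  qed
  moreover have "measure lebesgue (E - F0) = measure lebesgue E - measure lebesgue F0"
    using F0E F0s E(1) F0m by (intro measurable_measure_Diff) auto
  ultimately have MF: "measure lebesgue F0 > 0" using ME by linarith
  obtain K where K: "closed K" "K \<subseteq> F0" "F0 - K \<in> lmeasurable" "emeasure lebesgue (F0 - K) < ennreal (measure lebesgue F0)"
    by (rule sets_lebesgue_inner_closed[OF F0s MF]) (rule that)
  have "compact K" using K(1,2) F0E E(3) bounded_subset by (metis compact_eq_bounded_closed order_trans)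
  moreover have "\<not> negligible K"
  proof
    assume "negligible K"
    then have "K \<in> null_sets lebesgue" by (simp add: negligible_iff_null_sets)
    then have "emeasure lebesgue (F0 - K) = emeasure lebesgue F0" using F0s by (simp add: emeasure_Diff_null_set)
    then show False using K(4) F0m by (simp add: emeasure_eq_measure2)
  qed
  moreover have "K \<subseteq> E" using K(2) F0E by blast
  ultimately show ?thesis
    using that[of g H K] R K(2) unfolding F0_def by blast
qed

text \<open>Splitting by the radius at which differentiability takes effect and by small balls gives
  countably many parts, one of which is not negligible. On it the expansion error and the distance
  of the gradient from \<open>c i\<close> each contribute \<open>\<epsilon> / 2\<close>.\<close>

lemma lipschitz_almost_linear_piece:
  fixes u :: "'m::finite \<Rightarrow> real ^ 'n::finite \<Rightarrow> real"
  assumes S: "\<not> negligible S" and "0 < \<epsilon>" 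
    and der: "\<And>i p. p \<in> S \<Longrightarrow> (u i has_derivative (\<lambda>h. g i p \<bullet> h)) (at p)"
    and near: "\<And>i p. p \<in> S \<Longrightarrow> norm (g i p - c i) \<le> \<epsilon> / 2"
  obtains T where "T \<subseteq> S" "\<not> negligible T" "bounded T" "\<And>i. \<epsilon>-lipschitz_on T (\<lambda>x. u i x - c i \<bullet> x)"
proof -
  define Q where "Q j = {p. \<forall>i h. norm h < 1 / real (Suc j) \<longrightarrow> \<bar>u i (p + h) - u i p - g i p \<bullet> h\<bar> \<le> \<epsilon> / 2 * norm h}" for j
  have "S \<subseteq> (\<Union>j\<in>UNIV. Q j)"
  proof
    fix p assume p: "p \<in> S"
    have "\<forall>i. \<exists>d>0. \<forall>y. norm (y - p) < d \<longrightarrow> norm (u i y - u i p - g i p \<bullet> (y - p)) \<le> \<epsilon> / 2 * norm (y - p)"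
    proof
      fix i
      have "\<forall>e>0. \<exists>d>0. \<forall>y. norm (y - p) < d \<longrightarrow> norm (u i y - u i p - g i p \<bullet> (y - p)) \<le> e * norm (y - p)"
        using der[OF p, of i] unfolding has_derivative_at_alt by (rule conjunct2)
      then show "\<exists>d>0. \<forall>y. norm (y - p) < d \<longrightarrow> norm (u i y - u i p - g i p \<bullet> (y - p)) \<le> \<epsilon> / 2 * norm (y - p)"
        using half_gt_zero[OF \<open>0 < \<epsilon>\<close>] by blast
    qed
    then obtain d where d: "\<And>i. 0 < d i" "\<And>i y. norm (y - p) < d i \<Longrightarrow> norm (u i y - u i p - g i p \<bullet> (y - p)) \<le> \<epsilon> / 2 * norm (y - p)" by metis
    have "0 < Min (range d)" using d(1) by simp
    then obtain j where j: "1 / real (Suc j) < Min (range d)" by (rule nat_approx_posE)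
    have "p \<in> Q j"
      unfolding Q_def
    proof (intro CollectI allI impI)
      fix i and h :: "real ^ 'n" assume "norm h < 1 / real (Suc j)"
      moreover have "Min (range d) \<le> d i" by simp
      ultimately have "norm h < d i" using j by linarith
      then show "\<bar>u i (p + h) - u i p - g i p \<bullet> h\<bar> \<le> \<epsilon> / 2 * norm h" using d(2)[of "p + h" i] by simp
    qed
    then show "p \<in> (\<Union>j\<in>UNIV. Q j)" by blast
  qed
  then obtain j where j: "\<not> negligible (S \<inter> Q j)"
    by (rule nonnegligible_countable_piece[OF S countableI_type])
  \<comment> \<open>Two points of a ball of radius \<open>r\<close> are then closer than the radius
    \<open>1 / real (Suc j)\<close> in \<open>Q j\<close>.\<close>
  define r where "r = 1 / real (Suc j) / 2"
  have r: "r > 0" "r + r = 1 / real (Suc j)" unfolding r_def by (simp, rule field_sum_of_halves)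
  define D where "D = {v::real ^ 'n. \<forall>b\<in>Basis. v \<bullet> b \<in> \<rat>}"
  have D: "countable D" "closure D = UNIV"
    unfolding D_def by (rule countable_rational_vectors closure_rational_vectors)+
  have "S \<inter> Q j \<subseteq> (\<Union>v\<in>D. ball v r)"
  proof
    fix x assume "x \<in> S \<inter> Q j"
    have "x \<in> closure D" using D(2) by simp
    then obtain v where "v \<in> D" "dist v x < r" using closure_approachable r(1) by metis
    then show "x \<in> (\<Union>v\<in>D. ball v r)" by auto
  qed
  then obtain v where v: "\<not> negligible (S \<inter> Q j \<inter> ball v r)"
    by (rule nonnegligible_countable_piece[OF j D(1)])
  show ?thesis
  proof (rule that[OF _ v])
    show "bounded (S \<inter> Q j \<inter> ball v r)" using bounded_ball bounded_subset by blast
    fix i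
    show "\<epsilon>-lipschitz_on (S \<inter> Q j \<inter> ball v r) (\<lambda>x. u i x - c i \<bullet> x)"
    proof (rule lipschitz_onI)
      fix x y assume x: "x \<in> S \<inter> Q j \<inter> ball v r" and y: "y \<in> S \<inter> Q j \<inter> ball v r"
      have "dist y x < r + r" using x y dist_triangle[of y x v] by (simp add: dist_commute)
      then have "norm (y - x) < 1 / real (Suc j)" using r(2) by (simp add: dist_norm)
      then have "\<bar>u i (x + (y - x)) - u i x - g i x \<bullet> (y - x)\<bar> \<le> \<epsilon> / 2 * norm (y - x)"
        using x unfolding Q_def by blast
      then have "\<bar>u i y - u i x - g i x \<bullet> (y - x)\<bar> \<le> \<epsilon> / 2 * norm (y - x)" by simp
      moreover have "\<bar>(g i x - c i) \<bullet> (y - x)\<bar> \<le> norm (g i x - c i) * norm (y - x)" by (rule Cauchy_Schwarz_ineq2)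
      moreover have "norm (g i x - c i) * norm (y - x) \<le> \<epsilon> / 2 * norm (y - x)"
        using near[of x i] x by (intro mult_right_mono) auto
      moreover have "(u i x - c i \<bullet> x) - (u i y - c i \<bullet> y) = - (u i y - u i x - g i x \<bullet> (y - x)) - (g i x - c i) \<bullet> (y - x)"
        by (simp add: inner_diff_left inner_diff_right)
      ultimately show "dist (u i x - c i \<bullet> x) (u i y - c i \<bullet> y) \<le> \<epsilon> * dist x y"
        unfolding dist_real_def dist_norm norm_minus_commute[of x y] by linarith
    qed (use \<open>0 < \<epsilon>\<close> in simp)
  qed blast
qed

text \<open>The set \<open>S\<close> is only known to be nonnegligible. The gradients are frozen at
  a concentration point, which provides both the linear isomorphism and a nonnegligible set where
  the gradients stay close to its rows.\<close>

lemma exists_rectifying_chart: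
  fixes \<iota> :: "'m::finite \<Rightarrow> 'n::finite" and f :: "real ^ 'n \<Rightarrow> 'x::metric_space"
  assumes \<iota>: "inj \<iota>" and f: "L-lipschitz_on A f" and B: "B \<in> sets lebesgue" "B \<subseteq> A"
    and u: "\<And>i::'m. M-lipschitz_on UNIV (u i)" "\<And>i p. p \<in> A \<Longrightarrow> u i p = dist (f p) (z i)"
    and S: "S \<subseteq> B" "\<not> negligible S"
    and der: "\<And>i p. p \<in> S \<Longrightarrow> (u i has_derivative (\<lambda>h. g i p \<bullet> h)) (at p)"
    and indep: "\<And>p. p \<in> S \<Longrightarrow> inj (\<lambda>i. g i p)" "\<And>p. p \<in> S \<Longrightarrow> independent (range (\<lambda>i. g i p))"
  obtains K G and \<pi> :: "'x \<Rightarrow> real ^ 'm"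
  where "compact K" "K \<subseteq> B" "\<not> negligible K" "rectifying_chart \<iota> f K G \<pi>"
proof -
  let ?m = "real CARD('m)"
  define \<Phi> where "\<Phi> p = (\<chi> i. g i p)" for p
  obtain p0 where p0: "p0 \<in> S" "\<And>e. 0 < e \<Longrightarrow> \<not> negligible {q\<in>S. dist (\<Phi> q) (\<Phi> p0) < e}"
    by (rule nonnegligible_concentration_point[OF S(2), of \<Phi>]) (rule that)
  define c where "c i = g i p0" for i
  obtain \<Lambda> :: "real ^ 'n \<Rightarrow> real ^ 'n" where \<Lambda>: "linear \<Lambda>" "inj \<Lambda>" "\<And>i x. \<Lambda> x $ \<iota> i = c i \<bullet> x"
    by (rule linear_completion_of_independent[OF \<iota> indep[OF p0(1)]]) (use that in \<open>auto simp: c_def\<close>)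
  obtain b where b: "b > 0" "\<And>x. b * norm x \<le> norm (\<Lambda> x)"
    by (rule linear_inj_bounded_below_pos[OF \<Lambda>(1,2)]) (rule that)
  \<comment> \<open>The correction will have Lipschitz constant
    \<open>?m * (2 * \<epsilon>) = b / 2\<close>, below the lower bound \<open>b\<close> of
    \<Lambda>; the \<open>2\<close> comes from the Lusin theorem.\<close>
  define \<epsilon> where "\<epsilon> = b / (4 * ?m)"
  have \<epsilon>: "\<epsilon> > 0" "?m * (2 * \<epsilon>) < b" using b(1) by (auto simp: \<epsilon>_def)
  define S1 where "S1 = {q\<in>S. dist (\<Phi> q) (\<Phi> p0) < \<epsilon> / 2}"
  have S1: "\<not> negligible S1" unfolding S1_def using \<epsilon>(1) by (intro p0(2)) simp
  obtain T where T: "T \<subseteq> S1" "\<not> negligible T" "bounded T" "\<And>i. \<epsilon>-lipschitz_on T (\<lambda>x. u i x - c i \<bullet> x)"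
  proof (rule lipschitz_almost_linear_piece[OF S1 \<epsilon>(1), of u g c])
    show "(u i has_derivative (\<lambda>h. g i p \<bullet> h)) (at p)" if "p \<in> S1" for i p using der that by (simp add: S1_def)
    show "norm (g i p - c i) \<le> \<epsilon> / 2" if "p \<in> S1" for i p
      using dist_vec_nth_le[of "\<Phi> p" i "\<Phi> p0"] that by (simp add: S1_def \<Phi>_def c_def dist_norm)
  qed (rule that)
  have uc: "continuous_on UNIV (u i)" for i using u(1) by (rule lipschitz_on_continuous_on)
  have "\<epsilon>-lipschitz_on (closure T) (\<lambda>x. u i x - c i \<bullet> x)" for i
    by (rule lipschitz_on_closure[OF T(4)]) (intro continuous_intros continuous_on_subset[OF uc] subset_UNIV)
  then have "\<exists>w. \<epsilon>-lipschitz_on UNIV w \<and> (\<forall>x\<in>closure T. w x = u i x - c i \<bullet> x)" for i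
    by (rule mcshane_extension) blast
  then obtain w where w: "\<And>i. \<epsilon>-lipschitz_on UNIV (w i)" "\<And>i x. x \<in> closure T \<Longrightarrow> w i x = u i x - c i \<bullet> x" by metis
  \<comment> \<open>Restores measurability: \<open>E\<close> is measurable, contains
    \<open>T\<close> and lies in \<open>B\<close>, and the small Lipschitz bound still holds on it
    by continuity.\<close>
  define E where "E = closure T \<inter> B"
  have "bounded E" using T(3) bounded_closure bounded_subset unfolding E_def by blast
  moreover have "E \<in> sets lebesgue" unfolding E_def using B(1) by auto
  ultimately have E: "E \<in> lmeasurable" "bounded E" by (auto intro: bounded_set_imp_lmeasurable)
  have "T \<subseteq> E" unfolding E_def using T(1) S(1) closure_subset[of T] by (auto simp: S1_def)
  then have nE: "\<not> negligible E" using T(2) negligible_subset by blast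
  obtain g' H K where g': "\<And>i x. (g' i has_derivative (\<lambda>h. H i x \<bullet> h)) (at x)" "\<And>i. continuous_on UNIV (H i)"
    "\<And>i x. norm (H i x) \<le> 2 * \<epsilon>" and K: "compact K" "K \<subseteq> E" "\<not> negligible K" and g'w: "\<And>i x. x \<in> K \<Longrightarrow> g' i x = w i x"
    by (rule lusin_C1_finite_family[OF w(1) \<epsilon>(1) E(1) nE E(2)]) (rule that)
  \<comment> \<open>On \<open>K\<close> this adds to the linear form \<open>c i\<close> exactly what
    it lacks to equal \<open>u i\<close>, the distance to \<open>z i\<close>.\<close>
  define \<eta> where "\<eta> x = (\<Sum>i\<in>UNIV. g' i x *\<^sub>R (axis (\<iota> i) 1 :: real ^ 'n))" for x
  have \<eta>: "C1_map \<eta>" "(?m * (2 * \<epsilon>))-lipschitz_on UNIV \<eta>"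
    unfolding \<eta>_def by (rule C1_map_sum_axis[OF g'])+
  define G where "G x = \<Lambda> x + \<eta> x" for x
  have G: "C1_diffeomorphism G" "(1 / (b - ?m * (2 * \<epsilon>)))-lipschitz_on UNIV (inv G)"
    unfolding G_def[abs_def] using C1_map_perturbation_diffeomorphism[OF \<Lambda>(1) b(2) \<eta> \<epsilon>(2)] .
  define \<pi> :: "'x \<Rightarrow> real ^ 'm" where "\<pi> y = (\<chi> i. dist y (z i))" for y
  have "(sqrt ?m)-lipschitz_on UNIV \<pi>"
  proof (rule lipschitz_onI)
    fix x y
    show "dist (\<pi> x) (\<pi> y) \<le> sqrt ?m * dist x y"
      unfolding dist_norm
    proof (rule norm_le_sqrt_card)
      show "\<bar>(\<pi> x - \<pi> y) $ i\<bar> \<le> dist x y" for i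
        using abs_dist_diff_le[of x "z i" y] by (simp add: \<pi>_def dist_commute)
    qed
  qed simp
  moreover have "\<pi> (f x) = fst_part \<iota> (G x)" if x: "x \<in> K" for x
  proof (rule vec_eq_iff[THEN iffD2], rule allI)
    fix i
    have xT: "x \<in> closure T" "x \<in> A" using x K(2) B(2) by (auto simp: E_def)
    have "\<eta> x $ \<iota> i = (\<Sum>k\<in>UNIV. if k = i then g' k x else 0)"
      unfolding \<eta>_def sum_component
      by (rule sum.cong) (use \<iota> in \<open>auto simp: axis_def inj_eq\<close>)
    then have "\<eta> x $ \<iota> i = g' i x" by simp
    then have "G x $ \<iota> i = c i \<bullet> x + g' i x" by (simp add: G_def \<Lambda>(3))
    also have "\<dots> = dist (f x) (z i)" using g'w[OF x] w(2)[OF xT(1)] u(2)[OF xT(2)] by simp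
    finally show "\<pi> (f x) $ i = fst_part \<iota> (G x) $ i" by (simp add: \<pi>_def fst_part_def)
  qed
  moreover have KB: "K \<subseteq> B" using K(2) by (auto simp: E_def)
  ultimately have "rectifying_chart \<iota> f K G \<pi>"
    using G \<iota> lipschitz_on_subset[OF f] B(2) by (intro rectifying_chartI[where L = L]) auto
  then show ?thesis using that K(1,3) KB by blast
qed

text \<open>If the image were null, the image of \<open>K\<close> under \<open>G\<close> would lie
  in the null cylinder over \<open>\<pi> (f A)\<close>. The inverse of \<open>G\<close> is
  differentiable and preserves null sets, so \<open>K\<close> would be negligible.\<close>

lemma not_negligible_hausdorff_image:
  fixes \<iota> :: "'m::finite \<Rightarrow> 'n::finite" and f :: "real ^ 'n \<Rightarrow> 'x::metric_space" and \<pi> :: "'x \<Rightarrow> real ^ 'm"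
  assumes \<iota>: "inj \<iota>" and K: "\<not> negligible K" "K \<subseteq> A" and chart: "rectifying_chart \<iota> f K G \<pi>"
  shows "hausdorff_measure (real CARD('m)) (f ` A) \<noteq> 0"
proof
  assume 0: "hausdorff_measure (real CARD('m)) (f ` A) = 0"
  have G: "C1_diffeomorphism G" and \<pi>: "(sqrt (real CARD('m)))-lipschitz_on UNIV \<pi>"
    and fst: "\<And>z. z \<in> G ` K \<Longrightarrow> \<pi> (f (inv G z)) = fst_part \<iota> z"
    using chart by (auto simp: rectifying_chart_def Let_def)
  have injG: "inj G" using G by (simp add: C1_diffeomorphism_def bij_def)
  have "negligible {z::real ^ 'n. fst_part \<iota> z \<in> \<pi> ` f ` A}"
    by (rule negligible_fst_part_preimage[OF \<iota> lipschitz_on_subset[OF \<pi> subset_UNIV] 0])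
  moreover have "G ` K \<subseteq> {z. fst_part \<iota> z \<in> \<pi> ` f ` A}"
  proof
    fix z assume z: "z \<in> G ` K"
    then have "inv G z \<in> A" using K(2) injG by auto
    then show "z \<in> {z. fst_part \<iota> z \<in> \<pi> ` f ` A}" using fst[OF z] by (metis (mono_tags, lifting) imageI mem_Collect_eq)
  qed
  ultimately have n: "negligible (G ` K)" by (rule negligible_subset)
  have "inv G differentiable_on (G ` K)"
    using G unfolding C1_diffeomorphism_def C1_map_def differentiable_on_def differentiable_def
    by (blast intro: has_derivative_at_withinI)
  then have "negligible (inv G ` (G ` K))"
    by (intro negligible_differentiable_image_negligible n) simp
  then show False using K(1) injG by (simp add: image_comp inv_o_cancel)
qed

theorem theorem5p10:
  fixes \<iota> :: "'m::finite \<Rightarrow> 'n::finite"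
    and A :: "(real ^ 'n) set"
    and f :: "real ^ 'n \<Rightarrow> 'x::metric_space"
  assumes "inj \<iota>"
    and "A \<in> sets lebesgue"
    and "emeasure lebesgue A > 0"
    and "\<exists>L. L-lipschitz_on A f"
    and "AE p in lebesgue. p \<in> A \<longrightarrow> seminorm_rank (md_a f A p) \<ge> CARD('m)"
  shows "hausdorff_measure (real CARD('m)) (f ` A) > 0 \<and>
    (\<exists>\<K> :: (real ^ 'n) set set.
       countable \<K> \<and> pairwise disjnt \<K> \<and> (\<forall>K\<in>\<K>. compact K \<and> K \<subseteq> A) \<and>
       hausdorff_measure (real CARD('n)) (A - \<Union>\<K>) = 0 \<and>
       (\<forall>K\<in>\<K>.
          hausdorff_measure (real CARD('n)) K > 0 \<and>
          (\<exists>(G :: real ^ 'n \<Rightarrow> real ^ 'n) (\<pi> :: 'x \<Rightarrow> real ^ 'm).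
             C1_diffeomorphism G \<and>
             (sqrt (real CARD('m)))-lipschitz_on UNIV \<pi> \<and>
             (let F = f \<circ> inv G in
                (\<forall>z \<in> G ` K. (\<pi> \<circ> F) z = fst_part \<iota> z) \<and>
                (\<forall>z \<in> G ` K. F -` {F z} \<inter> G ` K \<subseteq> {w. fst_part \<iota> w = fst_part \<iota> z}) \<and>
                (\<exists>L. \<forall>y. bilipschitz_on L ({w. snd_part \<iota> w = y} \<inter> G ` K) F)))))"
proof -
  obtain L where f: "L-lipschitz_on A f" using assms(4) by blast
  have nA: "\<not> negligible A"
  proof
    assume "negligible A"
    then have "A \<in> null_sets lebesgue" by (simp add: negligible_iff_null_sets)
    then show False using assms(3) by auto
  qed
  then have Ane: "A \<noteq> {}" by auto
  obtain a u g N where u: "\<And>k. L-lipschitz_on UNIV (u k)"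
    and uA: "\<And>k p. p \<in> A \<Longrightarrow> u k p = dist (f p) (f (a k))" and N: "negligible N"
    and der: "\<And>(k::nat) p. p \<notin> N \<Longrightarrow> (u k has_derivative (\<lambda>h. g k p \<bullet> h)) (at p)"
    and md: "\<And>p. p \<in> A - N \<Longrightarrow> has_approx_metric_differential f A p (\<lambda>v. SUP k. \<bar>g k p \<bullet> v\<bar>)"
    by (rule metric_differential_of_lipschitz[OF assms(2) Ane f]) (rule that)
  obtain N2 where N2: "N2 \<in> null_sets lebesgue" "{p \<in> space lebesgue. \<not> (p \<in> A \<longrightarrow> seminorm_rank (md_a f A p) \<ge> CARD('m))} \<subseteq> N2"
    using assms(5) unfolding eventually_ae_filter by blast
  have N12: "negligible (N \<union> N2)" using N negligible_iff_null_sets[THEN iffD2, OF N2(1)] by (rule negligible_Un)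
  \<comment> \<open>The choice \<kappa> of indices depends on the point; there are only countably
    many such choices, so one of them works on a nonnegligible part of any \<open>B\<close>.\<close>
  have sel: "\<exists>\<kappa>::'m \<Rightarrow> nat. inj (\<lambda>i. g (\<kappa> i) p) \<and> independent (range (\<lambda>i. g (\<kappa> i) p))" if p: "p \<in> A" "p \<notin> N \<union> N2" for p
  proof -
    have "CARD('m) \<le> seminorm_rank (md_a f A p)" using N2(2) p by auto
    then have rank: "CARD('m) \<le> seminorm_rank (\<lambda>v. SUP k. \<bar>g k p \<bullet> v\<bar>)"
      using md_a_eqI[OF md[of p]] p by simp
    have bg: "\<bar>g k p \<bullet> h\<bar> \<le> L * norm h" for k h
      using Cauchy_Schwarz_ineq2[of "g k p" h] mult_right_mono[OF lipschitz_norm_gradient_le[OF u der[of p k]], of "norm h"] p by simp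
    have bdd: "bdd_above (range (\<lambda>k. \<bar>g k p \<bullet> v\<bar>))" for v by (intro bdd_aboveI2[of _ _ "L * norm v"] bg)
    obtain B where B: "B \<subseteq> range (\<lambda>k. g k p)" "independent B" "card B = CARD('m)"
      by (rule seminorm_rank_imp_independent[OF bdd rank]) (rule that)
    obtain h :: "'m \<Rightarrow> real ^ 'n" where h: "bij_betw h UNIV B"
      using finite_same_card_bij[of "UNIV::'m set" B] B(3) independent_imp_finite[OF B(2)] by auto
    have "\<forall>i. \<exists>k. g k p = h i" using h B(1) by (metis bij_betwE UNIV_I imageE subsetD)
    then obtain \<kappa> where "\<And>i. g (\<kappa> i) p = h i" by metis
    then have "inj (\<lambda>i. g (\<kappa> i) p) \<and> independent (range (\<lambda>i. g (\<kappa> i) p))"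
      using h B(2) by (simp add: bij_betw_def)
    then show ?thesis by blast
  qed
  have piece: "\<exists>K. compact K \<and> K \<subseteq> B \<and> \<not> negligible K \<and> (\<exists>G (\<pi> :: 'x \<Rightarrow> real ^ 'm). rectifying_chart \<iota> f K G \<pi>)"
    if B: "B \<in> sets lebesgue" "B \<subseteq> A" "\<not> negligible B" for B
  proof -
    have nB: "\<not> negligible (B - (N \<union> N2))"
    proof
      assume "negligible (B - (N \<union> N2))"
      then have "negligible ((B - (N \<union> N2)) \<union> (N \<union> N2))" using N12 by (rule negligible_Un)
      then show False using B(3) negligible_subset by blast
    qed
    have "B - (N \<union> N2) \<subseteq> (\<Union>\<kappa>\<in>(UNIV::('m \<Rightarrow> nat) set). {p. inj (\<lambda>i. g (\<kappa> i) p) \<and> independent (range (\<lambda>i. g (\<kappa> i) p))})"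
      using sel B(2) by blast
    then obtain \<kappa> :: "'m \<Rightarrow> nat" where \<kappa>: "\<not> negligible ((B - (N \<union> N2)) \<inter> {p. inj (\<lambda>i. g (\<kappa> i) p) \<and> independent (range (\<lambda>i. g (\<kappa> i) p))})"
      by (rule nonnegligible_countable_piece[OF nB countableI_type])
    show ?thesis
      by (rule exists_rectifying_chart[OF assms(1) f B(1,2), of L "\<lambda>i. u (\<kappa> i)" "\<lambda>i. f (a (\<kappa> i))" _ "\<lambda>i. g (\<kappa> i)", OF u uA _ \<kappa>])
        (use der in auto)
  qed
  obtain \<K> where \<K>: "countable \<K>" "pairwise disjnt \<K>" "negligible (A - \<Union>\<K>)"
    and K: "\<And>K. K \<in> \<K> \<Longrightarrow> compact K \<and> K \<subseteq> A \<and> \<not> negligible K \<and> (\<exists>G (\<pi> :: 'x \<Rightarrow> real ^ 'm). rectifying_chart \<iota> f K G \<pi>)"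
    using compact_exhaustion[where P = "\<lambda>K. \<exists>G (\<pi> :: 'x \<Rightarrow> real ^ 'm). rectifying_chart \<iota> f K G \<pi>", OF assms(2) piece]
    by blast
  \<comment> \<open>A single chart inside \<open>A\<close> already forces the image to have positive
    measure.\<close>
  have "hausdorff_measure (real CARD('m)) (f ` A) > 0"
    using piece[OF assms(2) order_refl nA] not_negligible_hausdorff_image[OF assms(1)]
    by (meson zero_less_iff_neq_zero)
  moreover have "hausdorff_measure (real CARD('n)) (A - \<Union>\<K>) = 0"
    using hausdorff_measure_negligible[OF \<K>(3)] by simp
  moreover have "hausdorff_measure (real CARD('n)) K > 0" if "K \<in> \<K>" for K
    using K[OF that] negligible_if_hausdorff_measure_0 by (metis zero_less_iff_neq_zero)
  ultimately show ?thesis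
    using \<K>(1,2) K unfolding rectifying_chart_def by blast
qed

end
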